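(* Let $\Phi:D\to\mathbb{R}^d$ be a $(d+p+1)$-admissible warping function with control weight $v_0$, where $p=0$ if $R_\Phi=\sup_{\xi\in D}\|\mathrm{D}\Phi(\xi)\|=\infty$ and $p\in\mathbb{N}_0$ otherwise. Let $m:\Lambda\times\Lambda\to(0,\infty)$ be a symmetric weight that satisfies $$m((y,\xi),(z,\eta))\le(1+|y-z|)^p\cdot v_1(\Phi(\xi)-\Phi(\eta))\qquad\text{for all }y,z\in\mathbb{R}^d,\ \xi,\eta\in D,$$ for some continuous and submultiplicative weight $v_1:\mathbb{R}^d\to(0,\infty)$ satisfying $v_1(\upsilon)=v_1(-\upsilon)$ for all $\upsilon\in\mathbb{R}^d$. With $$w_2:\mathbb{R}^d\to(0,\infty),\quad\upsilon\mapsto(1+|\upsilon|)^{d+1}\cdot v_1(\upsilon)\cdot[v_0(\upsilon)]^{9d/2+3p+3},$$ assume that $\theta\in C^{d+p+1}(\mathbb{R}^d)$ and $$v_0^n\cdot\frac{\partial^{(d+p+1)-n}}{\partial\upsilon_j^{(d+p+1)-n}}\theta\in L^2_{w_2}(\mathbb{R}^d)\qquad\text{for all }j\in\{1,\dots,d\},\ 0\le n\le d+p+1.$$ Then, with $\Gamma:\Lambda\times\Lambda\to\mathbb{C}$, $((y,\omega),(z,\eta))\mapsto e^{-2\pi i\langle y-z,\omega\rangle}$, and $\mathcal{V}^\delta_\Phi=(V^\delta_{\ell,k})_{\ell,k\in\mathbb{Z}^d}$ the $\Phi$-induced $\delta$-fine covering, $$\|\mathrm{osc}_{\mathcal{V}^\delta_\Phi,\Gamma}\|_{\mathcal{B}_m}<\infty\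 \text{ for all }\delta>0\qquad\text{and}\qquad\|\mathrm{osc}_{\mathcal{V}^\delta_\Phi,\Gamma}\|_{\mathcal{B}_m}\to0\ \text{ as }\delta\to0.$$
   Context: Notation. $|\cdot|$ is the Euclidean norm, $\|\cdot\|$ for matrices the induced operator norm, $B_r(x)$ the open Euclidean ball, $(T_xf)(y)=f(y-x)$, $\widehat f(\xi)=\int f(x)e^{-2\pi i\langle x,\xi\rangle}dx$ with inverse $\mathcal{F}^{-1}$; $B^{-T}$ is the inverse transpose; for a matrix $B$ and a set $M$, $B\langle M\rangle=\{Bx:x\in M\}$; $\delta\cdot M=\{\delta x:x\in M\}$. A weight is a measurable function with values in $(0,\infty)$. $L^p_v(\mathbb{R}^d)$ has norm $\|f\|_{L^p_v}=\|v f\|_{L^p}$. A weight $v$ on $\mathbb{R}^d$ is submultiplicative if $v(\sigma+\tau)\le v(\sigma)v(\tau)$, and radially increasing if $v(\sigma)\le v(\tau)$ whenever $|\sigma|\le|\tau|$. A weight $m$ on $\Lambda\times\Lambda$ is symmetric if $m(\lambda,\rho)=m(\rho,\lambda)$. $D\subset\mathbb{R}^d$ is non-empty and open and $\Lambda=\mathbb{R}^d\times D$ with Lebesgue measure. $k$-admissible warping functions ($k\in\mathbb{N}_0$). A map $\Phi:D\to\mathbb{R}^d$ is a $k$-admissible warping function with control weight $v_0:\mathbb{R}^d\to(0,\infty)$ if $v_0$ is continuous, submultiplicative and radially increasing, $\Phi$ is a $C^{k+1}$-diffeomorphism (onto $\mathbb{R}^d$), $A:=\mathrm{D}\Phi^{-1}$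 has positive determinant everywhere, and with $\phi_\tau(\upsilon):=A^T(\upsilon+\tau)A^{-T}(\tau)$ one has $\|\partial^\alpha\phi_\tau(\upsilon)\|\le v_0(\upsilon)$ for all $\tau,\upsilon\in\mathbb{R}^d$ and all $\alpha\in\mathbb{N}_0^d$ with $|\alpha|\le k$. Warped time-frequency system. Let $w(\tau)=\det A(\tau)$. For $\theta:\mathbb{R}^d\to\mathbb{C}$ in $L^2_{\sqrt w}(\mathbb{R}^d)$ and $(y,\omega)\in\Lambda$, put $g_\omega:=w(\Phi(\omega))^{-1/2}(T_{\Phi(\omega)}\theta)\circ\Phi$, extended by zero from $D$ to $\mathbb{R}^d$, and $g_{y,\omega}:=T_y\mathcal{F}^{-1}g_\omega$. Coverings. The $\Phi$-induced $\delta$-fine covering ($\delta>0$) consists of $V^\delta_{\ell,k}:=A^{-T}(\delta k/\sqrt d)\langle\delta\cdot B_1(\ell/\sqrt d)\rangle\times\Phi^{-1}(\delta\cdot B_1(k/\sqrt d))$, $\ell,k\in\mathbb{Z}^d$. For $\rho\in\Lambda$ let $\mathcal{V}^\delta_\rho$ be the union of all $V^\delta_{\ell,k}$ containing $\rho$. Oscillation. For $\lambda,\rho\in\Lambda$, $\mathrm{osc}_{\mathcal{V}^\delta_\Phi,\Gamma}(\lambda,\rho):=\sup_{\nu\in\mathcal{V}^\delta_\rho}\bigl|\langle g_\lambda,\ g_\rho-\Gamma(\rho,\nu)g_\nu\rangle_{L^2}\bigr|$. Kernel norms. For measurable $L:X\times X\to\mathbb{C}$, $\|L\|_{\mathcal{A}_1(X)}=\max\{\operatorname{ess\,sup}_x\int|L(x,y)|dy,\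 \operatorname{ess\,sup}_y\int|L(x,y)|dx\}$. For $K:\Lambda\times\Lambda\to\mathbb{C}$ measurable, $\|K\|_{\mathcal{B}_m}:=\bigl\|(\omega,\eta)\mapsto\|(y,z)\mapsto (mK)((y,\omega),(z,\eta))\|_{\mathcal{A}_1(\mathbb{R}^d)}\bigr\|_{\mathcal{A}_1(D)}$. *)

theory Defs
  imports "HOL-Analysis.Analysis"
begin

definition partial_deriv ::
    "'n::finite \<Rightarrow> (real^'n \<Rightarrow> 'b::real_normed_vector) \<Rightarrow> real^'n \<Rightarrow> 'b" where
  "partial_deriv j f = (\<lambda>x. frechet_derivative f (at x) (axis j 1))"

text \<open>A multi-index \<open>\<alpha>\<close> is represented by a list in which each coordinate \<open>j\<close> occurs
  \<open>\<alpha>\<^sub>j\<close> times, so \<open>|\<alpha>|\<close> is the length of the list. For C^k functions and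
  \<open>|\<alpha>| \<le> k\<close> the order of the list is irrelevant.\<close>

definition iterated_partial ::
    "'n::finite list \<Rightarrow> (real^'n \<Rightarrow> 'b::real_normed_vector) \<Rightarrow> real^'n \<Rightarrow> 'b" where
  "iterated_partial js f = foldr partial_deriv js f"

text \<open>Only meant for open \<open>U\<close>.\<close>

primrec Ck_on :: "nat \<Rightarrow> (real^'n::finite) set \<Rightarrow> (real^'n \<Rightarrow> 'b::real_normed_vector) \<Rightarrow> bool" where
  "Ck_on 0 U f \<longleftrightarrow> continuous_on U f"
| "Ck_on (Suc k) U f \<longleftrightarrow>
     (\<forall>x\<in>U. f differentiable (at x)) \<and> (\<forall>j. Ck_on k U (partial_deriv j f))"

definition Ck_diffeomorphism_onto_UNIV ::
    "nat \<Rightarrow> (real^'n::finite) set \<Rightarrow> (real^'n \<Rightarrow> real^'n) \<Rightarrow> bool" where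
  "Ck_diffeomorphism_onto_UNIV k D \<Phi> \<longleftrightarrow>
     bij_betw \<Phi> D UNIV \<and> Ck_on k D \<Phi> \<and> Ck_on k UNIV (inv_into D \<Phi>)"

definition weight_on :: "'a::euclidean_space set \<Rightarrow> ('a \<Rightarrow> real) \<Rightarrow> bool" where
  "weight_on X v \<longleftrightarrow> v \<in> borel_measurable (lebesgue_on X) \<and> (\<forall>x\<in>X. 0 < v x)"

definition submultiplicative :: "('a::real_normed_vector \<Rightarrow> real) \<Rightarrow> bool" where
  "submultiplicative v \<longleftrightarrow> (\<forall>\<sigma> \<tau>. v (\<sigma> + \<tau>) \<le> v \<sigma> * v \<tau>)"

definition radially_increasing :: "('a::real_normed_vector \<Rightarrow> real) \<Rightarrow> bool" where
  "radially_increasing v \<longleftrightarrow> (\<forall>\<sigma> \<tau>. norm \<sigma> \<le> norm \<tau> \<longrightarrow> v \<sigma> \<le> v \<tau>)"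

definition L2_weighted :: "('a::euclidean_space \<Rightarrow> real) \<Rightarrow> ('a \<Rightarrow> complex) set" where
  "L2_weighted v = {f \<in> borel_measurable lebesgue.
     (\<integral>\<^sup>+x. ennreal ((norm (v x * f x))\<^sup>2) \<partial>lebesgue) < \<infinity>}"

abbreviation matrix_opnorm :: "real^'n::finite^'n \<Rightarrow> real" where
  "matrix_opnorm B \<equiv> onorm ((*v) B)"

definition inv_transpose :: "real^'n::finite^'n \<Rightarrow> real^'n^'n" where
  "inv_transpose B = matrix_inv (transpose B)"

definition warp_A :: "(real^'n::finite) set \<Rightarrow> (real^'n \<Rightarrow> real^'n) \<Rightarrow> real^'n \<Rightarrow> real^'n^'n" where
  "warp_A D \<Phi> \<tau> = jacobian (inv_into D \<Phi>) (at \<tau>)"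

definition warp_w :: "(real^'n::finite) set \<Rightarrow> (real^'n \<Rightarrow> real^'n) \<Rightarrow> real^'n \<Rightarrow> real" where
  "warp_w D \<Phi> \<tau> = det (warp_A D \<Phi> \<tau>)"

definition warp_phi ::
    "(real^'n::finite) set \<Rightarrow> (real^'n \<Rightarrow> real^'n) \<Rightarrow> real^'n \<Rightarrow> real^'n \<Rightarrow> real^'n^'n" where
  "warp_phi D \<Phi> \<tau> \<upsilon> = transpose (warp_A D \<Phi> (\<upsilon> + \<tau>)) ** inv_transpose (warp_A D \<Phi> \<tau>)"

definition admissible_warping ::
    "nat \<Rightarrow> (real^'n::finite) set \<Rightarrow> (real^'n \<Rightarrow> real^'n) \<Rightarrow> (real^'n \<Rightarrow> real) \<Rightarrow> bool" where
  "admissible_warping k D \<Phi> v\<^sub>0 \<longleftrightarrow>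
     weight_on UNIV v\<^sub>0 \<and> continuous_on UNIV v\<^sub>0 \<and> submultiplicative v\<^sub>0 \<and> radially_increasing v\<^sub>0 \<and>
     Ck_diffeomorphism_onto_UNIV (k + 1) D \<Phi> \<and>
     (\<forall>\<tau>. 0 < det (warp_A D \<Phi> \<tau>)) \<and>
     (\<forall>\<tau> \<upsilon> js. length js \<le> k \<longrightarrow>
        matrix_opnorm (iterated_partial js (warp_phi D \<Phi> \<tau>) \<upsilon>) \<le> v\<^sub>0 \<upsilon>)"

definition warp_R :: "(real^'n::finite) set \<Rightarrow> (real^'n \<Rightarrow> real^'n) \<Rightarrow> ennreal" where
  "warp_R D \<Phi> = (SUP \<xi>\<in>D. ennreal (matrix_opnorm (jacobian \<Phi> (at \<xi>))))"

type_synonym 'n phase = "(real^'n) \<times> (real^'n)"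

definition phase_space :: "(real^'n::finite) set \<Rightarrow> 'n phase set" where
  "phase_space D = UNIV \<times> D"

definition L2_inner :: "('a::euclidean_space \<Rightarrow> complex) \<Rightarrow> ('a \<Rightarrow> complex) \<Rightarrow> complex" where
  "L2_inner f g = (LINT x|lebesgue. f x * cnj (g x))"

definition translate :: "'a::ab_group_add \<Rightarrow> ('a \<Rightarrow> 'b) \<Rightarrow> 'a \<Rightarrow> 'b" where
  "translate x f = (\<lambda>y. f (y - x))"

text \<open>The integral formula determines the inverse Fourier transform of integrable functions. This
  covers the \<open>warped_window\<close>s below when the prototype satisfies
  \<open>\<integral> |\<theta>| v\<^sub>0\<^sup>d < \<infinity>\<close>; if they are also square-integrable, it agrees with
  the Plancherel transform.\<close>

definition inv_fourier :: "('a::euclidean_space \<Rightarrow> complex) \<Rightarrow> 'a \<Rightarrow> complex" where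
  "inv_fourier f x = (LINT \<xi>|lebesgue. f \<xi> * exp (2 * of_real pi * \<i> * of_real (x \<bullet> \<xi>)))"

definition warped_window ::
    "(real^'n::finite) set \<Rightarrow> (real^'n \<Rightarrow> real^'n) \<Rightarrow> (real^'n \<Rightarrow> complex) \<Rightarrow>
     real^'n \<Rightarrow> real^'n \<Rightarrow> complex" where
  "warped_window D \<Phi> \<theta> \<omega> =
     (\<lambda>\<xi>. if \<xi> \<in> D
           then of_real (warp_w D \<Phi> (\<Phi> \<omega>) powr (-1/2)) * translate (\<Phi> \<omega>) \<theta> (\<Phi> \<xi>)
           else 0)"

definition warped_atom ::
    "(real^'n::finite) set \<Rightarrow> (real^'n \<Rightarrow> real^'n) \<Rightarrow> (real^'n \<Rightarrow> complex) \<Rightarrow>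
     'n phase \<Rightarrow> real^'n \<Rightarrow> complex" where
  "warped_atom D \<Phi> \<theta> = (\<lambda>(y, \<omega>). translate y (inv_fourier (warped_window D \<Phi> \<theta> \<omega>)))"

definition lattice_point :: "int^'n::finite \<Rightarrow> real^'n" where
  "lattice_point k = (\<chi> i. real_of_int (k $ i) / sqrt (real CARD('n)))"

definition scaled_ball :: "real \<Rightarrow> int^'n::finite \<Rightarrow> (real^'n) set" where
  "scaled_ball \<delta> k = (\<lambda>x. \<delta> *\<^sub>R x) ` ball (lattice_point k) 1"

definition induced_cover ::
    "(real^'n::finite) set \<Rightarrow> (real^'n \<Rightarrow> real^'n) \<Rightarrow> real \<Rightarrow>
     int^'n \<Rightarrow> int^'n \<Rightarrow> 'n phase set" where
  "induced_cover D \<Phi> \<delta> l k =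
     ((*v) (inv_transpose (warp_A D \<Phi> (\<delta> *\<^sub>R lattice_point k))) ` scaled_ball \<delta> l) \<times>
     (inv_into D \<Phi> ` scaled_ball \<delta> k)"

definition cover_neighbourhood ::
    "(int^'n::finite \<Rightarrow> int^'n \<Rightarrow> 'n phase set) \<Rightarrow>
     'n phase \<Rightarrow> 'n phase set" where
  "cover_neighbourhood V \<rho> = \<Union> {V l k | l k. \<rho> \<in> V l k}"

definition osc ::
    "(real^'n::finite) set \<Rightarrow> (real^'n \<Rightarrow> real^'n) \<Rightarrow> (real^'n \<Rightarrow> complex) \<Rightarrow>
     (int^'n \<Rightarrow> int^'n \<Rightarrow> 'n phase set) \<Rightarrow>
     ('n phase \<Rightarrow> 'n phase \<Rightarrow> complex) \<Rightarrow>
     'n phase \<Rightarrow> 'n phase \<Rightarrow> ennreal" where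
  "osc D \<Phi> \<theta> V \<Gamma> \<kappa> \<rho> =
     (SUP \<nu>\<in>cover_neighbourhood V \<rho>.
        ennreal (cmod (L2_inner (warped_atom D \<Phi> \<theta> \<kappa>)
          (\<lambda>x. warped_atom D \<Phi> \<theta> \<rho> x - \<Gamma> \<rho> \<nu> * warped_atom D \<Phi> \<theta> \<nu> x))))"

text \<open>The norms are defined for \<open>[0,\<infinity>]\<close>-valued kernels, to be thought of as the absolute value
  of a kernel. Unlike \<open>esssup\<close> of HOL-Probability, the essential supremum here is not set to
  \<open>\<infinity>\<close> on non-measurable functions.\<close>

definition ess_sup :: "'a measure \<Rightarrow> ('a \<Rightarrow> ennreal) \<Rightarrow> ennreal" where
  "ess_sup M f = Inf {c. AE x in M. f x \<le> c}"

definition A1_norm :: "'a measure \<Rightarrow> ('a \<Rightarrow> 'a \<Rightarrow> ennreal) \<Rightarrow> ennreal" where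
  "A1_norm M L = max (ess_sup M (\<lambda>x. \<integral>\<^sup>+y. L x y \<partial>M)) (ess_sup M (\<lambda>y. \<integral>\<^sup>+x. L x y \<partial>M))"

definition Bm_norm ::
    "(real^'n::finite) set \<Rightarrow> ('n phase \<Rightarrow> 'n phase \<Rightarrow> real) \<Rightarrow>
     ('n phase \<Rightarrow> 'n phase \<Rightarrow> ennreal) \<Rightarrow> ennreal" where
  "Bm_norm D m K =
     A1_norm (lebesgue_on D)
       (\<lambda>\<omega> \<eta>. A1_norm lebesgue (\<lambda>y z. ennreal (m (y, \<omega>) (z, \<eta>)) * K (y, \<omega>) (z, \<eta>)))"

end

theory Submission
  imports Defs "HOL-Probability.Probability"
begin

text \<open>By Plancherel's theorem and the substitution \<open>\<xi> = \<Phi>\<^sup>-\<^sup>1(\<tau> + \<Phi>(\<eta>))\<close>, the inner product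
  \<open>\<langle>g\<^sub>\<lambda>, g\<^sub>\<rho> - \<Gamma> g\<^sub>\<nu>\<rangle>\<close> becomes an oscillatory integral whose phase has gradient
  \<open>e = \<phi>\<^sub>\<tau>(\<cdot>) x'\<close> with \<open>x' = A\<^sup>T(\<Phi>(\<eta>)) (z - y)\<close>. Admissibility says that, relative to \<open>|e|\<close>, every
  derivative of \<open>e\<close> costs at most a factor \<open>v\<^sub>0\<^sup>2\<close>, and that \<open>|e| \<ge> |x'| / v\<^sub>0\<close>. The smooth partition
  \<open>1 = \<Sum>\<^sub>j e\<^sub>j\<^sup>2\<^sup>N / \<Sum>\<^sub>k e\<^sub>k\<^sup>2\<^sup>N\<close> then allows one to integrate the \<open>j\<close>-th piece by parts \<open>N = d + p + 1\<close> times
  in the \<open>j\<close>-th direction only; so only the pure derivatives of \<open>\<theta>\<close> occur, and the total loss is \<open>v\<^sub>0\<^sup>3\<^sup>N\<close>.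
  This gives decay \<open>(1 + |x'|)\<^sup>-\<^sup>N\<close> times a correlation of \<open>\<theta>\<close> with its local oscillation. The supremum
  over \<open>\<nu>\<close> is only a supremum over small translations; splitting the correlation by the weighted
  arithmetic-geometric mean inequality removes it before integrating, and leaves a quantity that is
  finite by the \<open>L\<^sup>2\<close> hypotheses and tends to zero with \<open>\<delta>\<close> because the derivatives of \<open>\<theta>\<close> are continuous.\<close>

section \<open>Plancherel's theorem with a Gaussian cutoff\<close>

text \<open>The exponent 9d/2 + 3p + 3 of \<open>v\<^sub>0\<close> is 3N + d + d/2: besides the loss
  3N, d comes from the Jacobian factor det \<phi> of the substitution and d/2 from the ratio
  sqrt(w(\<Phi>(\<eta>)) / w(\<Phi>(\<omega>))) of the normalisations. This ratio and
  \<open>v\<^sub>1\<close> depend on u = \<Phi>(\<eta>) - \<Phi>(\<omega>) and are distributed over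
  the points t + u and t by submultiplicativity. Of the N powers of decay, p pay for the factor (1 +
  |y - z|)^p in the bound for m, and d + 1 make the integral over the time variable converge.

  The oscillation is a supremum over an uncountable set. Instead of proving it measurable, the
  argument dominates it by Borel functions, and monotonicity of the nonnegative integral carries the
  bound through the nested norms. The majorant must not depend on \<nu>; this is why the shift, the
  phase size and the normalisation ratio produced by \<nu> finally enter through upper bounds alone.
  The factor \<Gamma> normalises the atom at \<nu> so that its relative phase vanishes at the centre
  of the substitution.\<close>

lemma
  fixes f :: "'a::euclidean_space \<Rightarrow> real \<Rightarrow> complex"
  assumes f: "\<And>b. b \<in> Basis \<Longrightarrow> integrable lborel (f b)"
  shows integrable_lborel_prod: "integrable lborel (\<lambda>x. \<Prod>b\<in>Basis. f b (x \<bullet> b))"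
    and integral_lborel_prod: "(LINT x|lborel. (\<Prod>b\<in>Basis. f b (x \<bullet> b))) = (\<Prod>b\<in>Basis. LINT x|lborel. f b x)"
proof -
  interpret product_sigma_finite "\<lambda>_::'a. lborel :: real measure" ..
  let ?S = "\<lambda>g. \<Sum>b\<in>Basis. g b *\<^sub>R (b::'a)"
  have coord: "?S g \<bullet> b = g b" if "b \<in> Basis" for g and b :: 'a
    using that by (simp add: inner_sum_left inner_Basis if_distrib[of "\<lambda>x. _ * x"] cong: if_cong)
  have [measurable]: "?S \<in> Pi\<^sub>M Basis (\<lambda>_. lborel) \<rightarrow>\<^sub>M borel" by measurable
  have [measurable]: "f b \<in> borel_measurable borel" if "b \<in> Basis" for b
    using borel_measurable_integrable[OF f[OF that]] by simp
  have m: "(\<lambda>x. \<Prod>b\<in>Basis. f b (x \<bullet> b)) \<in> borel_measurable borel" by measurable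
  have eq: "(\<Prod>b\<in>Basis. f b (?S g \<bullet> b)) = (\<Prod>b\<in>Basis. f b (g b))" for g
    by (intro prod.cong refl) (simp add: coord)
  have i: "integrable (Pi\<^sub>M Basis (\<lambda>_. lborel)) (\<lambda>g. \<Prod>b\<in>Basis. f b (g b))"
    by (rule product_integrable_prod) (auto intro: f)
  show "integrable lborel (\<lambda>x. \<Prod>b\<in>Basis. f b (x \<bullet> b))"
    by (subst lborel_eq, subst integrable_distr_eq) (use m i in \<open>simp_all add: eq\<close>)
  have "(LINT x|lborel. (\<Prod>b\<in>Basis. f b (x \<bullet> b))) =
      (LINT g|Pi\<^sub>M Basis (\<lambda>_. lborel). (\<Prod>b\<in>Basis. f b (?S g \<bullet> b)))"
    by (subst lborel_eq, subst integral_distr) (use m in simp_all)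
  also have "\<dots> = (\<Prod>b\<in>Basis. LINT x|lborel. f b x)"
    unfolding eq by (rule product_integral_prod) (auto intro: f)
  finally show "(LINT x|lborel. (\<Prod>b\<in>Basis. f b (x \<bullet> b))) = (\<Prod>b\<in>Basis. LINT x|lborel. f b x)" .
qed

text \<open>The standard normal density of the space. The product form lets the one-dimensional
  normal distribution supply the total mass and, through its characteristic function, the Fourier
  transform.\<close>

definition gauss :: "'a::euclidean_space \<Rightarrow> real" where
  "gauss x = (\<Prod>b\<in>Basis. std_normal_density (x \<bullet> b))"

lemma gauss_nonneg: "0 \<le> gauss x"
  by (simp add: gauss_def prod_nonneg)

lemma continuous_gauss: "continuous_on A (gauss :: 'a::euclidean_space \<Rightarrow> real)"
  unfolding gauss_def[abs_def] std_normal_density_def by (intro continuous_intros) auto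

lemma borel_gauss [measurable]: "gauss \<in> borel_measurable borel"
  by (intro borel_measurable_continuous_onI continuous_gauss)

lemma exp_norm_eq_gauss:
  "exp (- (norm x)\<^sup>2 / 2) = sqrt (2 * pi) ^ DIM('a) * gauss (x::'a::euclidean_space)"
proof -
  have "gauss x = (\<Prod>b\<in>(Basis::'a set). 1 / sqrt (2 * pi)) * (\<Prod>b\<in>Basis. exp (- (x \<bullet> b)\<^sup>2 / 2))"
    unfolding gauss_def std_normal_density_def prod.distrib ..
  also have "(\<Prod>b\<in>Basis. exp (- (x \<bullet> b)\<^sup>2 / 2)) = exp (\<Sum>b\<in>Basis. - (x \<bullet> b)\<^sup>2 / 2)"
    by (simp add: exp_sum)
  also have "(\<Sum>b\<in>Basis. - (x \<bullet> b)\<^sup>2 / 2) = - (norm x)\<^sup>2 / 2"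
    unfolding power2_norm_eq_inner by (subst euclidean_inner) (simp add: sum_negf sum_divide_distrib[symmetric] power2_eq_square)
  finally show ?thesis by (simp add: power_one_over field_simps)
qed

lemma
  fixes t :: "'a::euclidean_space"
  shows integrable_gauss_cis: "integrable lborel (\<lambda>x. complex_of_real (gauss x) * exp (\<i> * of_real (x \<bullet> t)))"
    and gauss_fourier: "(LINT x|lborel. complex_of_real (gauss x) * exp (\<i> * of_real (x \<bullet> t))) = of_real (exp (- (norm t)\<^sup>2 / 2))"
proof -
  let ?f = "\<lambda>b x. complex_of_real (std_normal_density x) * exp (\<i> * of_real (x * (t \<bullet> b)))"
  have i: "integrable lborel (?f b)" for b
    by (rule Bochner_Integration.integrable_bound[OF integrable_normal_density[of 1 0]]) (auto simp: norm_mult)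
  have int: "(LINT x|lborel. ?f b x) = of_real (exp (- (t \<bullet> b)\<^sup>2 / 2))" for b
  proof -
    have "char std_normal_distribution (t \<bullet> b) = (LINT x|lborel. ?f b x)"
      unfolding char_def
      by (subst integral_density) (auto simp: scaleR_conv_of_real mult.commute intro!: Bochner_Integration.integral_cong)
    then show ?thesis by (simp add: char_std_normal_distribution)
  qed
  have eq: "(\<Prod>b\<in>Basis. ?f b (x \<bullet> b)) = complex_of_real (gauss x) * exp (\<i> * of_real (x \<bullet> t))" for x
  proof -
    have "(\<Prod>b\<in>Basis. ?f b (x \<bullet> b)) = of_real (gauss x) * exp (\<Sum>b\<in>Basis. \<i> * of_real (x \<bullet> b * (t \<bullet> b)))"
      by (simp add: prod.distrib gauss_def exp_sum)
    also have "(\<Sum>b\<in>Basis. \<i> * of_real (x \<bullet> b * (t \<bullet> b))) = \<i> * of_real (x \<bullet> t)"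
      by (subst euclidean_inner[of x t]) (simp add: sum_distrib_left)
    finally show ?thesis .
  qed
  show "integrable lborel (\<lambda>x. complex_of_real (gauss x) * exp (\<i> * of_real (x \<bullet> t)))"
    using integrable_lborel_prod[of ?f, OF i] unfolding eq .
  have "(LINT x|lborel. complex_of_real (gauss x) * exp (\<i> * of_real (x \<bullet> t))) = (\<Prod>b\<in>Basis. of_real (exp (- (t \<bullet> b)\<^sup>2 / 2)))"
    using integral_lborel_prod[of ?f, OF i] unfolding eq int .
  also have "\<dots> = of_real (exp (\<Sum>b\<in>Basis. - (t \<bullet> b)\<^sup>2 / 2))" by (simp add: exp_sum)
  also have "(\<Sum>b\<in>Basis. - (t \<bullet> b)\<^sup>2 / 2) = - (norm t)\<^sup>2 / 2"
    unfolding power2_norm_eq_inner by (subst euclidean_inner) (simp add: sum_negf sum_divide_distrib[symmetric] power2_eq_square)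
  finally show "(LINT x|lborel. complex_of_real (gauss x) * exp (\<i> * of_real (x \<bullet> t))) = of_real (exp (- (norm t)\<^sup>2 / 2))" .
qed

lemma integrable_gauss: "integrable lborel (gauss :: 'a::euclidean_space \<Rightarrow> real)"
  using integrable_gauss_cis[of "0::'a"] by (simp add: complex_of_real_integrable_eq)

lemma integral_gauss: "(LINT x|lborel. gauss (x::'a::euclidean_space)) = 1"
  using gauss_fourier[of "0::'a"] by (simp add: integral_complex_of_real)

text \<open>The integral formula requires no integrability: integrability is invariant under the
  affine map, and where it fails both integrals are 0 by convention.\<close>

lemma
  fixes f :: "'a::euclidean_space \<Rightarrow> 'b::{banach,second_countable_topology}"
  assumes c: "c \<noteq> 0"
  shows lborel_integral_affine: "(LINT x|lborel. f x) = \<bar>c\<bar> ^ DIM('a) *\<^sub>R (LINT x|lborel. f (t + c *\<^sub>R x))"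
    and lborel_integrable_affine: "integrable lborel (\<lambda>x. f (t + c *\<^sub>R x)) \<longleftrightarrow> integrable lborel f"
proof -
  have imp: "integrable lborel (\<lambda>x. f (t + c *\<^sub>R x))" if f: "integrable lborel f" and c: "c \<noteq> 0" for f :: "'a \<Rightarrow> 'b" and c t
  proof -
    have [measurable]: "f \<in> borel_measurable borel" using borel_measurable_integrable[OF f] by simp
    have "integrable (density (distr lborel borel (\<lambda>x. t + c *\<^sub>R x)) (\<lambda>_. \<bar>c\<bar> ^ DIM('a))) f"
      using f lborel_affine[OF c, of t] by simp
    then have "integrable lborel (\<lambda>x. \<bar>c\<bar> ^ DIM('a) *\<^sub>R f (t + c *\<^sub>R x))"
      using c by (subst (asm) integrable_density) (auto simp: integrable_distr_eq)
    from integrable_scaleR_right[OF this, of "inverse (\<bar>c\<bar> ^ DIM('a))"] show ?thesis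
      using c by simp
  qed
  show iff: "integrable lborel (\<lambda>x. f (t + c *\<^sub>R x)) \<longleftrightarrow> integrable lborel f"
    using imp[of f c t] imp[of "\<lambda>x. f (t + c *\<^sub>R x)" "1 / c" "- t /\<^sub>R c"] c by (auto simp: algebra_simps)
  show "(LINT x|lborel. f x) = \<bar>c\<bar> ^ DIM('a) *\<^sub>R (LINT x|lborel. f (t + c *\<^sub>R x))"
  proof (cases "integrable lborel f")
    case True
    then have [measurable]: "f \<in> borel_measurable borel" using borel_measurable_integrable by force
    show ?thesis
      by (subst lborel_affine[OF c, of t]) (simp add: integral_density integral_distr)
  next
    case False
    then show ?thesis using iff by (simp add: not_integrable_integral_eq)
  qed
qed

text \<open>Stands in for the Cauchy-Schwarz inequality for integrals; the free parameter decides
  which of the two squares is made small.\<close>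

lemma mult_le_sum_squares:
  fixes a b \<kappa> :: real
  assumes "0 < \<kappa>"
  shows "a * b \<le> (\<kappa> * a\<^sup>2 + b\<^sup>2 / \<kappa>) / 2"
proof -
  have "0 \<le> (\<kappa> * a - b)\<^sup>2 / \<kappa>" using assms by simp
  also have "(\<kappa> * a - b)\<^sup>2 / \<kappa> = \<kappa> * a\<^sup>2 + b\<^sup>2 / \<kappa> - 2 * (a * b)"
    using assms by (simp add: field_simps power2_eq_square)
  finally show ?thesis by simp
qed

lemma integrable_mult_square_integrable:
  fixes f h :: "'a \<Rightarrow> complex"
  assumes [measurable]: "f \<in> borel_measurable M" "h \<in> borel_measurable M"
    and "integrable M (\<lambda>x. (norm (f x))\<^sup>2)" "integrable M (\<lambda>x. (norm (h x))\<^sup>2)"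
  shows "integrable M (\<lambda>x. f x * cnj (h x))"
proof (rule Bochner_Integration.integrable_bound)
  show "integrable M (\<lambda>x. (norm (f x))\<^sup>2 + (norm (h x))\<^sup>2)" using assms by simp
  show "(\<lambda>x. f x * cnj (h x)) \<in> borel_measurable M"
    by (intro borel_measurable_times measurable_compose[OF assms(2) borel_measurable_continuous_onI[of cnj]] assms)
       (intro continuous_intros)
  have "norm (f x) * norm (h x) \<le> (norm (f x))\<^sup>2 + (norm (h x))\<^sup>2" for x
    using mult_le_sum_squares[of 1 "norm (f x)" "norm (h x)"] by (simp add: field_simps) (smt (verit) zero_le_power2)
  then show "AE x in M. norm (f x * cnj (h x)) \<le> norm ((norm (f x))\<^sup>2 + (norm (h x))\<^sup>2)"
    by (auto simp: norm_mult)
qed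

text \<open>In the application \<open>h\<close> is built from warped windows extended by zero, which
  may jump at the boundary of \<open>D\<close>; continuity is available on \<open>D\<close>, and off
  \<open>D\<close> the factor \<open>f\<close> vanishes. Dominated convergence needs a bounded
  second factor, so \<open>h\<close> is truncated radially to \<open>hn n\<close>. The remainder
  \<open>r n\<close> is small in L^2 uniformly in the translations, because the integral of its
  square is translation invariant.\<close>

lemma correlation_tendsto:
  fixes f h :: "'a::euclidean_space \<Rightarrow> complex"
  assumes D: "open D" "continuous_on D h" and f0: "\<And>x. x \<notin> D \<Longrightarrow> f x = 0"
    and f: "integrable lborel f" and f2: "integrable lborel (\<lambda>x. (norm (f x))\<^sup>2)"
    and hm[measurable]: "h \<in> borel_measurable borel" and h2: "integrable lborel (\<lambda>x. (norm (h x))\<^sup>2)"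
    and y: "y \<longlonglongrightarrow> 0"
  shows "(\<lambda>k. LINT x|lborel. f x * cnj (h (x - y k))) \<longlonglongrightarrow> (LINT x|lborel. f x * cnj (h x))"
proof -
  have [measurable]: "f \<in> borel_measurable borel" using borel_measurable_integrable[OF f] by simp
  have [measurable]: "cnj \<in> borel_measurable borel"
    by (intro borel_measurable_continuous_onI continuous_intros)
  have shift: "integrable lborel (\<lambda>x. g (x - c)) \<longleftrightarrow> integrable lborel g" "(LINT x|lborel. g (x - c)) = (LINT x|lborel. g x)"
    for g :: "'a \<Rightarrow> 'b::{banach,second_countable_topology}" and c
    using lborel_integrable_affine[of 1 g "- c"] lborel_integral_affine[of 1 g "- c"] by simp_all
  define hn where "hn n x = (real (Suc n) / max (real (Suc n)) (norm (h x))) *\<^sub>R h x" for n x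
  define r where "r n x = norm (h x - hn n x)" for n x
  have [measurable]: "hn n \<in> borel_measurable borel" for n unfolding hn_def[abs_def] by measurable
  have [measurable]: "r n \<in> borel_measurable borel" for n unfolding r_def[abs_def] by measurable
  have hn_le: "norm (hn n x) \<le> Suc n" for n x
  proof -
    have "norm (h x) / max (real (Suc n)) (norm (h x)) \<le> 1" by (auto simp: divide_le_eq)
    then have "real (Suc n) * (norm (h x) / max (real (Suc n)) (norm (h x))) \<le> real (Suc n) * 1"
      by (intro mult_left_mono) auto
    then show ?thesis unfolding hn_def by (simp add: max_def)
  qed
  have r_le: "r n x \<le> norm (h x)" for n x
  proof -
    define t where "t = real (Suc n) / max (real (Suc n)) (norm (h x))"
    have t: "0 \<le> t" "t \<le> 1" unfolding t_def by auto
    have "r n x = norm ((1 - t) *\<^sub>R h x)" unfolding r_def hn_def t_def[symmetric] by (simp add: algebra_simps)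
    also have "\<dots> \<le> norm (h x)" using t by (simp add: mult_left_le_one_le)
    finally show ?thesis .
  qed
  have r2: "integrable lborel (\<lambda>x. (r n x)\<^sup>2)" for n
    by (rule Bochner_Integration.integrable_bound[OF h2])
       (use r_le in \<open>auto intro!: AE_I2 power_mono simp: r_def abs_le_square_iff[symmetric]\<close>)
  have r_lim: "(\<lambda>n. LINT x|lborel. (r n x)\<^sup>2) \<longlonglongrightarrow> (LINT x|(lborel :: 'a measure). 0)"
  proof (rule integral_dominated_convergence[OF _ _ h2])
    show "AE x in lborel. (\<lambda>n. (r n x)\<^sup>2) \<longlonglongrightarrow> 0"
    proof (rule AE_I2)
      fix x
      obtain N where N: "norm (h x) \<le> real N" using real_arch_simple by blast
      have "r n x = 0" if "n \<ge> N" for n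
      proof -
        have "max (real (Suc n)) (norm (h x)) = real (Suc n)" using N that by (intro max_absorb1) linarith
        then show ?thesis unfolding r_def hn_def by simp
      qed
      then show "(\<lambda>n. (r n x)\<^sup>2) \<longlonglongrightarrow> 0"
        by (intro tendsto_eventually eventually_sequentiallyI[of N]) simp
    qed
  qed (use r_le in \<open>auto intro!: AE_I2 power_mono simp: r_def abs_le_square_iff[symmetric]\<close>)
  have hn_lim: "(\<lambda>k. LINT x|lborel. norm (f x) * norm (hn n (x - y k) - hn n x)) \<longlonglongrightarrow> (LINT x|(lborel :: 'a measure). 0)" for n
  proof (rule integral_dominated_convergence[where w="\<lambda>x. norm (f x) * (2 * Suc n)"])
    show "integrable lborel (\<lambda>x. norm (f x) * (2 * Suc n))" using f by simp
    show "AE x in lborel. (\<lambda>k. norm (f x) * norm (hn n (x - y k) - hn n x)) \<longlonglongrightarrow> 0"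
    proof (rule AE_I2)
      fix x
      show "(\<lambda>k. norm (f x) * norm (hn n (x - y k) - hn n x)) \<longlonglongrightarrow> 0"
      proof (cases "x \<in> D")
        case True
        have "continuous_on D (hn n)" unfolding hn_def by (intro continuous_intros D) auto
        then have "isCont (hn n) x" using D True continuous_on_eq_continuous_at by blast
        moreover have "(\<lambda>k. x - y k) \<longlonglongrightarrow> x" using tendsto_diff[OF tendsto_const y, of x] by simp
        ultimately have "(\<lambda>k. hn n (x - y k)) \<longlonglongrightarrow> hn n x" by (rule isCont_tendsto_compose)
        then have "(\<lambda>k. norm (f x) * norm (hn n (x - y k) - hn n x)) \<longlonglongrightarrow> norm (f x) * norm (hn n x - hn n x)"
          by (intro tendsto_intros)
        then show ?thesis by simp
      qed (simp add: f0)
    qed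
    show "AE x in lborel. norm (norm (f x) * norm (hn n (x - y k) - hn n x)) \<le> norm (f x) * (2 * Suc n)" for k
    proof (rule AE_I2)
      fix x
      have "norm (hn n (x - y k) - hn n x) \<le> 2 * Suc n"
        using norm_triangle_ineq4[of "hn n (x - y k)" "hn n x"] hn_le[of n "x - y k"] hn_le[of n x] by simp
      then show "norm (norm (f x) * norm (hn n (x - y k) - hn n x)) \<le> norm (f x) * (2 * Suc n)"
        by (simp add: mult_left_mono)
    qed
  qed auto
  have hy2: "integrable lborel (\<lambda>x. (norm (h (x - c)))\<^sup>2)" for c
    using shift(1)[of "\<lambda>x. (norm (h x))\<^sup>2"] h2 by simp
  have ifh: "integrable lborel (\<lambda>x. f x * cnj (h (x - c)))" for c
    by (rule integrable_mult_square_integrable) (use f2 hy2 in auto)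
  have ifh0: "integrable lborel (\<lambda>x. f x * cnj (h x))" using ifh[of 0] by simp
  have bound: "norm ((LINT x|lborel. f x * cnj (h (x - y k))) - (LINT x|lborel. f x * cnj (h x)))
     \<le> \<kappa> * (LINT x|lborel. (norm (f x))\<^sup>2) + (LINT x|lborel. (r n x)\<^sup>2) / \<kappa>
        + (LINT x|lborel. norm (f x) * norm (hn n (x - y k) - hn n x))" if \<kappa>: "0 < \<kappa>" for k n \<kappa>
  proof -
    have ri: "integrable lborel (\<lambda>x. (r n (x - y k))\<^sup>2)" using shift(1)[of "\<lambda>x. (r n x)\<^sup>2"] r2 by simp
    have hi: "integrable lborel (\<lambda>x. norm (f x) * norm (hn n (x - y k) - hn n x))"
    proof (rule Bochner_Integration.integrable_bound)
      show "integrable lborel (\<lambda>x. norm (f x) * (2 * Suc n))" using f by simp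
      show "AE x in lborel. norm (norm (f x) * norm (hn n (x - y k) - hn n x)) \<le> norm (norm (f x) * (2 * Suc n))"
      proof (rule AE_I2)
        fix x
        have "norm (hn n (x - y k) - hn n x) \<le> 2 * Suc n"
          using norm_triangle_ineq4[of "hn n (x - y k)" "hn n x"] hn_le[of n "x - y k"] hn_le[of n x] by simp
        then show "norm (norm (f x) * norm (hn n (x - y k) - hn n x)) \<le> norm (norm (f x) * (2 * Suc n))"
          by (simp add: mult_left_mono abs_mult)
      qed
    qed auto
    have "norm ((LINT x|lborel. f x * cnj (h (x - y k))) - (LINT x|lborel. f x * cnj (h x)))
       = norm (LINT x|lborel. f x * cnj (h (x - y k)) - f x * cnj (h x))"
      using ifh ifh0 by (subst Bochner_Integration.integral_diff) auto
    also have "\<dots> \<le> (LINT x|lborel. norm (f x * cnj (h (x - y k)) - f x * cnj (h x)))"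
      by (rule integral_norm_bound)
    also have "\<dots> \<le> (LINT x|lborel. \<kappa> * (norm (f x))\<^sup>2 + (r n (x - y k))\<^sup>2 / (2 * \<kappa>) + (r n x)\<^sup>2 / (2 * \<kappa>)
        + norm (f x) * norm (hn n (x - y k) - hn n x))"
    proof (rule integral_mono)
      show "integrable lborel (\<lambda>x. norm (f x * cnj (h (x - y k)) - f x * cnj (h x)))"
        using ifh ifh0 by (intro integrable_norm Bochner_Integration.integrable_diff)
      show "integrable lborel (\<lambda>x. \<kappa> * (norm (f x))\<^sup>2 + (r n (x - y k))\<^sup>2 / (2 * \<kappa>) + (r n x)\<^sup>2 / (2 * \<kappa>)
        + norm (f x) * norm (hn n (x - y k) - hn n x))"
        using f2 ri r2 hi by simp
      fix x
      have "norm (f x * cnj (h (x - y k)) - f x * cnj (h x)) = norm (f x) * norm (h (x - y k) - h x)"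
        by (metis complex_cnj_diff complex_mod_cnj norm_mult right_diff_distrib)
      also have "\<dots> \<le> norm (f x) * (r n (x - y k) + r n x + norm (hn n (x - y k) - hn n x))"
        unfolding r_def by (intro mult_left_mono) (norm, simp)
      finally have "norm (f x * cnj (h (x - y k)) - f x * cnj (h x)) \<le>
         norm (f x) * r n (x - y k) + norm (f x) * r n x + norm (f x) * norm (hn n (x - y k) - hn n x)"
        by (simp only: distrib_left)
      then show "norm (f x * cnj (h (x - y k)) - f x * cnj (h x)) \<le> \<kappa> * (norm (f x))\<^sup>2 + (r n (x - y k))\<^sup>2 / (2 * \<kappa>) + (r n x)\<^sup>2 / (2 * \<kappa>)
        + norm (f x) * norm (hn n (x - y k) - hn n x)"
        using mult_le_sum_squares[OF \<kappa>, of "norm (f x)" "r n (x - y k)"] mult_le_sum_squares[OF \<kappa>, of "norm (f x)" "r n x"]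
        by (simp add: add_divide_distrib)
    qed
    also have "\<dots> = \<kappa> * (LINT x|lborel. (norm (f x))\<^sup>2) + (LINT x|lborel. (r n (x - y k))\<^sup>2) / (2 * \<kappa>)
        + (LINT x|lborel. (r n x)\<^sup>2) / (2 * \<kappa>) + (LINT x|lborel. norm (f x) * norm (hn n (x - y k) - hn n x))"
      using f2 ri r2 hi by simp
    also have "(LINT x|lborel. (r n (x - y k))\<^sup>2) = (LINT x|lborel. (r n x)\<^sup>2)"
      by (rule shift(2)[of "\<lambda>x. (r n x)\<^sup>2"])
    finally show ?thesis using \<kappa> by (simp add: field_simps)
  qed
  show ?thesis
  proof (rule LIMSEQ_I)
    fix e :: real assume e: "0 < e"
    define F where "F = (LINT x|lborel. (norm (f x))\<^sup>2)"
    have F: "0 \<le> F" unfolding F_def by (rule Bochner_Integration.integral_nonneg) simp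
    \<comment> \<open>The order of the choices matters: the remainder enters divided by \<kappa>, so
      \<kappa> comes first, then the truncation level \<open>n\<close>, then \<open>K\<close>, which
      depends on \<open>n\<close>.\<close>
    define \<kappa> where "\<kappa> = e / (3 * (F + 1))"
    have \<kappa>: "0 < \<kappa>" using e F by (simp add: \<kappa>_def)
    have 1: "\<kappa> * F < e / 3" using e F by (simp add: \<kappa>_def field_simps)
    have "eventually (\<lambda>n. (LINT x|lborel. (r n x)\<^sup>2) < \<kappa> * (e / 3)) sequentially"
      using r_lim e \<kappa> by (intro order_tendstoD(2)) auto
    then obtain n where n: "(LINT x|lborel. (r n x)\<^sup>2) < \<kappa> * (e / 3)" by (auto simp: eventually_sequentially)
    then have 2: "(LINT x|lborel. (r n x)\<^sup>2) / \<kappa> < e / 3" using \<kappa> by (simp add: field_simps)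
    have "eventually (\<lambda>k. (LINT x|lborel. norm (f x) * norm (hn n (x - y k) - hn n x)) < e / 3) sequentially"
      using hn_lim[of n] e by (intro order_tendstoD(2)) auto
    then obtain K where K: "(LINT x|lborel. norm (f x) * norm (hn n (x - y k) - hn n x)) < e / 3" if "k \<ge> K" for k
      by (auto simp: eventually_sequentially)
    show "\<exists>K. \<forall>k\<ge>K. norm ((LINT x|lborel. f x * cnj (h (x - y k))) - (LINT x|lborel. f x * cnj (h x))) < e"
    proof (intro exI allI impI)
      fix k assume "K \<le> k"
      from bound[OF \<kappa>, of k n] K[OF this] 1 2
      show "norm ((LINT x|lborel. f x * cnj (h (x - y k))) - (LINT x|lborel. f x * cnj (h x))) < e"
        unfolding F_def by linarith
    qed
  qed
qed

text \<open>A product majorant is the form in which absolute convergence is checked before integrals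
  are exchanged.\<close>

lemma integrable_pair_bound:
  fixes F :: "'a::euclidean_space \<times> 'b::euclidean_space \<Rightarrow> 'c::{banach,second_countable_topology}"
  assumes [measurable]: "F \<in> borel_measurable (lborel \<Otimes>\<^sub>M lborel)"
    and u: "integrable lborel u" and v: "integrable lborel v"
    and le: "\<And>x y. norm (F (x, y)) \<le> u x * v y"
  shows "integrable (lborel \<Otimes>\<^sub>M lborel) F"
proof (rule lborel_pair.Fubini_integrable)
  have int: "integrable lborel (\<lambda>y. norm (F (x, y)))" for x
    by (rule Bochner_Integration.integrable_bound[OF integrable_mult_right[OF v, of "u x"]])
       (use order_trans[OF le abs_ge_self] in auto)
  have "integrable lborel (\<lambda>y. F (x, y))" for x
    by (subst integrable_norm_iff[symmetric]) (use int in auto)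
  then show "AE x in lborel. integrable lborel (\<lambda>y. F (x, y))" by auto
  show "integrable lborel (\<lambda>x. LINT y|lborel. norm (F (x, y)))"
  proof (rule Bochner_Integration.integrable_bound[OF integrable_mult_left[OF u, of "LINT y|lborel. v y"]])
    show "AE x in lborel. norm (LINT y|lborel. norm (F (x, y))) \<le> norm (u x * (LINT y|lborel. v y))"
    proof (rule AE_I2)
      fix x
      have "(LINT y|lborel. norm (F (x, y))) \<le> (LINT y|lborel. u x * v y)"
        by (intro integral_mono int integrable_mult_right v le)
      moreover have "0 \<le> (LINT y|lborel. norm (F (x, y)))" by (simp add: Bochner_Integration.integral_nonneg)
      ultimately show "norm (LINT y|lborel. norm (F (x, y))) \<le> norm (u x * (LINT y|lborel. v y))"
        by simp
    qed
  qed measurable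
qed measurable

lemma inv_fourier_lborel:
  assumes [measurable]: "f \<in> borel_measurable borel"
  shows "inv_fourier f x = (LINT t|lborel. f t * exp (2 * of_real pi * \<i> * of_real (x \<bullet> t)))"
  unfolding inv_fourier_def by (rule integral_completion) measurable

text \<open>The transform of the cutoff is the normal density of width \<open>a\<close>, so removing
  the cutoff amounts to averaging against an approximate identity. The passage between the
  exponential and \<open>gauss\<close> is made on both sides of the transform; the resulting (2
  pi)^d cancels against the Jacobian of the scaling.\<close>

lemma fourier_gauss_scaled:
  fixes z :: "'a::euclidean_space"
  assumes a: "0 < a"
  shows "(LINT x|lborel. of_real (exp (- (norm ((2 * pi * a) *\<^sub>R x))\<^sup>2 / 2)) * exp (2 * of_real pi * \<i> * of_real (x \<bullet> z)))
     = complex_of_real (gauss (z /\<^sub>R a) / a ^ DIM('a))"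
proof -
  define s where "s = 2 * pi * a"
  have s: "0 < s" using a by (simp add: s_def)
  define c where "c = sqrt (2 * pi) ^ DIM('a)"
  have cc: "c * c = (2 * pi) ^ DIM('a)" unfolding c_def power_mult_distrib[symmetric] by simp
  let ?g = "\<lambda>x. of_real (exp (- (norm (s *\<^sub>R x))\<^sup>2 / 2)) * exp (2 * of_real pi * \<i> * of_real (x \<bullet> z))"
  have "(LINT x|lborel. ?g x) = \<bar>1 / s\<bar> ^ DIM('a) *\<^sub>R (LINT x|lborel. ?g (0 + (1 / s) *\<^sub>R x))"
    by (rule lborel_integral_affine) (use s in auto)
  also have "(LINT x|lborel. ?g (0 + (1 / s) *\<^sub>R x)) = (LINT x|lborel. of_real c * (of_real (gauss x) * exp (\<i> * of_real (x \<bullet> (z /\<^sub>R a)))))"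
  proof (intro Bochner_Integration.integral_cong refl)
    fix x :: 'a
    have "exp (- (norm (s *\<^sub>R (0 + (1 / s) *\<^sub>R x)))\<^sup>2 / 2) = c * gauss x"
      using s exp_norm_eq_gauss[of x] by (simp add: c_def)
    moreover have "2 * of_real pi * \<i> * of_real ((0 + (1 / s) *\<^sub>R x) \<bullet> z) = \<i> * of_real (x \<bullet> (z /\<^sub>R a))"
      using a by (simp add: s_def field_simps)
    ultimately show "?g (0 + (1 / s) *\<^sub>R x) = of_real c * (of_real (gauss x) * exp (\<i> * of_real (x \<bullet> (z /\<^sub>R a))))"
      by (simp only: of_real_mult mult.assoc)
  qed
  also have "\<dots> = of_real c * of_real (exp (- (norm (z /\<^sub>R a))\<^sup>2 / 2))"
    using gauss_fourier[of "z /\<^sub>R a"] by simp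
  also have "exp (- (norm (z /\<^sub>R a))\<^sup>2 / 2) = c * gauss (z /\<^sub>R a)"
    unfolding c_def by (rule exp_norm_eq_gauss)
  finally have "(LINT x|lborel. ?g x) = of_real ((1 / s) ^ DIM('a) * (c * c) * gauss (z /\<^sub>R a))"
    using s by (simp add: scaleR_conv_of_real)
  also have "(1 / s) ^ DIM('a) * (c * c) * gauss (z /\<^sub>R a) = gauss (z /\<^sub>R a) / a ^ DIM('a)"
    unfolding cc using a by (simp add: s_def power_divide power_mult_distrib)
  finally show ?thesis by (simp add: s_def)
qed

text \<open>This is only an inequality since the integral on the left is \<open>0\<close> by convention if the product
  of the transforms is not integrable. Otherwise a Gaussian cutoff can be removed from it.\<close>

theorem parseval_bound:
  fixes f h :: "'a::euclidean_space \<Rightarrow> complex"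
  assumes D: "open D" "continuous_on D h" and f0: "\<And>x. x \<notin> D \<Longrightarrow> f x = 0"
    and f: "integrable lborel f" and f2: "integrable lborel (\<lambda>x. (norm (f x))\<^sup>2)"
    and h: "integrable lborel h" and h2: "integrable lborel (\<lambda>x. (norm (h x))\<^sup>2)"
  shows "norm (L2_inner (inv_fourier f) (inv_fourier h)) \<le> norm (LINT x|lborel. f x * cnj (h x))"
proof -
  have [measurable]: "f \<in> borel_measurable borel" using borel_measurable_integrable[OF f] by simp
  have [measurable]: "h \<in> borel_measurable borel" using borel_measurable_integrable[OF h] by simp
  have [measurable]: "cnj \<in> borel_measurable borel"
    by (intro borel_measurable_continuous_onI continuous_intros)
  define e where "e t = exp (2 * of_real pi * \<i> * of_real t)" for t :: real
  have [measurable]: "e \<in> borel_measurable borel" unfolding e_def[abs_def] by measurable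
  have ne[simp]: "norm (e t) = 1" for t unfolding e_def by simp
  have ced: "cnj (e t) = e (- t)" for t unfolding e_def by (simp add: exp_cnj)
  have eadd: "e s * e t = e (s + t)" for s t unfolding e_def by (simp add: exp_add[symmetric] algebra_simps)
  let ?F = "\<lambda>x. LINT t|lborel. f t * e (x \<bullet> t)" and ?H = "\<lambda>x. LINT t|lborel. h t * e (x \<bullet> t)"
  have F: "inv_fourier f = ?F" and H: "inv_fourier h = ?H"
    unfolding e_def by (auto simp: inv_fourier_lborel)
  have [measurable]: "?F \<in> borel_measurable borel" "?H \<in> borel_measurable borel" by measurable
  have L: "L2_inner (inv_fourier f) (inv_fourier h) = (LINT x|lborel. ?F x * cnj (?H x))"
    unfolding L2_inner_def F H by (rule integral_completion) measurable
  show ?thesis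
  proof (cases "integrable lborel (\<lambda>x. ?F x * cnj (?H x))")
    case False
    then show ?thesis unfolding L by (simp add: not_integrable_integral_eq)
  next
    case int: True
    define a where "a k = 1 / real (Suc k)" for k
    have a: "0 < a k" for k by (simp add: a_def)
    have a0: "a \<longlonglongrightarrow> 0" unfolding a_def by (rule LIMSEQ_Suc[OF lim_1_over_n])
    \<comment> \<open>With this factor the triple integral over the two transform variables and
      \<open>x\<close> converges absolutely; the factor itself tends to 1 as \<open>a k\<close>
      tends to 0.\<close>
    define E where "E k x = complex_of_real (exp (- (norm ((2 * pi * a k) *\<^sub>R x))\<^sup>2 / 2))" for k and x :: 'a
    have [measurable]: "E k \<in> borel_measurable borel" for k unfolding E_def[abs_def] by measurable
    have E1: "norm (E k x) \<le> 1" for k x unfolding E_def by simp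
    have Ei: "integrable lborel (E k)" for k
    proof -
      have eq: "E k = (\<lambda>x. complex_of_real (sqrt (2 * pi) ^ DIM('a) * gauss (0 + (2 * pi * a k) *\<^sub>R x)))"
        unfolding E_def exp_norm_eq_gauss by auto
      have "integrable lborel (\<lambda>x::'a. gauss (0 + (2 * pi * a k) *\<^sub>R x))"
        using lborel_integrable_affine[of "2 * pi * a k" gauss 0] integrable_gauss a[of k] by auto
      then show ?thesis unfolding eq by (intro integrable_of_real integrable_mult_right)
    qed
    define C where "C y = (LINT x|lborel. f x * cnj (h (x - y)))" for y
    define B where "B = (LINT x|lborel. (norm (f x))\<^sup>2) + (LINT x|lborel. (norm (h x))\<^sup>2)"
    have hy2: "integrable lborel (\<lambda>x. (norm (h (x - c)))\<^sup>2)" "(LINT x|lborel. (norm (h (x - c)))\<^sup>2) = (LINT x|lborel. (norm (h x))\<^sup>2)" for c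
      using lborel_integrable_affine[of 1 "\<lambda>x. (norm (h x))\<^sup>2" "- c"] lborel_integral_affine[of 1 "\<lambda>x. (norm (h x))\<^sup>2" "- c"] h2 by simp_all
    have ifh: "integrable lborel (\<lambda>x. f x * cnj (h (x - c)))" for c
      by (rule integrable_mult_square_integrable) (use f2 hy2 in auto)
    \<comment> \<open>The bound is uniform in the translation, so it serves both for the last
      exchange of integrals and as the dominating constant in the limit.\<close>
    have nB: "(LINT x|lborel. norm (f x * cnj (h (x - y)))) \<le> B" for y
    proof -
      have "(LINT x|lborel. norm (f x * cnj (h (x - y)))) \<le> (LINT x|lborel. (norm (f x))\<^sup>2 + (norm (h (x - y)))\<^sup>2)"
      proof (rule integral_mono)
        show "norm (f x * cnj (h (x - y))) \<le> (norm (f x))\<^sup>2 + (norm (h (x - y)))\<^sup>2" for x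
          using mult_le_sum_squares[of 1 "norm (f x)" "norm (h (x - y))"]
          by (simp add: field_simps norm_mult) (smt (verit) zero_le_power2)
      qed (use ifh f2 hy2 in auto)
      also have "\<dots> = B" using f2 hy2 by (simp add: B_def)
      finally show ?thesis .
    qed
    have CB: "norm (C y) \<le> B" for y
      unfolding C_def by (rule order_trans[OF integral_norm_bound nB])
    \<comment> \<open>Fubini turns the regularised integral into the mean of the correlation
      \<open>C\<close> at scale \<open>a k\<close> under the normal density. The limit then follows
      from the continuity of \<open>C\<close> at 0.\<close>
    have J: "(LINT x|lborel. ?F x * cnj (?H x) * E k x) = (LINT v|lborel. gauss v * C (a k *\<^sub>R v))" for k
    proof -
      have HB: "norm (?H x) \<le> (LINT t|lborel. norm (h t))" for x
        using integral_norm_bound[of lborel "\<lambda>t. h t * e (x \<bullet> t)"] by (simp add: norm_mult)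
      have "(LINT x|lborel. ?F x * cnj (?H x) * E k x) = (LINT x|lborel. (LINT t|lborel. f t * e (x \<bullet> t) * (cnj (?H x) * E k x)))"
        by (subst Bochner_Integration.integral_mult_left_zero) (simp add: mult.assoc)
      also have "\<dots> = (LINT t|lborel. (LINT x|lborel. f t * e (x \<bullet> t) * (cnj (?H x) * E k x)))"
      proof (rule lborel_pair.Fubini_integral)
        show "integrable (lborel \<Otimes>\<^sub>M lborel) (\<lambda>(t, x). f t * e (x \<bullet> t) * (cnj (?H x) * E k x))"
        proof (rule integrable_pair_bound)
          show "integrable lborel (\<lambda>t. norm (f t))" using f by simp
          show "integrable lborel (\<lambda>x. norm (E k x) * (LINT t|lborel. norm (h t)))" using Ei by simp
          show "norm (case (t, x) of (t, x) \<Rightarrow> f t * e (x \<bullet> t) * (cnj (?H x) * E k x))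
             \<le> norm (f t) * (norm (E k x) * (LINT t|lborel. norm (h t)))" for t x
            using mult_left_mono[OF HB[of x], of "norm (f t) * norm (E k x)"] by (simp add: norm_mult algebra_simps)
        qed measurable
      qed
      also have "\<dots> = (LINT t|lborel. f t * (LINT v|lborel. cnj (h (t - a k *\<^sub>R v)) * gauss v))"
      proof (intro Bochner_Integration.integral_cong refl)
        fix t
        have "(LINT x|lborel. f t * e (x \<bullet> t) * (cnj (?H x) * E k x)) =
            f t * (LINT x|lborel. e (x \<bullet> t) * E k x * cnj (?H x))"
          by (subst Bochner_Integration.integral_mult_right_zero[symmetric]) (simp add: algebra_simps)
        also have "(LINT x|lborel. e (x \<bullet> t) * E k x * cnj (?H x)) =
            (LINT x|lborel. (LINT s|lborel. cnj (h s) * (E k x * e (x \<bullet> (t - s)))))"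
        proof (intro Bochner_Integration.integral_cong refl)
          fix x
          have "cnj (?H x) = (LINT s|lborel. cnj (h s * e (x \<bullet> s)))"
            by (rule Bochner_Integration.integral_cnj[symmetric])
          then have "e (x \<bullet> t) * E k x * cnj (?H x) = (LINT s|lborel. e (x \<bullet> t) * E k x * cnj (h s * e (x \<bullet> s)))"
            by (simp only: Bochner_Integration.integral_mult_right_zero)
          also have "\<dots> = (LINT s|lborel. cnj (h s) * (E k x * e (x \<bullet> (t - s))))"
          proof (intro Bochner_Integration.integral_cong refl)
            fix s
            have "e (x \<bullet> (t - s)) = e (x \<bullet> t) * cnj (e (x \<bullet> s))"
              by (simp add: ced eadd inner_diff_right)
            then show "e (x \<bullet> t) * E k x * cnj (h s * e (x \<bullet> s)) = cnj (h s) * (E k x * e (x \<bullet> (t - s)))"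
              by simp
          qed
          finally show "e (x \<bullet> t) * E k x * cnj (?H x) = (LINT s|lborel. cnj (h s) * (E k x * e (x \<bullet> (t - s))))" .
        qed
        also have "\<dots> = (LINT s|lborel. (LINT x|lborel. cnj (h s) * (E k x * e (x \<bullet> (t - s)))))"
        proof (rule lborel_pair.Fubini_integral)
          show "integrable (lborel \<Otimes>\<^sub>M lborel) (\<lambda>(s, x). cnj (h s) * (E k x * e (x \<bullet> (t - s))))"
          proof (rule integrable_pair_bound)
            show "integrable lborel (\<lambda>s. norm (h s))" using h by simp
            show "integrable lborel (\<lambda>x. norm (E k x))" using Ei by simp
          qed (auto simp: norm_mult)
        qed
        also have "\<dots> = (LINT s|lborel. cnj (h s) * of_real (gauss ((t - s) /\<^sub>R a k) / a k ^ DIM('a)))"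
          unfolding E_def e_def by (simp only: Bochner_Integration.integral_mult_right_zero fourier_gauss_scaled[OF a])
        \<comment> \<open>The substitution s = t - a_k v; its Jacobian cancels the factor 1 / a_k^d
          of the scaled density.\<close>
        also have "\<dots> = \<bar>- a k\<bar> ^ DIM('a) *\<^sub>R (LINT v|lborel. cnj (h (t + (- a k) *\<^sub>R v)) * of_real (gauss ((t - (t + (- a k) *\<^sub>R v)) /\<^sub>R a k) / a k ^ DIM('a)))"
          by (rule lborel_integral_affine) (use a[of k] in auto)
        also have "\<dots> = (LINT v|lborel. cnj (h (t - a k *\<^sub>R v)) * gauss v)"
          using a[of k] by (subst integral_scaleR_right[symmetric]) (auto simp: scaleR_conv_of_real intro!: Bochner_Integration.integral_cong)
        finally show "(LINT x|lborel. f t * e (x \<bullet> t) * (cnj (?H x) * E k x)) = f t * (LINT v|lborel. cnj (h (t - a k *\<^sub>R v)) * gauss v)" .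
      qed
      also have "\<dots> = (LINT t|lborel. (LINT v|lborel. f t * (cnj (h (t - a k *\<^sub>R v)) * gauss v)))"
        by simp
      also have "\<dots> = (LINT v|lborel. (LINT t|lborel. f t * (cnj (h (t - a k *\<^sub>R v)) * gauss v)))"
      proof (rule lborel_pair.Fubini_integral)
        show "integrable (lborel \<Otimes>\<^sub>M lborel) (\<lambda>(v, t). f t * (cnj (h (t - a k *\<^sub>R v)) * complex_of_real (gauss v)))"
        proof (rule lborel_pair.Fubini_integrable)
          have i: "integrable lborel (\<lambda>t. f t * cnj (h (t - a k *\<^sub>R v)) * complex_of_real (gauss v))" for v
            using ifh by simp
          then show "AE v in lborel. integrable lborel (\<lambda>t. case (v, t) of (v, t) \<Rightarrow> f t * (cnj (h (t - a k *\<^sub>R v)) * complex_of_real (gauss v)))"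
            by (simp add: mult.assoc)
          show "integrable lborel (\<lambda>v. LINT t|lborel. norm (case (v, t) of (v, t) \<Rightarrow> f t * (cnj (h (t - a k *\<^sub>R v)) * complex_of_real (gauss v))))"
          proof (rule Bochner_Integration.integrable_bound)
            show "integrable lborel (\<lambda>v::'a. gauss v * B)" using integrable_gauss[where 'a='a] by simp
            show "AE v in lborel. norm (LINT t|lborel. norm (case (v, t) of (v, t) \<Rightarrow> f t * (cnj (h (t - a k *\<^sub>R v)) * complex_of_real (gauss v)))) \<le> norm (gauss v * B)"
            proof (rule AE_I2)
              fix v :: 'a
              have "(LINT t|lborel. norm (case (v, t) of (v, t) \<Rightarrow> f t * (cnj (h (t - a k *\<^sub>R v)) * complex_of_real (gauss v))))
                = gauss v * (LINT t|lborel. norm (f t * cnj (h (t - a k *\<^sub>R v))))"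
              proof -
                have "(LINT t|lborel. norm (case (v, t) of (v, t) \<Rightarrow> f t * (cnj (h (t - a k *\<^sub>R v)) * complex_of_real (gauss v))))
                  = (LINT t|lborel. gauss v * norm (f t * cnj (h (t - a k *\<^sub>R v))))"
                  by (intro Bochner_Integration.integral_cong refl) (simp add: norm_mult gauss_nonneg)
                then show ?thesis by (simp only: Bochner_Integration.integral_mult_right_zero)
              qed
              also have "norm \<dots> \<le> norm (gauss v * B)"
                using nB[of "a k *\<^sub>R v"] gauss_nonneg[of v] by (simp add: abs_mult mult_left_mono)
              finally show "norm (LINT t|lborel. norm (case (v, t) of (v, t) \<Rightarrow> f t * (cnj (h (t - a k *\<^sub>R v)) * complex_of_real (gauss v)))) \<le> norm (gauss v * B)" .
            qed
          qed measurable
        qed measurable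
      qed
      also have "\<dots> = (LINT v|lborel. gauss v * C (a k *\<^sub>R v))"
        unfolding C_def by (subst Bochner_Integration.integral_mult_right_zero[symmetric]) (simp add: algebra_simps)
      finally show ?thesis .
    qed
    have 1: "(\<lambda>k. LINT x|lborel. ?F x * cnj (?H x) * E k x) \<longlonglongrightarrow> (LINT x|lborel. ?F x * cnj (?H x))"
    proof (rule integral_dominated_convergence[where w="\<lambda>x. norm (?F x * cnj (?H x))"])
      show "AE x in lborel. (\<lambda>k. ?F x * cnj (?H x) * E k x) \<longlonglongrightarrow> ?F x * cnj (?H x)"
      proof (rule AE_I2)
        fix x
        have "(\<lambda>k. E k x) \<longlonglongrightarrow> complex_of_real (exp (- (norm ((2 * pi * 0) *\<^sub>R x))\<^sup>2 / 2))"
          unfolding E_def by (intro tendsto_intros a0) auto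
        then have "(\<lambda>k. ?F x * cnj (?H x) * E k x) \<longlonglongrightarrow> ?F x * cnj (?H x) * 1"
          by (intro tendsto_mult_left) simp
        then show "(\<lambda>k. ?F x * cnj (?H x) * E k x) \<longlonglongrightarrow> ?F x * cnj (?H x)" by simp
      qed
      show "AE x in lborel. norm (?F x * cnj (?H x) * E k x) \<le> norm (?F x * cnj (?H x))" for k
        using E1 by (auto simp: norm_mult intro!: mult_left_le)
      show "integrable lborel (\<lambda>x. norm (?F x * cnj (?H x)))" using int by (rule integrable_norm)
    qed measurable
    have 2: "(\<lambda>k. LINT v|lborel. gauss v * C (a k *\<^sub>R v)) \<longlonglongrightarrow> (LINT v|lborel. gauss (v::'a) * C 0)"
    proof (rule integral_dominated_convergence[where w="\<lambda>v. gauss v * B"])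
      have [measurable]: "C \<in> borel_measurable borel" unfolding C_def by measurable
      show "(\<lambda>v. complex_of_real (gauss v) * C 0) \<in> borel_measurable lborel" by measurable
      show "(\<lambda>v. complex_of_real (gauss v) * C (a k *\<^sub>R v)) \<in> borel_measurable lborel" for k by measurable
      show "integrable lborel (\<lambda>v::'a. gauss v * B)" using integrable_gauss[where 'a='a] by simp
      show "AE v in lborel. (\<lambda>k. complex_of_real (gauss v) * C (a k *\<^sub>R v)) \<longlonglongrightarrow> of_real (gauss v) * C 0"
      proof (rule AE_I2)
        fix v :: 'a
        have "(\<lambda>k. a k *\<^sub>R v) \<longlonglongrightarrow> 0" using tendsto_scaleR[OF a0 tendsto_const[of v]] by simp
        then have "(\<lambda>k. C (a k *\<^sub>R v)) \<longlonglongrightarrow> C 0"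
          unfolding C_def by (auto intro!: correlation_tendsto[OF D f0 f f2 _ h2])
        then show "(\<lambda>k. complex_of_real (gauss v) * C (a k *\<^sub>R v)) \<longlonglongrightarrow> of_real (gauss v) * C 0"
          by (intro tendsto_intros)
      qed
      show "AE v in lborel. norm (complex_of_real (gauss v) * C (a k *\<^sub>R v)) \<le> gauss v * B" for k
        using CB by (auto simp: norm_mult gauss_nonneg intro!: mult_left_mono)
    qed
    have "(LINT v|lborel. complex_of_real (gauss (v::'a)) * C 0) = C 0"
      using integral_gauss[where 'a='a] by (simp add: integral_complex_of_real)
    then have "(LINT x|lborel. ?F x * cnj (?H x)) = C 0"
      using LIMSEQ_unique[OF 1] 2 unfolding J by simp
    then show ?thesis unfolding L C_def by simp
  qed
qed

section \<open>Change of variables for arbitrary finite index types\<close>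

text \<open>The change of variables theorems of HOL-Analysis are restricted to well-ordered index types. They
  are transported to an arbitrary finite index type along a bijection with an initial segment of the
  natural numbers.\<close>

typedef (overloaded) 'n well_index = "{..<CARD('n::finite)}"
  by (rule exI[of _ 0]) auto

instantiation well_index :: (finite) linorder
begin
definition "x \<le> y \<longleftrightarrow> Rep_well_index x \<le> Rep_well_index y"
definition "x < y \<longleftrightarrow> Rep_well_index x < Rep_well_index y"
instance
  by standard (auto simp: less_eq_well_index_def less_well_index_def Rep_well_index_inject)
end

instance well_index :: (finite) finite
proof
  have "(UNIV :: 'a well_index set) = Abs_well_index ` {..<CARD('a)}"
    using type_definition.Abs_image[OF type_definition_well_index] by auto
  then show "finite (UNIV :: 'a well_index set)" by (metis finite_imageI finite_lessThan)
qed

instance well_index :: (finite) wellorder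
proof -
  have "wf {(x, y). (x::'a well_index) < y}"
    by (auto simp: trancl_def tranclp_less intro!: finite_acyclic_wf acyclicI)
  thus "OFCLASS('a well_index, wellorder_class)"
    by (rule wf_wellorderI) intro_classes
qed

lemma card_well_index: "CARD('n::finite well_index) = CARD('n)"
  using type_definition.card[OF type_definition_well_index] by simp

text \<open>Conjugation by \<beta> is a sign-preserving bijection between the permutations of the
  two index types, and it only reorders the factors of each term of the Leibniz sum.\<close>

lemma det_reindex:
  fixes A :: "real^'n::finite^'n" and \<beta> :: "'n \<Rightarrow> 'm::finite"
  assumes \<beta>: "bij \<beta>"
  shows "det (\<chi> i j. A $ inv \<beta> i $ inv \<beta> j) = det A"
proof -
  let ?F = "map_permutation UNIV \<beta>"
  have b: "bij_betw \<beta> UNIV UNIV" "inj \<beta>" using \<beta> by (auto simp: bij_def)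
  have bij: "bij_betw ?F {p. p permutes UNIV} {p. p permutes UNIV}"
    by (rule bij_betw_byWitness[where f' = "map_permutation UNIV (inv \<beta>)"])
       (use b \<beta> bij_betw_inv_into[OF b(1)] in \<open>auto intro!: map_permutation_compose_inv map_permutation_permutes simp: bij_betw_def surj_f_inv_f\<close>)
  have "det (\<chi> i j. A $ inv \<beta> i $ inv \<beta> j) =
     (\<Sum>p | p permutes UNIV. of_int (sign p) * (\<Prod>i\<in>UNIV. A $ inv \<beta> i $ inv \<beta> (p i)))"
    by (simp add: det_def)
  also have "\<dots> = (\<Sum>p | p permutes UNIV. of_int (sign (?F p)) * (\<Prod>i\<in>UNIV. A $ inv \<beta> i $ inv \<beta> (?F p i)))"
    by (rule sum.reindex_bij_betw[OF bij, symmetric])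
  also have "\<dots> = (\<Sum>p | p permutes UNIV. of_int (sign p) * (\<Prod>i\<in>UNIV. A $ i $ p i))"
  proof (intro sum.cong refl)
    fix p :: "'n \<Rightarrow> 'n" assume p: "p \<in> {p. p permutes UNIV}"
    have s: "sign (?F p) = sign p"
      using p b by (intro sign_map_permutation) auto
    have "(\<Prod>i\<in>UNIV. A $ inv \<beta> i $ inv \<beta> (?F p i)) =
      (\<Prod>i\<in>UNIV. A $ inv \<beta> (\<beta> i) $ inv \<beta> (?F p (\<beta> i)))"
      by (rule prod.reindex_bij_betw[OF b(1), symmetric])
    also have "\<dots> = (\<Prod>i\<in>UNIV. A $ i $ p i)"
      using b by (simp add: map_permutation_apply)
    finally show "of_int (sign (?F p)) * (\<Prod>i\<in>UNIV. A $ inv \<beta> i $ inv \<beta> (?F p i)) =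
      of_int (sign p) * (\<Prod>i\<in>UNIV. A $ i $ p i)" by (simp add: s)
  qed
  finally show ?thesis by (simp add: det_def)
qed

text \<open>The preimage of a box is a box with the same side lengths in another order, and the
  values on boxes determine Lebesgue measure.\<close>

lemma distr_reindex_lborel:
  fixes \<beta> :: "'m::finite \<Rightarrow> 'n::finite"
  assumes \<beta>: "bij \<beta>"
  shows "distr lborel borel (\<lambda>x::real^'n. (\<chi> i. x $ \<beta> i)) = (lborel :: (real^'m) measure)"
proof (rule lborel_eqI[symmetric])
  have [measurable]: "(\<lambda>x::real^'n. (\<chi> i. x $ \<beta> i)) \<in> borel_measurable borel"
    by (intro borel_measurable_continuous_onI continuous_intros)
  fix l u :: "real^'m" assume le: "\<And>b. b \<in> Basis \<Longrightarrow> l \<bullet> b \<le> u \<bullet> b"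
  have eq: "(\<lambda>x::real^'n. (\<chi> i. x $ \<beta> i)) -` box l u = box (\<chi> i. l $ inv \<beta> i) (\<chi> i. u $ inv \<beta> i)"
    using \<beta> by (auto simp: mem_box_cart bij_def) (metis inv_f_f surj_f_inv_f)+
  have le': "l $ i \<le> u $ i" for i using le[of "axis i 1"] by (auto simp: inner_axis axis_in_Basis_iff)
  have "emeasure (distr lborel borel (\<lambda>x::real^'n. (\<chi> i. x $ \<beta> i))) (box l u) =
     (\<Prod>b\<in>Basis. ((\<chi> i. u $ inv \<beta> i) - (\<chi> i. l $ inv \<beta> i) :: real^'n) \<bullet> b)"
    by (subst emeasure_distr) (auto simp: eq emeasure_lborel_box_eq le' inner_axis axis_eq_axis Basis_vec_def)
  also have "\<dots> = (\<Prod>i\<in>UNIV. u $ inv \<beta> i - l $ inv \<beta> i)"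
    by (simp add: Basis_vec_def prod.UNION_disjoint inner_axis UNION_singleton_eq_range prod.reindex inj_on_def axis_eq_axis)
  also have "\<dots> = (\<Prod>i\<in>UNIV. u $ i - l $ i)"
    using prod.reindex_bij_betw[OF bij_imp_bij_inv[OF \<beta>], of "\<lambda>i. u $ i - l $ i"] by simp
  also have "\<dots> = (\<Prod>b\<in>Basis. (u - l) \<bullet> b)"
    by (simp add: Basis_vec_def inner_axis UNION_singleton_eq_range prod.reindex inj_on_def axis_eq_axis)
  finally show "emeasure (distr lborel borel (\<lambda>x::real^'n. (\<chi> i. x $ \<beta> i))) (box l u) = (\<Prod>b\<in>Basis. (u - l) \<bullet> b)" .
qed simp

text \<open>On a bounded set the continuous Jacobian is integrable, as the formula for the measure
  of an image requires; \<open>density_distr_diffeomorphism\<close> passes to unbounded sets by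
  exhaustion.\<close>

lemma emeasure_differentiable_image_wellorder:
  fixes f :: "real^'n::{finite,wellorder} \<Rightarrow> real^'n::_"
  assumes S: "S \<in> sets borel" "bounded S" and fS: "f ` S \<in> sets borel"
    and der: "\<And>x. (f has_derivative f' x) (at x)" and inj: "inj f"
    and cont: "continuous_on UNIV (\<lambda>x. det (matrix (f' x)))"
  shows "emeasure lborel (f ` S) = (\<integral>\<^sup>+x\<in>S. ennreal \<bar>det (matrix (f' x))\<bar> \<partial>lborel)"
proof -
  let ?W = "\<lambda>x. \<bar>det (matrix (f' x))\<bar>"
  have [measurable]: "?W \<in> borel_measurable borel"
    by (intro borel_measurable_continuous_onI continuous_intros cont)
  obtain a b where ab: "S \<subseteq> cbox a b" using S(2) bounded_subset_cbox_symmetric by blast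
  have "set_integrable lborel (cbox a b) ?W"
    by (rule borel_integrable_compact[OF compact_cbox, folded set_integrable_def, unfolded])
       (auto intro!: continuous_intros continuous_on_subset[OF cont])
  then have i: "set_integrable lborel S ?W"
    by (rule set_integrable_subset) (use S ab in auto)
  then have i': "set_integrable lebesgue S ?W"
    unfolding set_integrable_def by (subst integrable_completion) (use S in auto)
  have hi: "?W integrable_on S"
    using set_lebesgue_integral_eq_integral(1)[OF i'] .
  have Sl: "S \<in> sets lebesgue" using S by simp
  have fl: "f ` S \<in> lmeasurable" and m: "measure lebesgue (f ` S) = integral S ?W"
    using measurable_differentiable_image_eq[OF Sl, of f f'] measure_differentiable_image_eq[OF Sl, of f f'] hi
      der inj has_derivative_at_withinI inj_on_subset by (metis subset_UNIV)+
  have "emeasure lborel (f ` S) = emeasure lebesgue (f ` S)" using fS by simp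
  also have "\<dots> = ennreal (integral S ?W)" using fl m
    by (metis emeasure_eq_measure2)
  also have "integral S ?W = (LINT x:S|lebesgue. ?W x)" using set_lebesgue_integral_eq_integral(2)[OF i'] by simp
  also have "\<dots> = (LINT x:S|lborel. ?W x)"
    unfolding set_lebesgue_integral_def by (subst integral_completion) (use S in auto)
  also have "ennreal \<dots> = (\<integral>\<^sup>+x\<in>S. ennreal (?W x) \<partial>lborel)"
    unfolding set_lebesgue_integral_def using i unfolding set_integrable_def
    by (subst nn_integral_eq_integral[symmetric])
       (auto intro!: nn_integral_cong simp: indicator_def)
  finally show ?thesis .
qed

text \<open>Conjugating \<open>f\<close> with the coordinate relabellings \<open>L\<close> and
  \<open>R\<close> moves the problem to the well-ordered index type. Relabelling preserves Lebesgue
  measure and, by \<open>det_reindex\<close>, the Jacobian determinant.\<close>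

lemma emeasure_differentiable_image:
  fixes f :: "real^'n::finite \<Rightarrow> real^'n"
  assumes S: "S \<in> sets borel" "bounded S" and fS: "f ` S \<in> sets borel"
    and der: "\<And>x. (f has_derivative (*v) (A x)) (at x)" and inj: "inj f"
    and cont: "continuous_on UNIV (\<lambda>x. det (A x))"
  shows "emeasure lborel (f ` S) = (\<integral>\<^sup>+x\<in>S. ennreal \<bar>det (A x)\<bar> \<partial>lborel)"
proof -
  obtain \<beta> :: "'n \<Rightarrow> 'n well_index" where \<beta>: "bij \<beta>"
    using card_well_index[where 'n='n] by (metis finite_same_card_bij finite)
  define L :: "real^'n \<Rightarrow> real^'n well_index" where "L = (\<lambda>x. (\<chi> i. x $ inv \<beta> i))"
  define R :: "real^'n well_index \<Rightarrow> real^'n" where "R = (\<lambda>x. (\<chi> i. x $ \<beta> i))"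
  have b: "inj \<beta>" "surj \<beta>" using \<beta> by (auto simp: bij_def)
  have RL[simp]: "R (L x) = x" for x by (simp add: L_def R_def vec_eq_iff b)
  have LR[simp]: "L (R x) = x" for x by (simp add: L_def R_def vec_eq_iff b surj_f_inv_f)
  have lL: "linear L" and lR: "linear R" by (auto intro!: linearI simp: L_def R_def vec_eq_iff)
  have bL: "bounded_linear L" and bR: "bounded_linear R"
    using lL lR linear_conv_bounded_linear by auto
  have [measurable]: "L \<in> borel_measurable borel" "R \<in> borel_measurable borel"
    using bL bR by (auto intro!: borel_measurable_continuous_onI linear_continuous_on)
  have dL: "distr lborel borel L = lborel" and dR: "distr lborel borel R = lborel"
    unfolding L_def R_def using distr_reindex_lborel[OF bij_imp_bij_inv[OF \<beta>]] distr_reindex_lborel[OF \<beta>] by auto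
  define g where "g = L \<circ> f \<circ> R"
  define B where "B x = (\<chi> i j. A (R x) $ inv \<beta> i $ inv \<beta> j)" for x
  have Bmv: "B x *v h = L (A (R x) *v R h)" for x h
    unfolding B_def L_def R_def
    by (simp add: vec_eq_iff matrix_vector_mult_def)
       (auto intro!: sum.reindex_bij_witness[of _ "\<beta>" "inv \<beta>"] simp: b surj_f_inv_f)
  have gd: "(g has_derivative (*v) (B x)) (at x)" for x
  proof -
    have "(g has_derivative L \<circ> ((*v) (A (R x)) \<circ> R)) (at x)"
      unfolding g_def comp_assoc
      by (intro diff_chain_at bounded_linear_imp_has_derivative bL bR der)
    then show ?thesis by (simp add: Bmv[abs_def] o_def)
  qed
  have dB: "det (B x) = det (A (R x))" for x
    unfolding B_def by (rule det_reindex[OF \<beta>])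
  have im: "L ` T = R -` T" for T by (auto simp: image_iff) (metis LR)
  have im': "R -` T \<in> sets borel" if "T \<in> sets borel" for T :: "(real^'n) set"
    using that by (metis \<open>R \<in> borel_measurable borel\<close> measurable_sets_borel)
  have gi: "g ` (L ` S) = L ` (f ` S)" by (auto simp: g_def image_image)
  have "emeasure lborel (f ` S) = emeasure (distr lborel borel R) (f ` S)" by (simp add: dR)
  also have "\<dots> = emeasure lborel (L ` (f ` S))"
    by (subst emeasure_distr) (auto simp: fS im)
  also have "\<dots> = emeasure lborel (g ` (L ` S))" by (simp only: gi)
  also have "\<dots> = (\<integral>\<^sup>+x\<in>L ` S. ennreal \<bar>det (matrix ((*v) (B x)))\<bar> \<partial>lborel)"
  proof (rule emeasure_differentiable_image_wellorder[OF _ _ _ gd])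
    show "L ` S \<in> sets borel" using im im' S by auto
    show "bounded (L ` S)" using S bL by (simp add: bounded_linear_image)
    show "g ` (L ` S) \<in> sets borel" unfolding gi using im im' fS by auto
    show "inj g" unfolding g_def using inj by (metis LR RL inj_compose inj_on_inverseI)
    show "continuous_on UNIV (\<lambda>x. det (matrix ((*v) (B x))))"
      using continuous_on_compose2[OF cont, of UNIV R] bR by (auto simp: dB linear_continuous_on)
  qed
  also have "\<dots> = (\<integral>\<^sup>+x. (\<lambda>y. ennreal \<bar>det (A y)\<bar> * indicator S y) (R x) \<partial>lborel)"
    by (intro nn_integral_cong) (auto simp: dB im indicator_def)
  also have "\<dots> = (\<integral>\<^sup>+y. ennreal \<bar>det (A y)\<bar> * indicator S y \<partial>distr lborel borel R)"
  proof -
    have [measurable]: "(\<lambda>y. det (A y)) \<in> borel_measurable borel"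
      by (rule borel_measurable_continuous_onI[OF cont])
    have "(\<lambda>y. ennreal \<bar>det (A y)\<bar> * indicator S y) \<in> borel_measurable borel"
      using S by measurable
    then show ?thesis by (subst nn_integral_distr) auto
  qed
  finally show ?thesis by (simp add: dR)
qed

text \<open>As an equality of measures, the change of variables yields the substitution rules for
  nonnegative integrals, for integrability and for Bochner integrals alike.\<close>

lemma density_distr_diffeomorphism:
  fixes f :: "real^'n::finite \<Rightarrow> real^'n"
  assumes der: "\<And>x. (f has_derivative (*v) (A x)) (at x)" and inj: "inj f"
    and cont: "continuous_on UNIV (\<lambda>x. det (A x))" and op: "open (range f)"
  shows "distr (density lborel (\<lambda>x. ennreal \<bar>det (A x)\<bar>)) borel f = density lborel (indicator (range f))"
proof (rule measure_eqI)
  let ?W = "\<lambda>x. ennreal \<bar>det (A x)\<bar>"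
  have [measurable]: "(\<lambda>x. det (A x)) \<in> borel_measurable borel"
    by (intro borel_measurable_continuous_onI cont)
  have cf: "continuous_on UNIV f"
    using der by (meson continuous_at_imp_continuous_on has_derivative_continuous)
  have [measurable]: "f \<in> borel_measurable borel"
    by (intro borel_measurable_continuous_onI cf)
  have [measurable]: "range f \<in> sets borel" using op by simp
  fix B assume "B \<in> sets (distr (density lborel ?W) borel f)"
  then have B[measurable]: "B \<in> sets borel" by simp
  define S where "S n = f -` B \<inter> cball 0 (real n)" for n
  have Sm[measurable]: "S n \<in> sets borel" for n
    unfolding S_def using measurable_sets_borel[OF \<open>f \<in> borel_measurable borel\<close> B] by auto
  \<comment> \<open>Written this way, the image is the intersection of \<open>B\<close> with a
    compact set and hence Borel.\<close>
  have fS: "f ` S n = B \<inter> f ` cball 0 (real n)" for n by (auto simp: S_def)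
  have "compact (f ` cball 0 (real n))" for n
    using cf by (intro compact_continuous_image) (auto intro: continuous_on_subset)
  then have fSm[measurable]: "f ` S n \<in> sets borel" for n
    unfolding fS by (rule sets.Int[OF B borel_compact])
  have "bounded (S n)" for n by (auto simp: S_def intro: bounded_subset[OF bounded_cball])
  then have eq: "emeasure lborel (f ` S n) = emeasure (density lborel ?W) (S n)" for n
    by (subst emeasure_differentiable_image[OF Sm _ fSm der inj cont]) (auto simp: emeasure_density)
  have inc: "incseq S" by (auto simp: S_def incseq_def)
  then have inc': "incseq (\<lambda>n. f ` S n)" by (auto simp: incseq_def)
  have U: "(\<Union>n. S n) = f -` B" by (auto simp: S_def real_arch_simple)
  have U': "(\<Union>n. f ` S n) = B \<inter> range f" unfolding image_UN[symmetric] U by auto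
  have "emeasure (density lborel ?W) (f -` B) = (SUP n. emeasure (density lborel ?W) (S n))"
    unfolding U[symmetric] using inc by (intro SUP_emeasure_incseq[symmetric]) auto
  also have "\<dots> = (SUP n. emeasure lborel (f ` S n))" by (simp add: eq)
  also have "\<dots> = emeasure lborel (B \<inter> range f)"
    unfolding U'[symmetric] using inc' by (intro SUP_emeasure_incseq) auto
  finally have "emeasure (density lborel ?W) (f -` B) = emeasure lborel (B \<inter> range f)" .
  then show "emeasure (distr (density lborel ?W) borel f) B = emeasure (density lborel (indicator (range f))) B"
  proof -
    have "emeasure (distr (density lborel ?W) borel f) B = emeasure (density lborel ?W) (f -` B)"
      by (subst emeasure_distr) auto
    moreover have "emeasure (density lborel (indicator (range f))) B = emeasure lborel (B \<inter> range f)"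
      by (subst emeasure_density)
         (auto simp: indicator_inter_arith[symmetric] Int_commute nn_integral_indicator)
    ultimately show ?thesis using \<open>emeasure (density lborel ?W) (f -` B) = emeasure lborel (B \<inter> range f)\<close> by simp
  qed
qed simp

section \<open>Symbol estimates along a direction\<close>

text \<open>In other words, the directional derivatives satisfy \<open>|\<partial>\<^sub>b\<^sup>i f| \<le> g q\<^sup>i\<close> for \<open>i \<le> n\<close>.\<close>

primrec symbol_est ::
    "'a::real_normed_vector \<Rightarrow> ('a \<Rightarrow> real) \<Rightarrow> nat \<Rightarrow> ('a \<Rightarrow> real) \<Rightarrow> ('a \<Rightarrow> 'b::real_normed_vector) \<Rightarrow> bool" where
  "symbol_est b q 0 g f \<longleftrightarrow> continuous_on UNIV f \<and> (\<forall>x. norm (f x) \<le> g x)"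
| "symbol_est b q (Suc n) g f \<longleftrightarrow> continuous_on UNIV f \<and> (\<forall>x. norm (f x) \<le> g x) \<and>
     (\<exists>f'. (\<forall>x. ((\<lambda>r. f (x + r *\<^sub>R b)) has_vector_derivative f' x) (at 0)) \<and> symbol_est b q n (\<lambda>x. g x * q x) f')"

lemma symbol_est_cont: "symbol_est b q n g f \<Longrightarrow> continuous_on UNIV f"
  by (cases n) auto

lemma symbol_est_norm: "symbol_est b q n g f \<Longrightarrow> norm (f x) \<le> g x"
  by (cases n) auto

lemma symbol_est_nonneg: "symbol_est b q n g f \<Longrightarrow> 0 \<le> g x"
  using symbol_est_norm norm_ge_zero order_trans by blast

lemma symbol_est_SucI:
  assumes "continuous_on UNIV f" "\<And>x. norm (f x) \<le> g x"
    "\<And>x. ((\<lambda>r. f (x + r *\<^sub>R b)) has_vector_derivative f' x) (at 0)"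
    "symbol_est b q n (\<lambda>x. g x * q x) f'"
  shows "symbol_est b q (Suc n) g f"
  using assms by auto

lemma symbol_est_mono:
  assumes "symbol_est b q n g f" "\<And>x. g x \<le> g' x" and q: "\<And>x. 0 \<le> q x"
  shows "symbol_est b q n g' f"
  using assms(1,2)
proof (induction n arbitrary: g g' f)
  case (Suc n)
  then obtain f' where "\<forall>x. ((\<lambda>r. f (x + r *\<^sub>R b)) has_vector_derivative f' x) (at 0)" "symbol_est b q n (\<lambda>x. g x * q x) f'"
    by auto
  moreover have "symbol_est b q n (\<lambda>x. g' x * q x) f'"
    by (rule Suc.IH[OF calculation(2)]) (intro mult_right_mono Suc.prems q)
  ultimately show ?case using Suc.prems by (auto intro: order_trans)
qed (auto intro: order_trans)

lemma symbol_est_pred: "symbol_est b q (Suc n) g f \<Longrightarrow> symbol_est b q n g f"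
proof (induction n arbitrary: g f)
  case (Suc n)
  obtain f' where f': "\<forall>x. ((\<lambda>r. f (x + r *\<^sub>R b)) has_vector_derivative f' x) (at 0)"
      "symbol_est b q (Suc n) (\<lambda>x. g x * q x) f'" and f: "continuous_on UNIV f" "\<forall>x. norm (f x) \<le> g x"
    using Suc.prems unfolding symbol_est.simps(2)[of b q "Suc n"] by blast
  show ?case
    unfolding symbol_est.simps(2)[of b q n] using f f'(1) Suc.IH[OF f'(2)] by blast
qed simp

lemma symbol_est_le: "symbol_est b q n g f \<Longrightarrow> m \<le> n \<Longrightarrow> symbol_est b q m g f"
proof (induction n)
  case (Suc n)
  then show ?case by (metis le_Suc_eq symbol_est_pred)
qed simp

lemma symbol_est_derivE:
  assumes "symbol_est b q (Suc n) g f"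
  obtains f' where "\<And>x. ((\<lambda>r. f (x + r *\<^sub>R b)) has_vector_derivative f' x) (at 0)"
    "symbol_est b q n (\<lambda>x. g x * q x) f'"
  using assms by auto

lemma symbol_est_add:
  assumes "symbol_est b q n g1 f1" "symbol_est b q n g2 f2"
  shows "symbol_est b q n (\<lambda>x. g1 x + g2 x) (\<lambda>x. f1 x + f2 x)"
  using assms
proof (induction n arbitrary: g1 g2 f1 f2)
  case (Suc n)
  obtain f1' where 1: "\<And>x. ((\<lambda>r. f1 (x + r *\<^sub>R b)) has_vector_derivative f1' x) (at 0)" "symbol_est b q n (\<lambda>x. g1 x * q x) f1'"
    using symbol_est_derivE[OF Suc.prems(1)] by metis
  obtain f2' where 2: "\<And>x. ((\<lambda>r. f2 (x + r *\<^sub>R b)) has_vector_derivative f2' x) (at 0)" "symbol_est b q n (\<lambda>x. g2 x * q x) f2'"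
    using symbol_est_derivE[OF Suc.prems(2)] by metis
  show ?case
  proof (rule symbol_est_SucI)
    show "((\<lambda>r. f1 (x + r *\<^sub>R b) + f2 (x + r *\<^sub>R b)) has_vector_derivative f1' x + f2' x) (at 0)" for x
      by (intro has_vector_derivative_add 1 2)
    show "symbol_est b q n (\<lambda>x. (g1 x + g2 x) * q x) (\<lambda>x. f1' x + f2' x)"
      using Suc.IH[OF 1(2) 2(2)] by (simp add: algebra_simps)
  qed (use Suc.prems[THEN symbol_est_cont] Suc.prems[THEN symbol_est_norm] in
       \<open>auto intro!: continuous_intros norm_triangle_mono\<close>)
qed (auto intro!: continuous_intros norm_triangle_mono)

lemma symbol_est_zero: "(\<And>x. 0 \<le> g x) \<Longrightarrow> (\<And>x. 0 \<le> q x) \<Longrightarrow> symbol_est b q n g (\<lambda>x. 0)"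
proof (induction n arbitrary: g)
  case (Suc n)
  show ?case
    by (rule symbol_est_SucI[where f'="\<lambda>x. 0"]) (use Suc in \<open>auto intro!: derivative_eq_intros\<close>)
qed auto

lemma symbol_est_const:
  "(\<And>x. norm c \<le> g x) \<Longrightarrow> (\<And>x. 0 \<le> q x) \<Longrightarrow> symbol_est b q n g (\<lambda>x. c)"
proof (induction n)
  case (Suc n)
  have "0 \<le> g x" for x using Suc.prems(1) norm_ge_zero order_trans by blast
  then show ?case
    by (intro symbol_est_SucI[where f'="\<lambda>x. 0"])
       (use Suc in \<open>auto intro!: derivative_eq_intros symbol_est_zero\<close>)
qed auto

text \<open>Each derivative splits a product into two terms, whence 2^n. Such crude constants are
  harmless because they depend on the order alone.\<close>

lemma symbol_est_mult:
  fixes f1 f2 :: "'a::real_normed_vector \<Rightarrow> 'b::real_normed_algebra"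
  assumes "symbol_est b q n g1 f1" "symbol_est b q n g2 f2" and q: "\<And>x. 0 \<le> q x"
  shows "symbol_est b q n (\<lambda>x. 2 ^ n * (g1 x * g2 x)) (\<lambda>x. f1 x * f2 x)"
  using assms(1,2)
proof (induction n arbitrary: g1 g2 f1 f2)
  case 0
  then show ?case
    by (auto intro!: continuous_intros order_trans[OF norm_mult_ineq] mult_mono intro: order_trans[OF norm_ge_zero])
next
  case (Suc n)
  obtain f1' where 1: "\<And>x. ((\<lambda>r. f1 (x + r *\<^sub>R b)) has_vector_derivative f1' x) (at 0)" "symbol_est b q n (\<lambda>x. g1 x * q x) f1'"
    using symbol_est_derivE[OF Suc.prems(1)] by metis
  obtain f2' where 2: "\<And>x. ((\<lambda>r. f2 (x + r *\<^sub>R b)) has_vector_derivative f2' x) (at 0)" "symbol_est b q n (\<lambda>x. g2 x * q x) f2'"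
    using symbol_est_derivE[OF Suc.prems(2)] by metis
  note nn = Suc.prems[THEN symbol_est_nonneg]
  show ?case
  proof (rule symbol_est_SucI)
    show "((\<lambda>r. f1 (x + r *\<^sub>R b) * f2 (x + r *\<^sub>R b)) has_vector_derivative f1 x * f2' x + f1' x * f2 x) (at 0)" for x
      using has_vector_derivative_mult[OF 1(1)[of x] 2(1)[of x]] by simp
    show "symbol_est b q n (\<lambda>x. (2 ^ Suc n * (g1 x * g2 x)) * q x) (\<lambda>x. f1 x * f2' x + f1' x * f2 x)"
      using symbol_est_add[OF Suc.IH[OF symbol_est_pred[OF Suc.prems(1)] 2(2)] Suc.IH[OF 1(2) symbol_est_pred[OF Suc.prems(2)]]]
      by (simp add: algebra_simps)
    show "continuous_on UNIV (\<lambda>x. f1 x * f2 x)"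
      using Suc.prems[THEN symbol_est_cont] by (intro continuous_intros)
    fix x
    have "norm (f1 x * f2 x) \<le> g1 x * g2 x"
      using Suc.prems[THEN symbol_est_norm] nn by (intro order_trans[OF norm_mult_ineq] mult_mono) auto
    also have "\<dots> \<le> 2 ^ Suc n * (g1 x * g2 x)"
      using mult_right_mono[of 1 "2 ^ Suc n" "g1 x * g2 x"] nn one_le_power[of "2::real" "Suc n"] by simp
    finally show "norm (f1 x * f2 x) \<le> 2 ^ Suc n * (g1 x * g2 x)" .
  qed
qed

text \<open>Kept apart from the product estimate since a constant factor costs no 2^n.\<close>

lemma symbol_est_cmult:
  fixes f :: "'a::real_normed_vector \<Rightarrow> 'b::real_normed_algebra"
  assumes "symbol_est b q n g f"
  shows "symbol_est b q n (\<lambda>x. norm c * g x) (\<lambda>x. c * f x)"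
  using assms
proof (induction n arbitrary: g f)
  case 0
  then show ?case by (auto intro!: continuous_intros order_trans[OF norm_mult_ineq] mult_left_mono)
next
  case (Suc n)
  obtain f' where 1: "\<And>x. ((\<lambda>r. f (x + r *\<^sub>R b)) has_vector_derivative f' x) (at 0)" "symbol_est b q n (\<lambda>x. g x * q x) f'"
    using symbol_est_derivE[OF Suc.prems(1)] by metis
  show ?case
  proof (rule symbol_est_SucI)
    show "((\<lambda>r. c * f (x + r *\<^sub>R b)) has_vector_derivative c * f' x) (at 0)" for x
      by (intro has_vector_derivative_mult_right 1)
    show "symbol_est b q n (\<lambda>x. (norm c * g x) * q x) (\<lambda>x. c * f' x)"
      using Suc.IH[OF 1(2)] by (simp add: algebra_simps)
  qed (use Suc.prems[THEN symbol_est_cont] Suc.prems[THEN symbol_est_norm] in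
       \<open>auto intro!: continuous_intros order_trans[OF norm_mult_ineq] mult_left_mono\<close>)
qed

lemma symbol_est_bounded_linear:
  assumes L: "bounded_linear L" and L1: "\<And>z. norm (L z) \<le> norm z" and "symbol_est b q n g f"
  shows "symbol_est b q n g (\<lambda>x. L (f x))"
  using assms(3)
proof (induction n arbitrary: g f)
  case 0
  then show ?case using L by (auto intro!: bounded_linear.continuous_on[OF L] intro: order_trans[OF L1])
next
  case (Suc n)
  obtain f' where 1: "\<And>x. ((\<lambda>r. f (x + r *\<^sub>R b)) has_vector_derivative f' x) (at 0)" "symbol_est b q n (\<lambda>x. g x * q x) f'"
    using symbol_est_derivE[OF Suc.prems(1)] by metis
  show ?case
  proof (rule symbol_est_SucI)
    show "((\<lambda>r. L (f (x + r *\<^sub>R b))) has_vector_derivative L (f' x)) (at 0)" for x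
      by (rule bounded_linear.has_vector_derivative[OF L 1(1)])
    show "symbol_est b q n (\<lambda>x. g x * q x) (\<lambda>x. L (f' x))" by (rule Suc.IH[OF 1(2)])
  qed (use Suc.prems[THEN symbol_est_cont] Suc.prems[THEN symbol_est_norm] in
       \<open>auto intro!: bounded_linear.continuous_on[OF L] intro: order_trans[OF L1]\<close>)
qed

lemma symbol_est_of_real:
  "symbol_est b q n g f \<Longrightarrow> symbol_est b q n g (\<lambda>x. of_real (f x) :: complex)"
  by (rule symbol_est_bounded_linear[OF bounded_linear_of_real]) auto

lemma symbol_est_cnj: "symbol_est b q n g f \<Longrightarrow> symbol_est b q n g (\<lambda>x. cnj (f x))"
  by (rule symbol_est_bounded_linear[OF bounded_linear_cnj]) auto

lemma symbol_est_prod: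
  fixes f :: "'i \<Rightarrow> 'a::real_normed_vector \<Rightarrow> 'b::{real_normed_algebra_1,comm_ring_1}"
  assumes "finite I" and "\<And>i. i \<in> I \<Longrightarrow> symbol_est b q n (g i) (f i)" and q: "\<And>x. 0 \<le> q x"
  shows "symbol_est b q n (\<lambda>x. 2 ^ (n * card I) * (\<Prod>i\<in>I. g i x)) (\<lambda>x. \<Prod>i\<in>I. f i x)"
  using assms(1,2)
proof (induction I)
  case empty
  then show ?case using q by (auto intro!: symbol_est_const)
next
  case (insert i I)
  have "symbol_est b q n (\<lambda>x. 2 ^ n * (g i x * (2 ^ (n * card I) * (\<Prod>i\<in>I. g i x)))) (\<lambda>x. f i x * (\<Prod>i\<in>I. f i x))"
    by (rule symbol_est_mult) (use insert q in auto)
  then show ?case using insert(1,2) by (simp add: power_add algebra_simps)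
qed

lemma symbol_est_power:
  fixes f :: "'a::real_normed_vector \<Rightarrow> 'b::{real_normed_algebra_1,comm_ring_1}"
  assumes "symbol_est b q n g f" and q: "\<And>x. 0 \<le> q x"
  shows "symbol_est b q n (\<lambda>x. 2 ^ (n * k) * g x ^ k) (\<lambda>x. f x ^ k)"
  using symbol_est_prod[of "{..<k}" b q n "\<lambda>_. g" "\<lambda>_. f"] assms by simp

lemma symbol_est_sum:
  assumes "finite I" and "\<And>i. i \<in> I \<Longrightarrow> symbol_est b q n (g i) (f i)" and q: "\<And>x. 0 \<le> q x"
  shows "symbol_est b q n (\<lambda>x. \<Sum>i\<in>I. g i x) (\<lambda>x. \<Sum>i\<in>I. f i x)"
  using assms(1,2)
  by (induction I) (auto intro!: symbol_est_add symbol_est_zero q)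

text \<open>A bound that is the same for all orders fits the scheme, because q \<ge> 1 lets the
  factors q^i be inserted.\<close>

lemma symbol_est_chain:
  assumes cont: "\<And>m. m \<le> n \<Longrightarrow> continuous_on UNIV (F m)"
    and der: "\<And>m x. m < n \<Longrightarrow> ((\<lambda>r. F m (x + r *\<^sub>R b)) has_vector_derivative F (Suc m) x) (at 0)"
    and g: "\<And>m x. m \<le> n \<Longrightarrow> norm (F m x) \<le> g x" and q: "\<And>x. 1 \<le> q x"
  shows "symbol_est b q n g (F 0)"
proof -
  have "symbol_est b q (n - m) g (F m)" if "m \<le> n" for m
    using that
  proof (induction "n - m" arbitrary: m)
    case 0
    then show ?case using cont g by simp
  next
    case (Suc k)
    then have m: "n - m = Suc (n - Suc m)" by simp
    have nn: "0 \<le> g x" for x using order_trans[OF norm_ge_zero g[of 0 x]] by simp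
    show ?case unfolding m
    proof (rule symbol_est_SucI)
      have "symbol_est b q (n - Suc m) g (F (Suc m))" using Suc by simp
      then show "symbol_est b q (n - Suc m) (\<lambda>x. g x * q x) (F (Suc m))"
      proof (rule symbol_est_mono)
        show "g x \<le> g x * q x" for x using mult_left_mono[OF q nn, of x x] by simp
        show "0 \<le> q x" for x using q[of x] by simp
      qed
    qed (use Suc in \<open>auto intro!: cont der g\<close>)
  qed
  from this[of 0] show ?thesis by simp
qed

text \<open>The recursion is read off from (1/f)' = - f' * (1/f) * (1/f): two product rules give
  2^(2n), the two factors 1/f give the square, and \<open>M\<close> bounds the product of the
  majorants of f and 1/f.\<close>

primrec inverse_const :: "real \<Rightarrow> nat \<Rightarrow> real" where
  "inverse_const M 0 = 1"
| "inverse_const M (Suc n) = max 1 (max (inverse_const M n) (2 ^ (2 * n) * (inverse_const M n)\<^sup>2 * M))"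

lemma inverse_const_ge_1: "1 \<le> inverse_const M n"
  by (cases n) auto

text \<open>The derivative of 1/f consists of f' and two copies of 1/f, so the estimate of order n
  for 1/f yields that of order n + 1. The majorant reproduces itself because (g q) h^2 = (g h) (h q)
  \<le> M (h q).\<close>

lemma symbol_est_inverse:
  fixes f :: "'a::real_normed_vector \<Rightarrow> 'b::real_normed_field"
  assumes "symbol_est b q n g f" and nz: "\<And>x. f x \<noteq> 0" and h: "\<And>x. norm (inverse (f x)) \<le> h x"
    and M: "\<And>x. g x * h x \<le> M" and q: "\<And>x. 0 \<le> q x"
  shows "symbol_est b q n (\<lambda>x. inverse_const M n * h x) (\<lambda>x. inverse (f x))"
  using assms(1)
proof (induction n)
  case 0
  then show ?case using nz h by (auto intro!: continuous_intros)
next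
  case (Suc n)
  obtain f' where 1: "\<And>x. ((\<lambda>r. f (x + r *\<^sub>R b)) has_vector_derivative f' x) (at 0)" "symbol_est b q n (\<lambda>x. g x * q x) f'"
    using symbol_est_derivE[OF Suc.prems(1)] by metis
  note IH = Suc.IH[OF symbol_est_pred[OF Suc.prems]]
  let ?C = "inverse_const M n"
  have hn: "0 \<le> h x" for x using h norm_ge_zero order_trans by blast
  have C: "1 \<le> ?C" by (rule inverse_const_ge_1)
  show ?case
  proof (rule symbol_est_SucI)
    show "continuous_on UNIV (\<lambda>x. inverse (f x))"
      using symbol_est_cont[OF Suc.prems] nz by (intro continuous_intros) auto
    show "norm (inverse (f x)) \<le> inverse_const M (Suc n) * h x" for x
      using h[of x] mult_right_mono[OF inverse_const_ge_1 hn, of x M "Suc n"] by simp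
    show "((\<lambda>r. inverse (f (x + r *\<^sub>R b))) has_vector_derivative (- 1) * (f' x * (inverse (f x) * inverse (f x)))) (at 0)" for x
      using 1(1)[of x] nz[of x] unfolding has_vector_derivative_def
      by (auto intro!: derivative_eq_intros simp: fun_eq_iff scaleR_conv_of_real algebra_simps)
    have "symbol_est b q n (\<lambda>x. norm (- 1 :: 'b) * (2 ^ n * ((g x * q x) * (2 ^ n * ((?C * h x) * (?C * h x))))))
       (\<lambda>x. (- 1) * (f' x * (inverse (f x) * inverse (f x))))"
      by (intro symbol_est_cmult symbol_est_mult 1 IH q)
    then show "symbol_est b q n (\<lambda>x. inverse_const M (Suc n) * h x * q x) (\<lambda>x. (- 1) * (f' x * (inverse (f x) * inverse (f x))))"
    proof (rule symbol_est_mono[OF _ _ q])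
      fix x
      have "norm (- 1 :: 'b) * (2 ^ n * ((g x * q x) * (2 ^ n * ((?C * h x) * (?C * h x))))) = (2 ^ (2 * n) * ?C\<^sup>2 * (g x * h x)) * (h x * q x)"
        by (simp add: power2_eq_square power_add mult_2)
      also have "\<dots> \<le> (2 ^ (2 * n) * ?C\<^sup>2 * M) * (h x * q x)"
        using M[of x] hn[of x] q[of x] by (intro mult_right_mono mult_left_mono) auto
      also have "\<dots> \<le> inverse_const M (Suc n) * (h x * q x)"
        using hn[of x] q[of x] by (intro mult_right_mono) auto
      finally show "norm (- 1 :: 'b) * (2 ^ n * ((g x * q x) * (2 ^ n * ((?C * h x) * (?C * h x))))) \<le> inverse_const M (Suc n) * h x * q x"
        by (simp add: mult.assoc)
    qed
  qed
qed

primrec exp_const :: "real \<Rightarrow> nat \<Rightarrow> real" where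
  "exp_const K 0 = 1"
| "exp_const K (Suc n) = max (exp_const K n) (2 ^ n * K * exp_const K n)"

lemma exp_const_ge_1: "1 \<le> exp_const K n"
  by (induction n) auto

lemma has_vector_derivative_cis_phase:
  fixes b :: "'a::real_normed_vector"
  assumes "((\<lambda>r. \<psi> (x + r *\<^sub>R b)) has_real_derivative d) (at 0)"
  shows "((\<lambda>r. exp (\<i> * of_real (\<psi> (x + r *\<^sub>R b)))) has_vector_derivative (\<i> * (of_real d * exp (\<i> * of_real (\<psi> x))))) (at 0)"
proof -
  have i: "((\<lambda>r. \<i> * complex_of_real (\<psi> (x + r *\<^sub>R b))) has_vector_derivative \<i> * of_real d) (at 0)"
    using assms by (intro has_vector_derivative_mult_right has_vector_derivative_of_real)
       (simp add: has_real_derivative_iff_has_vector_derivative)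
  have z: "x + 0 *\<^sub>R b = x" by simp
  show ?thesis
    using field_vector_diff_chain_at[OF i DERIV_exp] unfolding z o_def mult.assoc .
qed

text \<open>The derivative i \<psi>' exp(i \<psi>) contains the exponential again, so the estimate
  feeds on itself. The premise on \<psi>' is conditional because order n - 1 of \<psi>' is consumed,
  and nothing at all when n = 0.\<close>

lemma symbol_est_exp:
  assumes \<psi>: "\<And>x. ((\<lambda>r. \<psi> (x + r *\<^sub>R b)) has_real_derivative \<psi>' x) (at 0)" "continuous_on UNIV \<psi>"
    and \<psi>': "\<And>m. n = Suc m \<Longrightarrow> symbol_est b q m (\<lambda>x. K * q x) \<psi>'" and q: "\<And>x. 0 \<le> q x" and K: "0 \<le> K"
  shows "symbol_est b q n (\<lambda>x. exp_const K n) (\<lambda>x. exp (\<i> * of_real (\<psi> x)))"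
  using \<psi>'
proof (induction n)
  case 0
  then show ?case using \<psi>(2) by (auto intro!: continuous_intros)
next
  case (Suc n)
  have IH: "symbol_est b q n (\<lambda>x. exp_const K n) (\<lambda>x. exp (\<i> * of_real (\<psi> x)))"
    by (rule Suc.IH) (use Suc.prems[of n] in \<open>auto intro: symbol_est_pred simp del: symbol_est.simps\<close>)
  show ?case
  proof (rule symbol_est_SucI)
    show "continuous_on UNIV (\<lambda>x. exp (\<i> * of_real (\<psi> x)))"
      using \<psi>(2) by (auto intro!: continuous_intros)
    show "norm (exp (\<i> * of_real (\<psi> x))) \<le> exp_const K (Suc n)" for x
      using exp_const_ge_1[of K "Suc n"] by simp
    show "((\<lambda>r. exp (\<i> * of_real (\<psi> (x + r *\<^sub>R b)))) has_vector_derivative (\<i> * (of_real (\<psi>' x) * exp (\<i> * of_real (\<psi> x))))) (at 0)" for x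
      by (rule has_vector_derivative_cis_phase[OF \<psi>(1)])
    have "symbol_est b q n (\<lambda>x. norm \<i> * (2 ^ n * ((K * q x) * exp_const K n))) (\<lambda>x. \<i> * (of_real (\<psi>' x) * exp (\<i> * of_real (\<psi> x))))"
      by (intro symbol_est_cmult symbol_est_mult symbol_est_of_real IH q Suc.prems) simp
    then show "symbol_est b q n (\<lambda>x. exp_const K (Suc n) * q x) (\<lambda>x. \<i> * (of_real (\<psi>' x) * exp (\<i> * of_real (\<psi> x))))"
    proof (rule symbol_est_mono[OF _ _ q])
      fix x
      have "2 ^ n * K * exp_const K n * q x \<le> exp_const K (Suc n) * q x"
        by (intro mult_right_mono q) simp
      then show "norm \<i> * (2 ^ n * ((K * q x) * exp_const K n)) \<le> exp_const K (Suc n) * q x"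
        by (simp add: algebra_simps)
    qed
  qed
qed

text \<open>Estimating 1 and the exponential separately would lose the smallness. The value is
  bounded by \<open>g\<close>, and every derivative carries a factor \<open>K\<close> because the
  constant 1 drops out on differentiation; so the majorant tends to \<open>g\<close> as
  \<open>K\<close> tends to 0.\<close>

lemma symbol_est_one_minus_exp:
  assumes \<psi>: "\<And>x. ((\<lambda>r. \<psi> (x + r *\<^sub>R b)) has_real_derivative \<psi>' x) (at 0)" "continuous_on UNIV \<psi>"
    and \<psi>': "\<And>m. n = Suc m \<Longrightarrow> symbol_est b q m (\<lambda>x. K * q x) \<psi>'" and q: "\<And>x. 0 \<le> q x" and K: "0 \<le> K"
    and g0: "\<And>x. norm (1 - exp (\<i> * of_real (\<psi> x))) \<le> g x"
  shows "symbol_est b q n (\<lambda>x. g x + 2 ^ n * K * exp_const K n) (\<lambda>x. 1 - exp (\<i> * of_real (\<psi> x)))"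
proof (cases n)
  case 0
  then show ?thesis using \<psi>(2) K g0 by (auto intro!: continuous_intros add_increasing2)
next
  case (Suc m)
  have E: "symbol_est b q m (\<lambda>x. exp_const K m) (\<lambda>x. exp (\<i> * of_real (\<psi> x)))"
    by (rule symbol_est_exp[OF \<psi> _ q K]) (use \<psi>'[OF Suc] in \<open>auto intro: symbol_est_pred simp del: symbol_est.simps\<close>)
  have gn: "0 \<le> g x" for x using g0 norm_ge_zero order_trans by blast
  have nn: "0 \<le> 2 ^ n * K * exp_const K n" for n using K exp_const_ge_1[of K n] by simp
  show ?thesis unfolding Suc
  proof (rule symbol_est_SucI)
    show "continuous_on UNIV (\<lambda>x. 1 - exp (\<i> * of_real (\<psi> x)))"
      using \<psi>(2) by (auto intro!: continuous_intros)
    show "norm (1 - exp (\<i> * of_real (\<psi> x))) \<le> g x + 2 ^ Suc m * K * exp_const K (Suc m)" for x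
      using g0[of x] nn[of "Suc m"] by linarith
    show "((\<lambda>r. 1 - exp (\<i> * of_real (\<psi> (x + r *\<^sub>R b)))) has_vector_derivative (- \<i>) * (of_real (\<psi>' x) * exp (\<i> * of_real (\<psi> x)))) (at 0)" for x
      using has_vector_derivative_diff[OF has_vector_derivative_const has_vector_derivative_cis_phase[OF \<psi>(1)], of 1] by simp
    have "symbol_est b q m (\<lambda>x. norm (- \<i>) * (2 ^ m * ((K * q x) * exp_const K m))) (\<lambda>x. (- \<i>) * (of_real (\<psi>' x) * exp (\<i> * of_real (\<psi> x))))"
      by (intro symbol_est_cmult symbol_est_mult symbol_est_of_real E q \<psi>' Suc)
    then show "symbol_est b q m (\<lambda>x. (g x + 2 ^ Suc m * K * exp_const K (Suc m)) * q x) (\<lambda>x. (- \<i>) * (of_real (\<psi>' x) * exp (\<i> * of_real (\<psi> x))))"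
    proof (rule symbol_est_mono[OF _ _ q])
      fix x
      have "2 ^ m * K * exp_const K m \<le> 2 ^ Suc m * K * exp_const K (Suc m)"
        using K exp_const_ge_1[of K m] by (intro mult_mono) auto
      then have "2 ^ m * K * exp_const K m * q x \<le> (g x + 2 ^ Suc m * K * exp_const K (Suc m)) * q x"
        using gn[of x] by (intro mult_right_mono q) linarith
      then show "norm (- \<i>) * (2 ^ m * ((K * q x) * exp_const K m)) \<le> (g x + 2 ^ Suc m * K * exp_const K (Suc m)) * q x"
        by (simp add: algebra_simps)
    qed
  qed
qed

section \<open>Non-stationary phase\<close>

text \<open>Integrating \<open>f (x + b) - f x\<close> over all \<open>x\<close> avoids any assumption of decay of \<open>f\<close>.\<close>

lemma integral_directional_derivative_eq_0:
  fixes f f' :: "'a::euclidean_space \<Rightarrow> complex"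
  assumes der: "\<And>x. ((\<lambda>r. f (x + r *\<^sub>R b)) has_vector_derivative f' x) (at 0)"
    and cont: "continuous_on UNIV f'" and f: "integrable lborel f" and f': "integrable lborel f'"
  shows "(LINT x|lborel. f' x) = 0"
proof -
  have [measurable]: "f' \<in> borel_measurable borel" using borel_measurable_integrable[OF f'] by simp
  have shift: "integrable lborel (\<lambda>x. g (x + c)) \<longleftrightarrow> integrable lborel g" "(LINT x|lborel. g (x + c)) = (LINT x|lborel. g x)"
    for g :: "'a \<Rightarrow> 'b::{banach,second_countable_topology}" and c
    using lborel_integrable_affine[of 1 g c] lborel_integral_affine[of 1 g c] by (simp_all add: add.commute)
  have d: "((\<lambda>r. f (x + r *\<^sub>R b)) has_vector_derivative f' (x + r *\<^sub>R b)) (at r)" for x r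
  proof -
    have "((\<lambda>s. f (x + r *\<^sub>R b + s *\<^sub>R b)) has_vector_derivative f' (x + r *\<^sub>R b)) (at (r - r))"
      using der[of "x + r *\<^sub>R b"] by simp
    then have "((\<lambda>s. f (x + r *\<^sub>R b + s *\<^sub>R b)) \<circ> (\<lambda>s. s - r) has_vector_derivative 1 *\<^sub>R f' (x + r *\<^sub>R b)) (at r)"
      by (intro vector_diff_chain_at) (auto intro!: derivative_eq_intros simp: has_vector_derivative_def)
    then show ?thesis by (simp add: o_def algebra_simps)
  qed
  have ftc: "(LINT r|lborel. indicator {0..1} r *\<^sub>R f' (x + r *\<^sub>R b)) = f (x + b) - f x" for x
  proof -
    have "continuous_on {0..1} (\<lambda>r. f' (x + r *\<^sub>R b))"
      by (rule continuous_on_compose2[OF cont]) (intro continuous_intros, simp)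
    from integral_FTC_Icc[OF _ has_vector_derivative_at_within[OF d] this] show ?thesis by simp
  qed
  have "0 = (LINT x|lborel. f (x + b) - f x)"
    using f shift(1)[of f b] shift(2)[of f b] by simp
  also have "\<dots> = (LINT x|lborel. (LINT r|lborel. indicator {0..1} r *\<^sub>R f' (x + r *\<^sub>R b)))"
    by (simp only: ftc)
  \<comment> \<open>By translation invariance the inner integral is the same for every
    \<open>r\<close>, so averaging over the unit interval returns the integral of
    \<open>f'\<close>.\<close>
  also have "\<dots> = (LINT r|lborel. (LINT x|lborel. indicator {0..1} r *\<^sub>R f' (x + r *\<^sub>R b)))"
  proof (rule lborel_pair.Fubini_integral)
    show "integrable (lborel \<Otimes>\<^sub>M lborel) (\<lambda>(r, x). indicator {0..1::real} r *\<^sub>R f' (x + r *\<^sub>R b))"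
    proof (rule lborel_pair.Fubini_integrable)
      have "(\<lambda>r. LINT x|lborel. norm (case (r, x) of (r, x) \<Rightarrow> indicator {0..1::real} r *\<^sub>R f' (x + r *\<^sub>R b)))
         = (\<lambda>r. indicator {0..1} r *\<^sub>R (LINT x|lborel. norm (f' x)))"
        using shift(2)[of "\<lambda>x. norm (f' x)"] by (simp add: fun_eq_iff)
      then show "integrable lborel (\<lambda>r. LINT x|lborel. norm (case (r, x) of (r, x) \<Rightarrow> indicator {0..1::real} r *\<^sub>R f' (x + r *\<^sub>R b)))"
        by (simp only:) (intro integrable_scaleR_left integrable_real_indicator, auto)
      show "AE r in lborel. integrable lborel (\<lambda>x. case (r, x) of (r, x) \<Rightarrow> indicator {0..1::real} r *\<^sub>R f' (x + r *\<^sub>R b))"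
        using shift(1)[of f'] f' by auto
    qed measurable
  qed
  also have "\<dots> = (LINT r|lborel. indicator {0..1::real} r *\<^sub>R (LINT x|lborel. f' x))"
    using shift(2)[of f'] by simp
  also have "\<dots> = (LINT x|lborel. f' x)" by simp
  finally show ?thesis by simp
qed

text \<open>The factor of each step is the loss of one integration by parts: 2k + 1 from the power
  of \<open>ej\<close>, 1 more from the derivative of the amplitude, and 2^k from the product
  rule.\<close>

primrec phase_const :: "nat \<Rightarrow> real" where
  "phase_const 0 = 1"
| "phase_const (Suc k) = real (2 * k + 2) * 2 ^ k * phase_const k"

lemma phase_const_nonneg: "0 \<le> phase_const k"
  by (induction k) auto

text \<open>Setting for integration by parts in one direction \<open>b\<close>: \<open>ej\<close> is
  the derivative of the phase along \<open>b\<close>, \<rho> stands for the size of the full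
  gradient, and \<sigma> * V controls its inverse, with \<sigma> carrying the decay. The symbol
  estimate of \<open>ej\<close> is relative to \<rho> because \<open>ej\<close> itself may vanish
  where the gradient does not.\<close>

context
  fixes b :: "'a::euclidean_space" and q \<rho> V gF ej \<psi> :: "'a \<Rightarrow> real" and \<sigma> :: real and N :: nat
  assumes q1: "\<And>x. 1 \<le> q x" and V1: "\<And>x. 1 \<le> V x" and \<rho>0: "\<And>x. 0 < \<rho> x"
    and \<rho>V: "\<And>x. inverse (\<rho> x) \<le> \<sigma> * V x" and gF0: "\<And>x. 0 \<le> gF x"
    and \<psi>: "\<And>x. ((\<lambda>r. \<psi> (x + r *\<^sub>R b)) has_real_derivative ej x) (at 0)" "continuous_on UNIV \<psi>"
    and ej: "symbol_est b q N \<rho> ej"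
    and int: "integrable lborel (\<lambda>x. gF x * q x ^ N * V x ^ N)"
begin

lemma sigma_nonneg: "0 \<le> \<sigma>"
proof -
  have "0 < \<sigma> * V undefined" using \<rho>V[of undefined] \<rho>0[of undefined] by (smt (verit) positive_imp_inverse_positive)
  then show ?thesis using V1[of undefined] by (simp add: zero_less_mult_iff)
qed

text \<open>The powers of \<open>q\<close> and \<open>V\<close> are raised to \<open>N\<close> so
  that a single integrable function dominates all intermediate terms. The factor \<sigma> keeps its
  exact power: it may be less than 1, and \<sigma>^N is the decay that is wanted.\<close>

lemma phase_majorant:
  assumes "a \<le> N" "i \<le> N"
  shows "gF x * q x ^ a * inverse (\<rho> x) ^ i \<le> \<sigma> ^ i * (gF x * q x ^ N * V x ^ N)"
proof -
  have "inverse (\<rho> x) ^ i \<le> (\<sigma> * V x) ^ i"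
    using \<rho>V[of x] \<rho>0[of x] by (intro power_mono) auto
  also have "\<dots> \<le> \<sigma> ^ i * V x ^ N"
    unfolding power_mult_distrib using sigma_nonneg V1 assms by (intro mult_left_mono power_increasing) auto
  finally have "gF x * q x ^ a * inverse (\<rho> x) ^ i \<le> gF x * q x ^ N * (\<sigma> ^ i * V x ^ N)"
    using gF0[of x] q1[of x] \<rho>0[of x] assms by (intro mult_mono power_increasing) auto
  then show ?thesis by (simp add: algebra_simps)
qed

lemma phase_integrable:
  fixes u :: "'a \<Rightarrow> complex"
  assumes "continuous_on UNIV u" "a \<le> N" "i \<le> N" "0 \<le> M" "\<And>x. norm (u x) \<le> M * (gF x * q x ^ a * inverse (\<rho> x) ^ i)"
  shows "integrable lborel u"
proof (rule Bochner_Integration.integrable_bound)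
  show "integrable lborel (\<lambda>x. M * \<sigma> ^ i * (gF x * q x ^ N * V x ^ N))" using int by simp
  show "u \<in> borel_measurable lborel" using assms by (simp add: borel_measurable_continuous_onI)
  show "AE x in lborel. norm (u x) \<le> norm (M * \<sigma> ^ i * (gF x * q x ^ N * V x ^ N))"
  proof (rule AE_I2)
    fix x
    have "norm (u x) \<le> M * (\<sigma> ^ i * (gF x * q x ^ N * V x ^ N))"
      using assms(5)[of x] mult_left_mono[OF phase_majorant[OF assms(2,3)] assms(4), of x] by linarith
    then show "norm (u x) \<le> norm (M * \<sigma> ^ i * (gF x * q x ^ N * V x ^ N))" by (simp add: mult.assoc)
  qed
qed

text \<open>Each step trades the factor \<open>ej\<^sup>2\<close> for one derivative: one power of \<open>ej\<close> is absorbed by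
  differentiating the oscillating exponential, the other keeps the new amplitude divisible by an even power.\<close>

lemma phase_induct:
  assumes "k \<le> N" "0 \<le> K" "symbol_est b q k (\<lambda>x. K * (gF x * q x ^ (N - k) * inverse (\<rho> x) ^ (N + k))) c"
  shows "norm (LINT x|lborel. of_real (ej x ^ (2 * k)) * c x * exp (\<i> * of_real (\<psi> x)))
      \<le> phase_const k * K * \<sigma> ^ N * (LINT x|lborel. gF x * q x ^ N * V x ^ N)"
  using assms
proof (induction k arbitrary: K c)
  case 0
  have c: "continuous_on UNIV c" and cn: "norm (c x) \<le> K * (gF x * q x ^ N * inverse (\<rho> x) ^ N)" for x
    using symbol_est_cont[OF 0(3)] symbol_est_norm[OF 0(3), of x] by auto
  have "continuous_on UNIV (\<lambda>x. c x * exp (\<i> * of_real (\<psi> x)))"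
    using \<psi>(2) c by (intro continuous_intros)
  then have i: "integrable lborel (\<lambda>x. c x * exp (\<i> * of_real (\<psi> x)))"
    by (rule phase_integrable[of _ N N K]) (use cn 0 in \<open>auto simp: norm_mult\<close>)
  have "norm (LINT x|lborel. c x * exp (\<i> * of_real (\<psi> x))) \<le> (LINT x|lborel. norm (c x * exp (\<i> * of_real (\<psi> x))))"
    by (rule integral_norm_bound)
  also have "\<dots> \<le> (LINT x|lborel. K * \<sigma> ^ N * (gF x * q x ^ N * V x ^ N))"
  proof (rule integral_mono)
    show "norm (c x * exp (\<i> * of_real (\<psi> x))) \<le> K * \<sigma> ^ N * (gF x * q x ^ N * V x ^ N)" for x
      using cn[of x] mult_left_mono[OF phase_majorant[of N N x] 0(2)] by (simp add: norm_mult mult.assoc)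
  qed (use i int in auto)
  finally show ?case by simp
next
  case (Suc k)
  have N: "N = Suc (N - 1)" "N - k = Suc (N - Suc k)" using Suc.prems(1) by auto
  obtain c' where c': "\<And>x. ((\<lambda>r. c (x + r *\<^sub>R b)) has_vector_derivative c' x) (at 0)"
    "symbol_est b q k (\<lambda>x. K * (gF x * q x ^ (N - Suc k) * inverse (\<rho> x) ^ (N + Suc k)) * q x) c'"
    by (rule symbol_est_derivE[OF Suc.prems(3)]) (rule that)
  have ejs: "symbol_est b q (Suc (N - 1)) \<rho> ej" using ej N(1) by simp
  obtain e' where e': "\<And>x. ((\<lambda>r. ej (x + r *\<^sub>R b)) has_vector_derivative e' x) (at 0)"
    "symbol_est b q (N - 1) (\<lambda>x. \<rho> x * q x) e'"
    by (rule symbol_est_derivE[OF ejs]) (rule that)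
  \<comment> \<open>The new amplitude: ej^(2k) * c2 is the directional derivative of ej^(2k+1) *
    c.\<close>
  define c2 where "c2 x = complex_of_real (2 * real k + 1) * (of_real (e' x) * c x) + of_real (ej x) * c' x" for x
  have q0: "0 \<le> q x" for x using q1[of x] by simp
  have s2: "symbol_est b q k (\<lambda>x. (real (2 * k + 2) * 2 ^ k * K) * (gF x * q x ^ (N - k) * inverse (\<rho> x) ^ (N + k))) c2"
  proof -
    have ej': "symbol_est b q k (\<lambda>x. \<rho> x * q x) e'" using e'(2) Suc.prems(1) by (auto intro: symbol_est_le)
    have ejk: "symbol_est b q k \<rho> ej" using ej Suc.prems(1) by (auto intro: symbol_est_le)
    have *: "symbol_est b q k (\<lambda>x. norm (complex_of_real (2 * real k + 1)) *
          (2 ^ k * (\<rho> x * q x * (K * (gF x * q x ^ (N - Suc k) * inverse (\<rho> x) ^ (N + Suc k)))))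
        + 2 ^ k * (\<rho> x * (K * (gF x * q x ^ (N - Suc k) * inverse (\<rho> x) ^ (N + Suc k)) * q x))) c2"
      unfolding c2_def
      by (intro symbol_est_add symbol_est_cmult symbol_est_mult symbol_est_of_real ej' ejk c' q0 symbol_est_pred[OF Suc.prems(3)])
    show ?thesis
    proof (rule symbol_est_mono[OF * _ q0])
      fix x
      have nrm: "norm (complex_of_real (2 * real k + 1)) = 2 * real k + 1" by (subst norm_of_real) simp
      define X where "X = K * (gF x * q x ^ (N - Suc k) * inverse (\<rho> x) ^ (N + Suc k))"
      define Y where "Y = K * (gF x * q x ^ (N - k) * inverse (\<rho> x) ^ (N + k))"
      have "r * s * (K * (g * A * (inverse r * I))) = K * (g * (s * A) * I)" if "0 < r" for r s g A I :: real
        using that by (simp add: field_simps)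
      \<comment> \<open>One factor 1/\<rho> of the old amplitude pays for the \<rho> in the bounds
        of \<open>ej\<close> and \<open>e'\<close>, and the factor q from differentiating raises the
        exponent N - Suc k to N - k.\<close>
      from this[OF \<rho>0] have XY: "\<rho> x * q x * X = Y"
        unfolding X_def Y_def N(2) power_Suc add_Suc_right .
      have "norm (complex_of_real (2 * real k + 1)) * (2 ^ k * (\<rho> x * q x * X)) + 2 ^ k * (\<rho> x * (X * q x))
         = (2 * real k + 1) * (2 ^ k * Y) + 2 ^ k * Y"
        unfolding nrm XY[symmetric] by (simp add: mult_ac)
      also have "\<dots> = real (2 * k + 2) * 2 ^ k * Y" by (simp add: algebra_simps)
      finally show "norm (complex_of_real (2 * real k + 1)) *
          (2 ^ k * (\<rho> x * q x * (K * (gF x * q x ^ (N - Suc k) * inverse (\<rho> x) ^ (N + Suc k)))))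
        + 2 ^ k * (\<rho> x * (K * (gF x * q x ^ (N - Suc k) * inverse (\<rho> x) ^ (N + Suc k)) * q x))
        \<le> (real (2 * k + 2) * 2 ^ k * K) * (gF x * q x ^ (N - k) * inverse (\<rho> x) ^ (N + k))"
        unfolding X_def Y_def by (simp only: mult.assoc)
    qed
  qed
  let ?E = "\<lambda>x. exp (\<i> * complex_of_real (\<psi> x))"
  define u where "u x = of_real (ej x ^ (2 * k)) * c2 x * ?E x" for x
  define v where "v x = of_real (ej x ^ (2 * Suc k)) * c x * ?E x" for x
  \<comment> \<open>\<open>f\<close> has one power of \<open>ej\<close> less than \<open>v\<close>,
    because differentiating the exponential supplies it. Hence its derivative is u + i v, and the
    integrals of \<open>u\<close> and \<open>v\<close> have the same modulus.\<close>
  define f where "f x = of_real (ej x ^ (2 * k + 1)) * c x * ?E x" for x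
  have cej: "continuous_on UNIV ej" and cc: "continuous_on UNIV c" and cc2: "continuous_on UNIV c2"
    using symbol_est_cont ej Suc.prems(3) s2 by blast+
  have cu: "continuous_on UNIV u" and cv: "continuous_on UNIV v" and cf: "continuous_on UNIV f"
    unfolding u_def v_def f_def using \<psi>(2) cej cc cc2 by (auto intro!: continuous_intros)
  have ejn: "\<bar>ej x\<bar> \<le> \<rho> x" for x using symbol_est_norm[OF ej, of x] by simp
  have cn: "norm (c x) \<le> K * (gF x * q x ^ (N - Suc k) * inverse (\<rho> x) ^ (N + Suc k))" for x
    by (rule symbol_est_norm[OF Suc.prems(3)])
  have en: "norm (complex_of_real (ej x ^ m)) \<le> \<rho> x ^ m" for x m
    using power_mono[OF ejn[of x], of m] by (simp add: norm_power power_abs)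
  have pw: "\<rho> x ^ m * inverse (\<rho> x) ^ (m + l) = inverse (\<rho> x) ^ l" for m l x
    using \<rho>0[of x] by (simp add: power_add power_inverse)
  have iu: "integrable lborel u"
  proof (rule phase_integrable[OF cu, of "N - k" "N - k" "real (2 * k + 2) * 2 ^ k * K"])
    fix x
    have "norm (u x) \<le> \<rho> x ^ (2 * k) * ((real (2 * k + 2) * 2 ^ k * K) * (gF x * q x ^ (N - k) * inverse (\<rho> x) ^ (N + k)))"
      unfolding u_def using symbol_est_norm[OF s2, of x] ejn[of x] \<rho>0[of x]
      by (auto simp: norm_mult norm_power intro!: mult_mono power_mono)
    also have "N + k = 2 * k + (N - k)" using Suc.prems by simp
    finally have ub: "norm (u x) \<le> \<rho> x ^ (2 * k) * (real (2 * k + 2) * 2 ^ k * K * (gF x * q x ^ (N - k) * inverse (\<rho> x) ^ (2 * k + (N - k))))" .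
    then show "norm (u x) \<le> real (2 * k + 2) * 2 ^ k * K * (gF x * q x ^ (N - k) * inverse (\<rho> x) ^ (N - k))"
    proof -
      have eq: "\<rho> x ^ (2 * k) * (real (2 * k + 2) * 2 ^ k * K * (gF x * q x ^ (N - k) * inverse (\<rho> x) ^ (2 * k + (N - k))))
        = real (2 * k + 2) * 2 ^ k * K * (gF x * q x ^ (N - k) * (\<rho> x ^ (2 * k) * inverse (\<rho> x) ^ (2 * k + (N - k))))"
        by (simp only: mult_ac)
      show ?thesis using ub unfolding eq pw .
    qed
  qed (use Suc.prems in auto)
  have iv: "integrable lborel v"
  proof (rule phase_integrable[OF cv, of "N - Suc k" "N - Suc k" K])
    fix x
    have "norm (v x) \<le> \<rho> x ^ (2 * Suc k) * (K * (gF x * q x ^ (N - Suc k) * inverse (\<rho> x) ^ (N + Suc k)))"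
      unfolding v_def norm_mult[of _ "exp _"] norm_exp_i_times mult_1_right
      unfolding norm_mult using \<rho>0[of x] by (intro mult_mono en cn) auto
    also have "N + Suc k = 2 * Suc k + (N - Suc k)" using Suc.prems by simp
    finally show "norm (v x) \<le> K * (gF x * q x ^ (N - Suc k) * inverse (\<rho> x) ^ (N - Suc k))"
      using pw[of x "2 * Suc k" "N - Suc k"] by (simp only: mult_ac)
  qed (use Suc.prems in auto)
  have "integrable lborel f"
  proof (rule phase_integrable[OF cf, of "N - Suc k" "N - k" K])
    fix x
    have "norm (f x) \<le> \<rho> x ^ (2 * k + 1) * (K * (gF x * q x ^ (N - Suc k) * inverse (\<rho> x) ^ (N + Suc k)))"
      unfolding f_def norm_mult[of _ "exp _"] norm_exp_i_times mult_1_right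
      unfolding norm_mult using \<rho>0[of x] by (intro mult_mono en cn) auto
    also have "N + Suc k = 2 * k + 1 + (N - k)" using Suc.prems by simp
    finally show "norm (f x) \<le> K * (gF x * q x ^ (N - Suc k) * inverse (\<rho> x) ^ (N - k))"
      using pw[of x "2 * k + 1" "N - k"] by (simp only: mult_ac)
  qed (use Suc.prems in auto)
  moreover have "((\<lambda>r. f (x + r *\<^sub>R b)) has_vector_derivative (u x + \<i> * v x)) (at 0)" for x
  proof -
    have 1: "((\<lambda>r. complex_of_real (ej (x + r *\<^sub>R b) ^ (2 * k + 1))) has_vector_derivative of_real (real (2 * k + 1) * ej x ^ (2 * k) * e' x)) (at 0)"
    proof (rule has_vector_derivative_of_real)
      have "((\<lambda>r. ej (x + r *\<^sub>R b)) has_real_derivative e' x) (at 0)"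
        using e'(1) by (simp add: has_real_derivative_iff_has_vector_derivative)
      from DERIV_power[OF this, of "2 * k + 1"]
      show "((\<lambda>r. ej (x + r *\<^sub>R b) ^ (2 * k + 1)) has_real_derivative real (2 * k + 1) * ej x ^ (2 * k) * e' x) (at 0)"
        by (simp add: algebra_simps)
    qed
    show ?thesis
      unfolding f_def
      by (rule has_vector_derivative_eq_rhs[OF has_vector_derivative_mult[OF has_vector_derivative_mult[OF 1 c'(1)] has_vector_derivative_cis_phase[OF \<psi>(1)]]])
         (simp add: u_def v_def c2_def algebra_simps)
  qed
  ultimately have "(LINT x|lborel. u x + \<i> * v x) = 0"
    using iu iv cu cv by (intro integral_directional_derivative_eq_0[of f b]) (auto intro!: continuous_intros)
  then have "(LINT x|lborel. u x) = - \<i> * (LINT x|lborel. v x)"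
    using iu iv by (simp add: add_eq_0_iff)
  then have "norm (LINT x|lborel. v x) = norm (LINT x|lborel. u x)"
    by (simp add: norm_mult)
  also have "\<dots> \<le> phase_const k * (real (2 * k + 2) * 2 ^ k * K) * \<sigma> ^ N * (LINT x|lborel. gF x * q x ^ N * V x ^ N)"
    unfolding u_def by (rule Suc.IH[OF _ _ s2]) (use Suc.prems in auto)
  finally show ?case unfolding v_def by (simp add: mult_ac)
qed

end

text \<open>The factors are the number of directions, the loss of \<open>N\<close> integrations by
  parts, and the symbol constant of the amplitude divided by the sum of the 2N-th powers of the
  gradient components.\<close>

definition phase_bound :: "nat \<Rightarrow> nat \<Rightarrow> real" where
  "phase_bound d N = real d * (phase_const N * (2 ^ N * (inverse_const (real d * 2 ^ (N * (2 * N)) * real d ^ N) N * real d ^ N)))"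

theorem nonstationary_phase:
  fixes e :: "real^'n::finite \<Rightarrow> real^'n" and F :: "real^'n \<Rightarrow> complex" and q V gF \<psi> :: "real^'n \<Rightarrow> real"
  assumes q1: "\<And>x. 1 \<le> q x" and V1: "\<And>x. 1 \<le> V x" and e0: "\<And>x. e x \<noteq> 0"
    and eV: "\<And>x. inverse (norm (e x)) \<le> \<sigma> * V x"
    and \<psi>: "\<And>j x. ((\<lambda>r. \<psi> (x + r *\<^sub>R axis j 1)) has_real_derivative e x $ j) (at 0)" "continuous_on UNIV \<psi>"
    and e: "\<And>j k. symbol_est (axis j 1) q N (\<lambda>x. norm (e x)) (\<lambda>x. e x $ k)"
    and F: "\<And>j. symbol_est (axis j 1) q N gF F"
    and int: "integrable lborel (\<lambda>x. gF x * q x ^ N * V x ^ N)"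
  shows "norm (LINT x|lborel. F x * exp (\<i> * of_real (\<psi> x)))
    \<le> phase_bound CARD('n) N * \<sigma> ^ N * (LINT x|lborel. gF x * q x ^ N * V x ^ N)"
proof -
  define d where "d = CARD('n)"
  have d: "0 < d" by (simp add: d_def)
  define S where "S x = (\<Sum>k\<in>UNIV. (e x $ k) ^ (2 * N))" for x
  have q0: "0 \<le> q x" for x using q1[of x] by simp
  have n0: "0 < norm (e x)" for x using e0 by simp
  have Sge: "(norm (e x) ^ 2 / d) ^ N \<le> S x" for x
  proof -
    \<comment> \<open>The largest squared component is at least the mean of all of them; this keeps
      \<open>S\<close> comparable to |e|^(2N).\<close>
    have "\<exists>k. (norm (e x))\<^sup>2 / d \<le> (e x $ k)\<^sup>2"
    proof (rule ccontr)
      assume "\<nexists>k. (norm (e x))\<^sup>2 / d \<le> (e x $ k)\<^sup>2"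
      then have "(\<Sum>k\<in>UNIV. (e x $ k)\<^sup>2) < (\<Sum>k\<in>(UNIV::'n set). (norm (e x))\<^sup>2 / d)"
        by (intro sum_strict_mono) (auto simp: not_le)
      then show False using d by (simp add: d_def norm_vec_def L2_set_def sum_nonneg)
    qed
    then obtain k where "(norm (e x))\<^sup>2 / d \<le> (e x $ k)\<^sup>2" by blast
    then have "((norm (e x))\<^sup>2 / d) ^ N \<le> ((e x $ k)\<^sup>2) ^ N" by (intro power_mono) auto
    also have "\<dots> = (e x $ k) ^ (2 * N)" by (simp add: power_mult)
    also have "\<dots> \<le> S x" unfolding S_def by (rule member_le_sum) auto
    finally show ?thesis .
  qed
  have Spos: "0 < S x" for x
    by (rule less_le_trans[OF _ Sge]) (use n0 d in auto)
  have Sinv: "norm (inverse (S x)) \<le> real d ^ N * inverse (norm (e x)) ^ (2 * N)" for x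
  proof -
    have "inverse (S x) \<le> inverse ((norm (e x) ^ 2 / d) ^ N)"
      using Sge[of x] n0[of x] d by (intro le_imp_inverse_le) auto
    also have "\<dots> = real d ^ N * inverse (norm (e x)) ^ (2 * N)"
    proof -
      have "(norm (e x) ^ 2 / d) ^ N = norm (e x) ^ (2 * N) / real d ^ N"
        by (simp only: power_divide power_mult)
      then show ?thesis by (simp add: power_inverse divide_inverse)
    qed
    finally show ?thesis using Spos[of x] by simp
  qed
  \<comment> \<open>Bounds the product of the majorants of \<open>S\<close> and of its inverse, in
    which the powers of |e| cancel.\<close>
  define M where "M = real d * 2 ^ (N * (2 * N)) * real d ^ N"
  have Sym: "symbol_est (axis j 1) q N (\<lambda>x. real d * (2 ^ (N * (2 * N)) * norm (e x) ^ (2 * N))) S" for j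
  proof -
    have "symbol_est (axis j 1) q N (\<lambda>x. \<Sum>k\<in>(UNIV::'n set). 2 ^ (N * (2 * N)) * norm (e x) ^ (2 * N)) S"
      unfolding S_def by (intro symbol_est_sum symbol_est_power e q0) auto
    then show ?thesis by (simp add: d_def)
  qed
  have SI: "symbol_est (axis j 1) q N (\<lambda>x. inverse_const M N * (real d ^ N * inverse (norm (e x)) ^ (2 * N))) (\<lambda>x. inverse (S x))" for j
  proof (rule symbol_est_inverse[OF Sym _ Sinv _ q0])
    show "S x \<noteq> 0" for x using Spos[of x] by simp
    show "real d * (2 ^ (N * (2 * N)) * norm (e x) ^ (2 * N)) * (real d ^ N * inverse (norm (e x)) ^ (2 * N)) \<le> M" for x
      using n0[of x] by (simp add: M_def power_inverse field_simps)
  qed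
  define c where "c x = F x * of_real (inverse (S x))" for x
  define K where "K = 2 ^ N * (inverse_const M N * real d ^ N)"
  have K: "0 \<le> K" unfolding K_def using inverse_const_ge_1[of M N] by simp
  \<comment> \<open>All pieces share the amplitude c = F / S, which is of size |e|^(-2N) relative to
    \<open>F\<close>; the numerators e_j^(2N) are what the \<open>N\<close> integrations by parts
    consume.\<close>
  have c: "symbol_est (axis j 1) q N (\<lambda>x. K * (gF x * q x ^ (N - N) * inverse (norm (e x)) ^ (N + N))) c" for j
  proof -
    have "symbol_est (axis j 1) q N (\<lambda>x. 2 ^ N * (gF x * (inverse_const M N * (real d ^ N * inverse (norm (e x)) ^ (2 * N))))) c"
      unfolding c_def by (intro symbol_est_mult symbol_est_of_real F SI q0)
    then show ?thesis by (simp add: K_def mult_2[symmetric] mult_ac)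
  qed
  have gF0: "0 \<le> gF x" for x using symbol_est_nonneg[OF F] .
  let ?I = "\<lambda>j x. of_real (e x $ j ^ (2 * N)) * c x * exp (\<i> * of_real (\<psi> x))"
  have bound: "norm (LINT x|lborel. ?I j x) \<le> phase_const N * K * \<sigma> ^ N * (LINT x|lborel. gF x * q x ^ N * V x ^ N)" for j
    by (rule phase_induct[OF q1 V1 _ eV gF0 \<psi> e int order_refl K c]) (use n0 in auto)
  have i: "integrable lborel (?I j)" for j
  proof (rule phase_integrable[OF q1 V1 _ eV gF0 \<psi> e int, where a=0 and i=0 and M=K])
    show "continuous_on UNIV (?I j)"
      by (intro continuous_on_mult continuous_on_of_real continuous_on_power continuous_on_exp continuous_on_const
            symbol_est_cont[OF e] symbol_est_cont[OF c] \<psi>(2))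
    fix x
    have "norm (?I j x) = \<bar>e x $ j\<bar> ^ (2 * N) * norm (c x)" by (simp add: norm_mult norm_power)
    also have "\<dots> \<le> norm (e x) ^ (2 * N) * (K * (gF x * q x ^ (N - N) * inverse (norm (e x)) ^ (N + N)))"
      by (intro mult_mono power_mono symbol_est_norm[OF c] component_le_norm_cart) auto
    also have "\<dots> = K * (gF x * q x ^ 0 * (norm (e x) ^ (2 * N) * inverse (norm (e x)) ^ (N + N)))"
      by (simp add: mult_ac)
    also have "norm (e x) ^ (2 * N) * inverse (norm (e x)) ^ (N + N) = inverse (norm (e x)) ^ 0"
      unfolding mult_2 power_mult_distrib[symmetric] using n0[of x] by simp
    finally show "norm (?I j x) \<le> K * (gF x * q x ^ 0 * inverse (norm (e x)) ^ 0)" .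
  qed (use n0 K in auto)
  have "F x * exp (\<i> * of_real (\<psi> x)) = (\<Sum>j\<in>UNIV. ?I j x)" for x
  proof -
    have "(\<Sum>j\<in>UNIV. ?I j x) = of_real (S x) * c x * exp (\<i> * of_real (\<psi> x))"
      by (simp add: S_def sum_distrib_right)
    then show ?thesis using Spos[of x] by (simp add: c_def)
  qed
  then have "norm (LINT x|lborel. F x * exp (\<i> * of_real (\<psi> x))) = norm (\<Sum>j\<in>UNIV. LINT x|lborel. ?I j x)"
    using i by simp
  also have "\<dots> \<le> (\<Sum>j\<in>(UNIV::'n set). phase_const N * K * \<sigma> ^ N * (LINT x|lborel. gF x * q x ^ N * V x ^ N))"
    by (intro sum_norm_le bound)
  finally show ?thesis
    by (simp add: phase_bound_def K_def M_def d_def mult_ac)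
qed

section \<open>Warping functions\<close>

lemma partial_deriv_has_vector_derivative:
  fixes f :: "real^'n::finite \<Rightarrow> 'b::real_normed_vector"
  assumes "f differentiable (at x)"
  shows "((\<lambda>r. f (x + r *\<^sub>R axis j 1)) has_vector_derivative partial_deriv j f x) (at 0)"
proof -
  let ?f' = "frechet_derivative f (at x)"
  have f': "(f has_derivative ?f') (at (x + 0 *\<^sub>R axis j 1))"
    using frechet_derivative_works[THEN iffD1, OF assms] by simp
  have "((\<lambda>r. x + r *\<^sub>R axis j (1::real)) has_derivative (\<lambda>r. r *\<^sub>R axis j 1)) (at 0)"
    by (auto intro!: derivative_eq_intros)
  from diff_chain_at[OF this f'] have "((\<lambda>r. f (x + r *\<^sub>R axis j 1)) has_derivative (\<lambda>r. ?f' (r *\<^sub>R axis j 1))) (at 0)"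
    by (simp add: o_def)
  moreover have "linear ?f'" using f' has_derivative_linear by simp
  ultimately show ?thesis
    by (simp add: has_vector_derivative_def partial_deriv_def linear_scale)
qed

lemma Ck_on_imp_continuous: "Ck_on n UNIV f \<Longrightarrow> continuous_on UNIV f"
  by (cases n) (auto intro: differentiable_imp_continuous_on simp: differentiable_on_def)

lemma Ck_on_funpow:
  assumes "Ck_on n UNIV f" "m \<le> n"
  shows "Ck_on (n - m) UNIV ((partial_deriv j ^^ m) f)"
  using assms(2)
proof (induction m)
  case (Suc m)
  then have "Ck_on (Suc (n - Suc m)) UNIV ((partial_deriv j ^^ m) f)" by (metis Suc_diff_Suc Suc_leD Suc_le_lessD)
  then show ?case by simp
qed (use assms in simp)

lemma Ck_on_funpow_continuous:
  "Ck_on n UNIV f \<Longrightarrow> m \<le> n \<Longrightarrow> continuous_on UNIV ((partial_deriv j ^^ m) f)"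
  by (rule Ck_on_imp_continuous[OF Ck_on_funpow])

lemma Ck_on_funpow_deriv:
  assumes "Ck_on n UNIV f" "m < n"
  shows "((\<lambda>r. (partial_deriv j ^^ m) f (x + r *\<^sub>R axis j 1)) has_vector_derivative (partial_deriv j ^^ Suc m) f x) (at 0)"
proof -
  have "Ck_on (Suc (n - Suc m)) UNIV ((partial_deriv j ^^ m) f)"
    using Ck_on_funpow[OF assms(1), of m j] assms(2) by (simp add: Suc_diff_Suc)
  then show ?thesis by (auto intro: partial_deriv_has_vector_derivative)
qed

lemma iterated_partial_replicate: "iterated_partial (replicate m j) f = (partial_deriv j ^^ m) f"
  by (induction m) (auto simp: iterated_partial_def)

lemma partial_deriv_eqI:
  "(f has_derivative f') (at x) \<Longrightarrow> partial_deriv j f x = f' (axis j 1)"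
  unfolding partial_deriv_def using frechet_derivative_at by metis

lemma Ck_on_bounded_linear:
  assumes L: "bounded_linear L"
  shows "Ck_on k UNIV f \<Longrightarrow> Ck_on k UNIV (\<lambda>x. L (f x))"
proof (induction k arbitrary: f)
  case 0
  then show ?case by (simp add: bounded_linear.continuous_on[OF L])
next
  case (Suc k)
  have d: "((\<lambda>x. L (f x)) has_derivative (\<lambda>h. L (frechet_derivative f (at x) h))) (at x)" for x
    using Suc.prems by (intro bounded_linear.has_derivative[OF L]) (simp add: frechet_derivative_works)
  then have "partial_deriv j (\<lambda>x. L (f x)) = (\<lambda>x. L (partial_deriv j f x))" for j
    by (intro ext) (subst partial_deriv_eqI[OF d], simp add: partial_deriv_def)
  moreover have "x \<in> UNIV \<Longrightarrow> (\<lambda>x. L (f x)) differentiable (at x)" for x using d differentiable_def by blast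
  ultimately show ?case using Suc by simp
qed

lemma Ck_on_add: "Ck_on k UNIV f \<Longrightarrow> Ck_on k UNIV g \<Longrightarrow> Ck_on k UNIV (\<lambda>x. f x + g x)"
proof (induction k arbitrary: f g)
  case 0
  then show ?case by (simp add: continuous_on_add)
next
  case (Suc k)
  have d: "((\<lambda>x. f x + g x) has_derivative (\<lambda>h. frechet_derivative f (at x) h + frechet_derivative g (at x) h)) (at x)" for x
    using Suc.prems by (intro has_derivative_add) (simp_all add: frechet_derivative_works)
  then have "partial_deriv j (\<lambda>x. f x + g x) = (\<lambda>x. partial_deriv j f x + partial_deriv j g x)" for j
    by (intro ext) (subst partial_deriv_eqI[OF d], simp add: partial_deriv_def)
  moreover have "x \<in> UNIV \<Longrightarrow> (\<lambda>x. f x + g x) differentiable (at x)" for x using d differentiable_def by blast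
  ultimately show ?case using Suc by simp
qed

lemma Ck_on_zero: "Ck_on k UNIV (\<lambda>x::real^'n::finite. 0 :: 'b::real_normed_vector)"
proof (induction k)
  case (Suc k)
  have "partial_deriv j (\<lambda>x::real^'n. 0::'b) = (\<lambda>x. 0)" for j
    by (simp add: partial_deriv_def fun_eq_iff)
  then show ?case using Suc by simp
qed simp

lemma Ck_on_sum: "finite I \<Longrightarrow> (\<And>i. i \<in> I \<Longrightarrow> Ck_on k UNIV (f i)) \<Longrightarrow> Ck_on k UNIV (\<lambda>x. \<Sum>i\<in>I. f i x)"
  by (induction I rule: finite_induct) (auto intro: Ck_on_add Ck_on_zero simp del: Ck_on.simps)

lemma has_derivative_shift:
  "(f has_derivative f') (at (x + c)) \<Longrightarrow> ((\<lambda>x. f (x + c)) has_derivative f') (at x)"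
  using diff_chain_at[of "\<lambda>x. x + c" "\<lambda>h. h" x f f'] by (simp add: o_def has_derivative_add_const)

lemma partial_deriv_shift:
  "f differentiable (at (x + c)) \<Longrightarrow> partial_deriv j (\<lambda>x. f (x + c)) x = partial_deriv j f (x + c)"
  by (subst partial_deriv_eqI[OF has_derivative_shift]) (auto simp: frechet_derivative_works partial_deriv_def)

lemma Ck_on_shift: "Ck_on k UNIV f \<Longrightarrow> Ck_on k UNIV (\<lambda>x. f (x + c))"
proof (induction k arbitrary: f)
  case 0
  then show ?case by (auto intro!: continuous_on_compose2[of UNIV f] continuous_intros)
next
  case (Suc k)
  then have "partial_deriv j (\<lambda>x. f (x + c)) = (\<lambda>x. partial_deriv j f (x + c))" for j
    by (auto simp: fun_eq_iff partial_deriv_shift)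
  moreover have "(\<lambda>x. f (x + c)) differentiable (at x)" for x
    using Suc.prems has_derivative_shift by (auto simp: differentiable_def) blast
  ultimately show ?case using Suc by auto
qed

lemma matrix_inv_mult:
  fixes A :: "real^'n::finite^'n"
  assumes "det A \<noteq> 0"
  shows "A ** matrix_inv A = mat 1" "matrix_inv A ** A = mat 1"
proof -
  have "\<exists>B. A ** B = mat 1 \<and> B ** A = mat 1" using assms invertible_det_nz invertible_def by blast
  then show "A ** matrix_inv A = mat 1" "matrix_inv A ** A = mat 1"
    unfolding matrix_inv_def by (metis (mono_tags, lifting) someI_ex)+
qed

lemma inner_matrix_transpose: "x \<bullet> (A *v h) = (transpose A *v x) \<bullet> (h::real^'n::finite)"
  by (simp add: dot_lmul_matrix transpose_matrix_vector)

text \<open>A variant of \<open>symbol_est_chain\<close> for a majorant that controls the value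
  itself but the derivatives only after one factor q. It fits \<phi> y, whose derivatives are
  bounded in terms of |y| rather than |\<phi> y|.\<close>

lemma symbol_est_chain1:
  assumes cont: "\<And>m. m \<le> n \<Longrightarrow> continuous_on UNIV (F m)"
    and der: "\<And>m x. m < n \<Longrightarrow> ((\<lambda>r. F m (x + r *\<^sub>R b)) has_vector_derivative F (Suc m) x) (at 0)"
    and g0: "\<And>x. norm (F 0 x) \<le> g x"
    and g: "\<And>m x. m < n \<Longrightarrow> norm (F (Suc m) x) \<le> g x * q x" and q: "\<And>x. 1 \<le> q x"
  shows "symbol_est b q n g (F 0)"
proof (cases n)
  case 0
  then show ?thesis using cont g0 by simp
next
  case (Suc k)
  have "symbol_est b q k (\<lambda>x. g x * q x) (F (Suc 0))"
    by (rule symbol_est_chain[of k "\<lambda>m. F (Suc m)"]) (use Suc cont der g q in auto)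
  then show ?thesis unfolding Suc
    by (intro symbol_est_SucI) (use Suc cont der g0 in auto)
qed

text \<open>The Leibniz sum has d! terms, each a product of d entries with a factor 2^N per
  entry.\<close>

definition det_const :: "nat \<Rightarrow> nat \<Rightarrow> real" where
  "det_const d N = fact d * 2 ^ (N * d)"

lemma det_const_pos: "0 < det_const d N"
  by (simp add: det_const_def)

locale warping =
  fixes D :: "(real^'n::finite) set" and \<Phi> :: "real^'n \<Rightarrow> real^'n" and v\<^sub>0 :: "real^'n \<Rightarrow> real" and N :: nat
  assumes openD: "open D" and adm: "admissible_warping N D \<Phi> v\<^sub>0" and N0: "0 < N"
begin

abbreviation "\<Theta> \<equiv> inv_into D \<Phi>"
abbreviation "A \<equiv> warp_A D \<Phi>"
abbreviation "w \<equiv> warp_w D \<Phi>"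
abbreviation "\<phi> \<equiv> warp_phi D \<Phi>"

lemma bij: "bij_betw \<Phi> D UNIV" and Theta_Ck: "Ck_on (Suc N) UNIV \<Theta>" and Phi_Ck: "Ck_on (Suc N) D \<Phi>"
  using adm by (auto simp: admissible_warping_def Ck_diffeomorphism_onto_UNIV_def simp del: Ck_on.simps)

lemma v0_cont: "continuous_on UNIV v\<^sub>0" and v0_sub: "v\<^sub>0 (a + b) \<le> v\<^sub>0 a * v\<^sub>0 b"
  and v0_rad: "norm a \<le> norm b \<Longrightarrow> v\<^sub>0 a \<le> v\<^sub>0 b" and v0_pos: "0 < v\<^sub>0 a"
  using adm by (auto simp: admissible_warping_def submultiplicative_def radially_increasing_def weight_on_def)

lemma v0_minus: "v\<^sub>0 (- a) = v\<^sub>0 a"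
  by (intro antisym v0_rad) auto

lemma v0_ge_1: "1 \<le> v\<^sub>0 a"
proof -
  have "v\<^sub>0 0 * 1 \<le> v\<^sub>0 0 * v\<^sub>0 0" using v0_sub[of 0 0] by simp
  then have "1 \<le> v\<^sub>0 0" using v0_pos[of 0] mult_le_cancel_left_pos by blast
  also have "v\<^sub>0 0 \<le> v\<^sub>0 a" by (rule v0_rad) simp
  finally show ?thesis .
qed

lemma Phi_Theta [simp]: "\<Phi> (\<Theta> t) = t"
  using bij by (simp add: bij_betw_inv_into_right)
lemma Theta_in_D [simp]: "\<Theta> t \<in> D"
  using bij by (metis bij_betw_imp_surj_on inv_into_into UNIV_I)
lemma Theta_Phi [simp]: "x \<in> D \<Longrightarrow> \<Theta> (\<Phi> x) = x"
  using bij by (simp add: bij_betw_inv_into_left)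
lemma range_Theta: "range \<Theta> = D"
  by (auto simp: image_iff) (metis Theta_Phi)
lemma inj_Theta: "inj \<Theta>"
  by (metis Phi_Theta injI)

lemma Theta_deriv: "(\<Theta> has_derivative (*v) (A t)) (at t)"
  using Theta_Ck jacobian_works unfolding warp_A_def by auto

lemma A_nth: "A t $ i $ j = partial_deriv j \<Theta> t $ i"
  by (simp add: warp_A_def jacobian_def matrix_def partial_deriv_def)

lemma partial_Theta_Ck: "Ck_on N UNIV (partial_deriv j \<Theta>)"
  using Theta_Ck by simp

lemma w_pos: "0 < w t"
  using adm by (auto simp: admissible_warping_def warp_w_def)

lemma Theta_cont: "continuous_on UNIV \<Theta>"
  by (rule Ck_on_imp_continuous[OF Theta_Ck])

lemma Phi_cont: "continuous_on D \<Phi>"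
  using Phi_Ck by (auto simp: continuous_on_eq_continuous_at[OF openD] differentiable_imp_continuous_within)

lemma det_cont: "continuous_on UNIV (\<lambda>t. det (A t))"
proof -
  have "continuous_on UNIV (\<lambda>t. partial_deriv j \<Theta> t $ i)" for i j
    using Ck_on_imp_continuous[OF partial_Theta_Ck] by (rule continuous_on_component)
  then have "continuous_on UNIV (\<lambda>t. A t $ i $ j)" for i j by (simp add: A_nth)
  then show ?thesis
    unfolding det_def by (intro continuous_on_sum continuous_on_mult continuous_on_const continuous_on_prod)
qed

lemma w_cont: "continuous_on UNIV w"
  using det_cont by (simp add: warp_w_def[abs_def])

lemma detA_nz: "det (A t) \<noteq> 0" "det (transpose (A t)) \<noteq> 0"
  using w_pos[of t] by (auto simp: warp_w_def det_transpose)

lemma phi_mult: "\<phi> t0 t *v (transpose (A t0) *v x) = transpose (A (t + t0)) *v x"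
  unfolding warp_phi_def inv_transpose_def matrix_vector_mul_assoc matrix_mul_assoc[symmetric]
    matrix_inv_mult(2)[OF detA_nz(2)] matrix_mul_rid ..

text \<open>Cocycle identity: the inverse of \<phi> is again a value of \<phi>, so the upper bound
  from admissibility, applied to it, becomes the lower bound \<open>phi_lower\<close>.\<close>

lemma phi_comp: "\<phi> (t + t0) (- t) *v (\<phi> t0 t *v y) = y"
proof -
  have "\<phi> (t + t0) (- t) ** \<phi> t0 t = transpose (A t0) ** ((inv_transpose (A (t + t0)) ** transpose (A (t + t0))) ** inv_transpose (A t0))"
    unfolding warp_phi_def by (simp add: matrix_mul_assoc)
  then have "\<phi> (t + t0) (- t) ** \<phi> t0 t = mat 1"
    unfolding inv_transpose_def by (simp add: matrix_inv_mult detA_nz)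
  then show ?thesis by (simp add: matrix_vector_mul_assoc)
qed

lemma phi_0: "\<phi> t0 0 = mat 1"
  unfolding warp_phi_def inv_transpose_def by (simp add: matrix_inv_mult detA_nz)

lemma det_phi: "det (\<phi> t0 t) = w (t + t0) / w t0"
proof -
  have "det (transpose (A t0)) * det (matrix_inv (transpose (A t0))) = 1"
    unfolding det_mul[symmetric] matrix_inv_mult(1)[OF detA_nz(2)] by simp
  then have "det (matrix_inv (transpose (A t0))) = 1 / w t0"
    using w_pos[of t0] by (simp add: warp_w_def field_simps det_transpose)
  then show ?thesis
    by (simp add: warp_phi_def inv_transpose_def det_mul det_transpose warp_w_def)
qed

text \<open>The second factor of \<phi> is constant in \<open>t\<close>, and the columns of
  \<open>A\<close> are the partial derivatives of the inverse warping. So \<phi> is a sum of fixed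
  linear images of translated partial derivatives, and regularity passes through without a product
  rule.\<close>

lemma phi_Ck: "Ck_on N UNIV (\<phi> t0)"
proof -
  define M where "M = inv_transpose (A t0)"
  define L where "L j v = (\<chi> a b. if a = j then \<Sum>l\<in>UNIV. v $ l * M $ l $ b else 0)" for j :: 'n and v :: "real^'n"
  have bl: "bounded_linear (L j)" for j
    unfolding L_def linear_conv_bounded_linear[symmetric]
    by (intro linearI) (auto simp: vec_eq_iff algebra_simps sum.distrib sum_distrib_left)
  have "\<phi> t0 t = (\<Sum>j\<in>UNIV. L j (partial_deriv j \<Theta> (t + t0)))" for t
    by (simp add: warp_phi_def vec_eq_iff matrix_matrix_mult_def transpose_def A_nth L_def M_def[symmetric])
  then have "\<phi> t0 = (\<lambda>t. \<Sum>j\<in>UNIV. L j (partial_deriv j \<Theta> (t + t0)))" by auto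
  then show ?thesis
    by (simp only:) (intro Ck_on_sum Ck_on_bounded_linear[OF bl] Ck_on_shift partial_Theta_Ck finite)
qed

lemma phi_deriv_bound: "m \<le> N \<Longrightarrow> norm ((partial_deriv j ^^ m) (\<phi> t0) t *v y) \<le> v\<^sub>0 t * norm y"
proof -
  assume "m \<le> N"
  then have "matrix_opnorm ((partial_deriv j ^^ m) (\<phi> t0) t) \<le> v\<^sub>0 t"
    using adm unfolding admissible_warping_def iterated_partial_replicate[symmetric] by auto
  moreover have "norm ((partial_deriv j ^^ m) (\<phi> t0) t *v y) \<le> matrix_opnorm ((partial_deriv j ^^ m) (\<phi> t0) t) * norm y"
    by (rule onorm[OF matrix_vector_mul_bounded_linear])
  ultimately show ?thesis by (meson mult_right_mono norm_ge_zero order_trans)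
qed

lemma phi_bound: "norm (\<phi> t0 t *v y) \<le> v\<^sub>0 t * norm y"
  using phi_deriv_bound[of 0] by simp

lemma phi_lower: "norm y \<le> v\<^sub>0 t * norm (\<phi> t0 t *v y)"
  using phi_bound[of "t + t0" "- t" "\<phi> t0 t *v y"] by (simp add: phi_comp v0_minus)

lemma phi_entry_bound: "m \<le> N \<Longrightarrow> \<bar>(partial_deriv j ^^ m) (\<phi> t0) t $ a $ b\<bar> \<le> v\<^sub>0 t"
proof -
  assume "m \<le> N"
  then have "matrix_opnorm ((partial_deriv j ^^ m) (\<phi> t0) t) \<le> v\<^sub>0 t"
    using adm unfolding admissible_warping_def iterated_partial_replicate[symmetric] by auto
  then show ?thesis using matrix_component_le_onorm order_trans by blast
qed

abbreviation "q \<equiv> \<lambda>t. (v\<^sub>0 t)\<^sup>2"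

lemma q_ge_1: "1 \<le> q t"
  using v0_ge_1[of t] by simp

lemma v0_le_q: "v\<^sub>0 t \<le> q t"
  using v0_ge_1[of t] by (simp add: power2_eq_square)

lemma bounded_linear_mv_nth: "bounded_linear (\<lambda>B::real^'n^'n. (B *v y) $ k)"
  unfolding linear_conv_bounded_linear[symmetric]
  by (intro linearI) (auto simp: matrix_vector_mult_def algebra_simps sum.distrib sum_distrib_left)

lemma bounded_linear_nth_nth: "bounded_linear (\<lambda>B::real^'n^'n. B $ a $ b)"
  unfolding linear_conv_bounded_linear[symmetric] by (intro linearI) auto

text \<open>The first majorant is relative to the gradient, as the non-stationary phase estimate
  demands; it rests on \<open>v\<^sub>0\<close> |y| \<le> \<open>v\<^sub>0\<close>^2 |\<phi> y|, the
  origin of \<open>q\<close>. The second is absolute and serves for the phase difference caused by a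
  nearby point, where smallness in |y| matters.\<close>

lemma symbol_est_phi_mult:
  assumes c: "0 \<le> c"
  shows "symbol_est (axis j 1) q N (\<lambda>t. c * norm (\<phi> t0 t *v y)) (\<lambda>t. c * (\<phi> t0 t *v y) $ k)"
    and "symbol_est (axis j 1) q N (\<lambda>t. c * norm y * v\<^sub>0 t) (\<lambda>t. c * (\<phi> t0 t *v y) $ k)"
proof -
  let ?F = "\<lambda>m t. c * ((partial_deriv j ^^ m) (\<phi> t0) t *v y) $ k"
  have L: "bounded_linear (\<lambda>B::real^'n^'n. c * (B *v y) $ k)"
    by (rule bounded_linear_const_mult[OF bounded_linear_mv_nth])
  have cont: "m \<le> N \<Longrightarrow> continuous_on UNIV (?F m)" for m
    by (rule bounded_linear.continuous_on[OF L Ck_on_funpow_continuous[OF phi_Ck]])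
  have der: "m < N \<Longrightarrow> ((\<lambda>r. ?F m (x + r *\<^sub>R axis j 1)) has_vector_derivative ?F (Suc m) x) (at 0)" for m x
    by (rule bounded_linear.has_vector_derivative[OF L Ck_on_funpow_deriv[OF phi_Ck]])
  have b: "m \<le> N \<Longrightarrow> norm (?F m t) \<le> c * (v\<^sub>0 t * norm y)" for m t
    using order_trans[OF component_le_norm_cart phi_deriv_bound] c by (auto simp: abs_mult intro!: mult_left_mono)
  have 1: "symbol_est (axis j 1) q N (\<lambda>t. c * norm (\<phi> t0 t *v y)) (?F 0)"
  proof (rule symbol_est_chain1[of N ?F])
    show "m \<le> N \<Longrightarrow> continuous_on UNIV (?F m)" for m by (rule cont)
    show "m < N \<Longrightarrow> ((\<lambda>r. ?F m (x + r *\<^sub>R axis j 1)) has_vector_derivative ?F (Suc m) x) (at 0)" for m x by (rule der)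
    show "1 \<le> q x" for x by (rule q_ge_1)
    show "norm (?F 0 x) \<le> c * norm (\<phi> t0 x *v y)" for x
      using component_le_norm_cart[of "\<phi> t0 x *v y" k] c by (auto simp: abs_mult intro!: mult_left_mono)
    fix m x assume "m < N"
    then have "norm (?F (Suc m) x) \<le> c * (v\<^sub>0 x * norm y)" by (intro b) simp
    also have "\<dots> \<le> c * (v\<^sub>0 x * (v\<^sub>0 x * norm (\<phi> t0 x *v y)))"
      using c phi_lower v0_pos[of x] by (intro mult_left_mono) auto
    finally show "norm (?F (Suc m) x) \<le> c * norm (\<phi> t0 x *v y) * q x"
      by (simp add: power2_eq_square mult_ac)
  qed
  then show "symbol_est (axis j 1) q N (\<lambda>t. c * norm (\<phi> t0 t *v y)) (\<lambda>t. c * (\<phi> t0 t *v y) $ k)" by simp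
  have "symbol_est (axis j 1) q N (\<lambda>t. c * norm y * v\<^sub>0 t) (?F 0)"
  proof (rule symbol_est_chain[of N ?F])
    show "m \<le> N \<Longrightarrow> continuous_on UNIV (?F m)" for m by (rule cont)
    show "m < N \<Longrightarrow> ((\<lambda>r. ?F m (x + r *\<^sub>R axis j 1)) has_vector_derivative ?F (Suc m) x) (at 0)" for m x by (rule der)
    show "1 \<le> q x" for x by (rule q_ge_1)
    show "m \<le> N \<Longrightarrow> norm (?F m x) \<le> c * norm y * v\<^sub>0 x" for m x using b[of m x] by (simp add: mult_ac)
  qed
  then show "symbol_est (axis j 1) q N (\<lambda>t. c * norm y * v\<^sub>0 t) (\<lambda>t. c * (\<phi> t0 t *v y) $ k)" by simp
qed

lemma symbol_est_det: "symbol_est (axis j 1) q N (\<lambda>t. det_const CARD('n) N * v\<^sub>0 t ^ CARD('n)) (\<lambda>t. det (\<phi> t0 t))"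
proof -
  have q0: "0 \<le> q t" for t by simp
  have e: "symbol_est (axis j 1) q N v\<^sub>0 (\<lambda>t. \<phi> t0 t $ a $ b)" for a b
    using symbol_est_chain[of N "\<lambda>m t. (partial_deriv j ^^ m) (\<phi> t0) t $ a $ b" "axis j 1" v\<^sub>0 q]
      bounded_linear.continuous_on[OF bounded_linear_nth_nth Ck_on_funpow_continuous[OF phi_Ck]]
      bounded_linear.has_vector_derivative[OF bounded_linear_nth_nth Ck_on_funpow_deriv[OF phi_Ck]]
      phi_entry_bound q_ge_1 by auto
  have "symbol_est (axis j 1) q N (\<lambda>t. \<Sum>p | p permutes (UNIV::'n set). norm (of_int (sign p) :: real) * (2 ^ (N * CARD('n)) * (\<Prod>i\<in>(UNIV::'n set). v\<^sub>0 t)))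
      (\<lambda>t. det (\<phi> t0 t))"
    unfolding det_def by (intro symbol_est_sum symbol_est_cmult symbol_est_prod e q0 finite)
  then show ?thesis
  proof (rule symbol_est_mono)
    fix t
    have "norm (of_int (sign p) :: real) = 1" for p :: "'n \<Rightarrow> 'n" by (simp add: sign_def)
    moreover have "card {p. p permutes (UNIV :: 'n set)} = fact CARD('n)"
      by (rule card_permutations) auto
    ultimately show "(\<Sum>p | p permutes (UNIV::'n set). norm (of_int (sign p) :: real) * (2 ^ (N * CARD('n)) * (\<Prod>i\<in>(UNIV::'n set). v\<^sub>0 t)))
      \<le> det_const CARD('n) N * v\<^sub>0 t ^ CARD('n)"
      by (simp add: det_const_def)
  qed simp
qed

text \<open>Order zero of the determinant estimate, read as the statement that \<open>w\<close> is
  moderate with respect to a multiple of the d-th power of \<open>v\<^sub>0\<close>.\<close>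

lemma w_ratio: "w (t + t0) \<le> det_const CARD('n) N * v\<^sub>0 t ^ CARD('n) * w t0"
  using symbol_est_norm[OF symbol_est_det, of t0 t] w_pos[of t0] w_pos[of "t + t0"]
  by (simp add: det_phi field_simps)

end

section \<open>Symbol estimates for the prototype and its local oscillation\<close>

locale warped_prototype = warping D \<Phi> v\<^sub>0 N
  for D :: "(real^'n::finite) set" and \<Phi> v\<^sub>0 N +
  fixes \<theta> :: "real^'n \<Rightarrow> complex"
  assumes theta_Ck: "Ck_on N UNIV \<theta>"
begin

abbreviation "\<theta>d j m \<equiv> (partial_deriv j ^^ m) \<theta>"

text \<open>Summing over all coordinates gives one majorant for every direction of differentiation,
  so all pieces of the partition lead to the same integral.\<close>

definition G :: "real^'n \<Rightarrow> real" where
  "G t = (\<Sum>j\<in>UNIV. \<Sum>m\<le>N. norm (\<theta>d j m t))"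

definition Gdiff :: "real^'n \<Rightarrow> real^'n \<Rightarrow> real" where
  "Gdiff s t = (\<Sum>j\<in>UNIV. \<Sum>m\<le>N. norm (\<theta>d j m t - \<theta>d j m (t - s)))"

lemma thetad_cont: "m \<le> N \<Longrightarrow> continuous_on UNIV (\<theta>d j m)"
  by (rule Ck_on_funpow_continuous[OF theta_Ck])

lemma theta_cont: "continuous_on UNIV \<theta>"
  using thetad_cont[of 0] by simp

lemma thetad_shift_cont: "m \<le> N \<Longrightarrow> continuous_on S (\<lambda>t. \<theta>d j m (t + c))"
  by (rule continuous_on_compose2[OF thetad_cont]) (auto intro!: continuous_intros)

lemma thetad_der: "m < N \<Longrightarrow> ((\<lambda>r. \<theta>d j m (x + r *\<^sub>R axis j 1 + c)) has_vector_derivative \<theta>d j (Suc m) (x + c)) (at 0)"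
  using Ck_on_funpow_deriv[OF theta_Ck, of m j "x + c"] by (simp add: algebra_simps)

lemma G_cont: "continuous_on UNIV G"
  unfolding G_def[abs_def] by (intro continuous_intros thetad_cont) auto

lemma Gdiff_cont: "continuous_on UNIV (Gdiff s)"
  unfolding Gdiff_def[abs_def] using thetad_shift_cont[where c="- s"]
  by (intro continuous_intros thetad_cont) auto

lemma G_nonneg: "0 \<le> G t" by (simp add: G_def sum_nonneg)
lemma Gdiff_nonneg: "0 \<le> Gdiff s t" by (simp add: Gdiff_def sum_nonneg)

lemma le_double_sum:
  fixes f :: "'n \<Rightarrow> nat \<Rightarrow> real"
  assumes "m \<le> N" "\<And>j m. 0 \<le> f j m"
  shows "f j m \<le> (\<Sum>j\<in>UNIV. \<Sum>m\<le>N. f j m)"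
proof -
  have "f j m \<le> (\<Sum>m\<le>N. f j m)" using assms by (intro member_le_sum) auto
  also have "\<dots> \<le> (\<Sum>j\<in>UNIV. \<Sum>m\<le>N. f j m)"
    using assms by (intro member_le_sum[where f="\<lambda>j. \<Sum>m\<le>N. f j m"] sum_nonneg) auto
  finally show ?thesis .
qed

lemma symbol_est_theta: "symbol_est (axis j 1) q N (\<lambda>t. G (t + c)) (\<lambda>t. \<theta> (t + c))"
proof -
  have "symbol_est (axis j 1) q N (\<lambda>t. G (t + c)) ((\<lambda>m t. \<theta>d j m (t + c)) 0)"
  proof (rule symbol_est_chain)
    show "norm (\<theta>d j m (t + c)) \<le> G (t + c)" if "m \<le> N" for m t
      unfolding G_def by (rule le_double_sum[OF that]) simp
  qed (simp_all only: thetad_shift_cont thetad_der q_ge_1)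
  then show ?thesis by simp
qed

lemma symbol_est_theta_diff: "symbol_est (axis j 1) q N (Gdiff s) (\<lambda>t. \<theta> t - \<theta> (t - s))"
proof -
  have "symbol_est (axis j 1) q N (Gdiff s) ((\<lambda>m t. \<theta>d j m t - \<theta>d j m (t - s)) 0)"
  proof (rule symbol_est_chain)
    show "norm (\<theta>d j m t - \<theta>d j m (t - s)) \<le> Gdiff s t" if "m \<le> N" for m t
      unfolding Gdiff_def by (rule le_double_sum[OF that, where f="\<lambda>j m. norm (\<theta>d j m t - \<theta>d j m (t - s))"]) simp
    show "continuous_on UNIV (\<lambda>t. \<theta>d j m t - \<theta>d j m (t - s))" if "m \<le> N" for m
      using thetad_shift_cont[OF that, of UNIV j "- s"] thetad_cont[OF that, of j] by (intro continuous_intros) auto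
    show "((\<lambda>r. \<theta>d j m (x + r *\<^sub>R axis j 1) - \<theta>d j m (x + r *\<^sub>R axis j 1 - s)) has_vector_derivative
       \<theta>d j (Suc m) x - \<theta>d j (Suc m) (x - s)) (at 0)" if "m < N" for m x
      using thetad_der[OF that, of j x 0] thetad_der[OF that, of j x "- s"]
      by (intro has_vector_derivative_diff) (simp_all del: funpow.simps)
  qed (rule q_ge_1)
  then show ?thesis by simp
qed

lemma phase_deriv:
  "((\<lambda>r. x \<bullet> \<Theta> (t + r *\<^sub>R h + t0)) has_real_derivative (\<phi> t0 (t + r *\<^sub>R h) *v (transpose (A t0) *v x)) \<bullet> h) (at r)"
proof -
  have 1: "((\<lambda>r. t + r *\<^sub>R h + t0) has_derivative (\<lambda>r. r *\<^sub>R h)) (at r)"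
    by (auto intro!: derivative_eq_intros)
  have "((\<lambda>r. x \<bullet> \<Theta> (t + r *\<^sub>R h + t0)) has_derivative (\<lambda>r'. x \<bullet> (A (t + r *\<^sub>R h + t0) *v (r' *\<^sub>R h)))) (at r)"
    using has_derivative_inner_right[OF diff_chain_at[OF 1 Theta_deriv], of x] by (simp add: o_def)
  moreover have "x \<bullet> (A (t + r *\<^sub>R h + t0) *v (r' *\<^sub>R h)) = ((\<phi> t0 (t + r *\<^sub>R h) *v (transpose (A t0) *v x)) \<bullet> h) * r'" for r'
    unfolding phi_mult inner_matrix_transpose by simp
  ultimately show ?thesis by (simp add: has_field_derivative_def)
qed

lemma phase_deriv_axis:
  "((\<lambda>r. c * (x \<bullet> \<Theta> (t + r *\<^sub>R axis j 1 + t0) + a)) has_real_derivative c * (\<phi> t0 t *v (transpose (A t0) *v x)) $ j) (at 0)"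
  using DERIV_cmult[OF DERIV_add[OF phase_deriv[of x t "axis j 1" t0 0] DERIV_const[of a]], of c]
  by (simp add: inner_axis)

text \<open>Mean value theorem on the segment from t0 to t0 + t; radial monotonicity replaces
  \<open>v\<^sub>0\<close> at the intermediate point by its value at \<open>t\<close>.\<close>

lemma phase_increment:
  "\<bar>x \<bullet> (\<Theta> (t + t0) - \<Theta> t0)\<bar> \<le> norm (transpose (A t0) *v x) * norm t * v\<^sub>0 t"
proof -
  let ?h = "\<lambda>r. x \<bullet> \<Theta> (0 + r *\<^sub>R t + t0)"
  have "\<exists>r. 0 < r \<and> r < 1 \<and> ?h 1 - ?h 0 = (1 - 0) * ((\<phi> t0 (0 + r *\<^sub>R t) *v (transpose (A t0) *v x)) \<bullet> t)"
    by (rule MVT2) (simp, rule phase_deriv)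
  then obtain r where r: "0 < r" "r < 1" "?h 1 - ?h 0 = (\<phi> t0 (r *\<^sub>R t) *v (transpose (A t0) *v x)) \<bullet> t" by auto
  have "\<bar>(\<phi> t0 (r *\<^sub>R t) *v (transpose (A t0) *v x)) \<bullet> t\<bar> \<le> norm (\<phi> t0 (r *\<^sub>R t) *v (transpose (A t0) *v x)) * norm t"
    by (rule Cauchy_Schwarz_ineq2)
  also have "\<dots> \<le> (v\<^sub>0 (r *\<^sub>R t) * norm (transpose (A t0) *v x)) * norm t"
    by (intro mult_right_mono phi_bound) auto
  also have "\<dots> \<le> (v\<^sub>0 t * norm (transpose (A t0) *v x)) * norm t"
    using r by (intro mult_right_mono v0_rad) (auto simp: mult_left_le_one_le)
  finally show ?thesis using r(3) by (simp add: inner_diff_right mult_ac)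
qed

text \<open>Apart from the 2^N of a product rule, this is the majorant of 1 - c E = (1 - c) + c (1 -
  E), where E is the relative phase factor. The minimum keeps it bounded in \<open>t\<close>, while
  its second entry makes it small on bounded sets as \<open>S\<close> tends to 0.\<close>

definition bracket_coeff :: "real \<Rightarrow> real \<Rightarrow> real^'n \<Rightarrow> real" where
  "bracket_coeff S c t = 2 ^ N * (\<bar>1 - c\<bar> + \<bar>c\<bar> * (min 2 (2 * pi * S * norm t * v\<^sub>0 t) + 2 ^ N * (2 * pi * S) * exp_const (2 * pi * S) N))"

definition bracket_bound :: "real \<Rightarrow> real \<Rightarrow> real^'n \<Rightarrow> real^'n \<Rightarrow> real" where
  "bracket_bound S c s t = Gdiff s t + bracket_coeff S c t * G (t - s)"

text \<open>The bracket is the increment \<theta> - \<theta>(. - s) plus ((1 - c) + c (1 - E))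
  \<theta>(. - s). In this form a small shift \<open>s\<close>, a ratio \<open>c\<close> near 1 and
  a small phase size \<open>S\<close> each make one part small.\<close>

lemma symbol_est_bracket:
  fixes zs t0 s :: "real^'n" and c :: real
  defines "S \<equiv> norm (transpose (A t0) *v zs)"
  shows "symbol_est (axis j 1) q N (bracket_bound S c s)
     (\<lambda>t. \<theta> t - of_real c * exp (\<i> * of_real (2 * pi * (zs \<bullet> \<Theta> (t + t0) - zs \<bullet> \<Theta> t0))) * \<theta> (t - s))"
proof -
  let ?\<psi> = "\<lambda>t. 2 * pi * (zs \<bullet> \<Theta> (t + t0) + - (zs \<bullet> \<Theta> t0))"
  let ?E = "\<lambda>t. exp (\<i> * complex_of_real (?\<psi> t))"
  have S: "0 \<le> S" by (simp add: S_def)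
  have q0: "0 \<le> q t" for t by simp
  have "symbol_est (axis j 1) q N (\<lambda>t. min 2 (2 * pi * S * norm t * v\<^sub>0 t) + 2 ^ N * (2 * pi * S) * exp_const (2 * pi * S) N)
     (\<lambda>t. 1 - ?E t)"
  proof (rule symbol_est_one_minus_exp)
    show "((\<lambda>r. ?\<psi> (x + r *\<^sub>R axis j 1)) has_real_derivative 2 * pi * (\<phi> t0 x *v (transpose (A t0) *v zs)) $ j) (at 0)" for x
      using phase_deriv_axis[of "2 * pi" zs x j t0 "- (zs \<bullet> \<Theta> t0)"] by simp
    show "continuous_on UNIV ?\<psi>"
      by (intro continuous_intros continuous_on_compose2[OF Theta_cont]) auto
    show "symbol_est (axis j 1) q m (\<lambda>x. 2 * pi * S * q x) (\<lambda>x. 2 * pi * (\<phi> t0 x *v (transpose (A t0) *v zs)) $ j)" if "N = Suc m" for m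
    proof -
      have "symbol_est (axis j 1) q m (\<lambda>x. 2 * pi * S * v\<^sub>0 x) (\<lambda>x. 2 * pi * (\<phi> t0 x *v (transpose (A t0) *v zs)) $ j)"
        unfolding S_def by (rule symbol_est_le[OF symbol_est_phi_mult(2)]) (use that in auto)
      then show ?thesis
        by (rule symbol_est_mono) (use S v0_le_q in \<open>auto intro!: mult_left_mono\<close>)
    qed
    show "norm (1 - ?E t) \<le> min 2 (2 * pi * S * norm t * v\<^sub>0 t)" for t
    proof -
      have "norm (1 - ?E t) \<le> norm (1::complex) + norm (?E t)" by (rule norm_triangle_ineq4)
      moreover have "norm (1 - ?E t) \<le> \<bar>?\<psi> t\<bar>"
      proof -
        have "norm (1 - ?E t) = 2 * \<bar>sin (?\<psi> t / 2)\<bar>"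
          using dist_exp_i_1[of "?\<psi> t"] by (simp only: norm_minus_commute)
        also have "\<dots> \<le> 2 * \<bar>?\<psi> t / 2\<bar>" by (intro mult_left_mono abs_sin_x_le_abs_x) simp
        finally show ?thesis by simp
      qed
      moreover have "\<bar>?\<psi> t\<bar> \<le> 2 * pi * (S * norm t * v\<^sub>0 t)"
        using phase_increment[of zs t t0] by (simp add: abs_mult S_def inner_diff_right)
      ultimately show ?thesis by simp
    qed
  qed (use S in auto)
  then have "symbol_est (axis j 1) q N (\<lambda>t. norm (1 - complex_of_real c) + norm (complex_of_real c) * (min 2 (2 * pi * S * norm t * v\<^sub>0 t) + 2 ^ N * (2 * pi * S) * exp_const (2 * pi * S) N))
     (\<lambda>t. (1 - complex_of_real c) + complex_of_real c * (1 - ?E t))"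
    by (intro symbol_est_add symbol_est_cmult symbol_est_const) auto
  then have "symbol_est (axis j 1) q N (\<lambda>t. 2 ^ N * ((norm (1 - complex_of_real c) + norm (complex_of_real c) * (min 2 (2 * pi * S * norm t * v\<^sub>0 t) + 2 ^ N * (2 * pi * S) * exp_const (2 * pi * S) N)) * G (t + (- s))))
     (\<lambda>t. ((1 - complex_of_real c) + complex_of_real c * (1 - ?E t)) * \<theta> (t + (- s)))"
    by (intro symbol_est_mult symbol_est_theta q0)
  from symbol_est_add[OF symbol_est_theta_diff this, of s]
  have "symbol_est (axis j 1) q N (bracket_bound S c s) (\<lambda>t. \<theta> t - \<theta> (t - s) + ((1 - complex_of_real c) + complex_of_real c * (1 - ?E t)) * \<theta> (t + (- s)))"
  proof (rule symbol_est_mono)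
    have "norm (1 - complex_of_real c) = \<bar>1 - c\<bar>" by (metis norm_of_real of_real_1 of_real_diff)
    then show "Gdiff s t + 2 ^ N * ((norm (1 - complex_of_real c) + norm (complex_of_real c) * (min 2 (2 * pi * S * norm t * v\<^sub>0 t) + 2 ^ N * (2 * pi * S) * exp_const (2 * pi * S) N)) * G (t + (- s))) \<le> bracket_bound S c s t" for t
      by (simp add: bracket_bound_def bracket_coeff_def)
  qed simp
  moreover have "(\<lambda>t. \<theta> t - \<theta> (t - s) + ((1 - complex_of_real c) + complex_of_real c * (1 - ?E t)) * \<theta> (t + (- s))) =
     (\<lambda>t. \<theta> t - of_real c * exp (\<i> * of_real (2 * pi * (zs \<bullet> \<Theta> (t + t0) - zs \<bullet> \<Theta> t0))) * \<theta> (t - s))"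
    by (simp add: fun_eq_iff algebra_simps)
  ultimately show ?thesis by (simp only:)
qed

text \<open>4^N collects the two product rules of the amplitude, 2^N the passage from 1/|y| to 2/(1
  + |y|), and the summand 1 covers the range |y| \<le> 1.\<close>

definition osc_const :: "real" where
  "osc_const = 4 ^ N * det_const CARD('n) N * (2 ^ N * (phase_bound CARD('n) N + 1))"

lemma osc_integral_bound:
  fixes x zs t0 s u :: "real^'n" and c :: real
  defines "S \<equiv> norm (transpose (A t0) *v zs)"
  assumes int: "integrable lborel (\<lambda>t. v\<^sub>0 t ^ (3 * N + CARD('n)) * (G (t + u) * bracket_bound S c s t))"
  shows "norm (LINT t|lborel. of_real (det (\<phi> t0 t)) * \<theta> (t + u) *
       cnj (\<theta> t - of_real c * exp (\<i> * of_real (2 * pi * (zs \<bullet> \<Theta> (t + t0) - zs \<bullet> \<Theta> t0))) * \<theta> (t - s)) *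
       exp (\<i> * of_real (2 * pi * (x \<bullet> \<Theta> (t + t0)))))
     \<le> osc_const * inverse (1 + norm (transpose (A t0) *v x)) ^ N *
        (LINT t|lborel. v\<^sub>0 t ^ (3 * N + CARD('n)) * (G (t + u) * bracket_bound S c s t))"
proof -
  define y where "y = transpose (A t0) *v x"
  define I where "I = (LINT t|lborel. v\<^sub>0 t ^ (3 * N + CARD('n)) * (G (t + u) * bracket_bound S c s t))"
  let ?br = "\<lambda>t. \<theta> t - of_real c * exp (\<i> * of_real (2 * pi * (zs \<bullet> \<Theta> (t + t0) - zs \<bullet> \<Theta> t0))) * \<theta> (t - s)"
  let ?F = "\<lambda>t. of_real (det (\<phi> t0 t)) * \<theta> (t + u) * cnj (?br t)"
  let ?\<psi> = "\<lambda>t. 2 * pi * (x \<bullet> \<Theta> (t + t0))"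
  define c1 where "c1 = 4 ^ N * det_const CARD('n) N"
  have c1: "0 < c1" by (simp add: c1_def det_const_pos)
  define gF where "gF t = c1 * (v\<^sub>0 t ^ CARD('n) * (G (t + u) * bracket_bound S c s t))" for t
  have q0: "0 \<le> q t" for t by simp
  have F: "symbol_est (axis j 1) q N gF ?F" for j
  proof -
    have "symbol_est (axis j 1) q N (\<lambda>t. 2 ^ N * ((2 ^ N * (det_const CARD('n) N * v\<^sub>0 t ^ CARD('n) * G (t + u))) * bracket_bound S c s t)) ?F"
      unfolding S_def by (intro symbol_est_mult symbol_est_of_real symbol_est_det symbol_est_theta symbol_est_cnj symbol_est_bracket q0)
    moreover have "2 ^ N * ((2 ^ N * (det_const CARD('n) N * v\<^sub>0 t ^ CARD('n) * G (t + u))) * bracket_bound S c s t) = gF t" for t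
    proof -
      have "(4::real) ^ N = 2 ^ N * 2 ^ N" by (simp add: power_mult_distrib[symmetric])
      then show ?thesis by (simp add: gF_def c1_def)
    qed
    ultimately show ?thesis by simp
  qed
  have gF0: "0 \<le> gF t" for t using symbol_est_nonneg[OF F] .
  \<comment> \<open>Here the exponent 3N + d arises: d from the determinant, 2N from q^N, and N from
    the lower bound for the phase gradient.\<close>
  have gFeq: "gF t * q t ^ N * v\<^sub>0 t ^ N = c1 * (v\<^sub>0 t ^ (3 * N + CARD('n)) * (G (t + u) * bracket_bound S c s t))" for t
  proof -
    have "q t ^ N = v\<^sub>0 t ^ (2 * N)" by (simp add: power_mult)
    then have "v\<^sub>0 t ^ (3 * N + CARD('n)) = v\<^sub>0 t ^ CARD('n) * q t ^ N * v\<^sub>0 t ^ N"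
      by (simp add: power_add[symmetric])
    then show ?thesis by (simp add: gF_def)
  qed
  have gFint: "integrable lborel (\<lambda>t. gF t * q t ^ N * v\<^sub>0 t ^ N)"
    unfolding gFeq using int by simp
  have gFI: "(LINT t|lborel. gF t * q t ^ N * v\<^sub>0 t ^ N) = c1 * I"
    unfolding gFeq I_def by simp
  have decay_mass: "0 \<le> I"
  proof -
    have "0 \<le> (LINT t|lborel. gF t * q t ^ N * v\<^sub>0 t ^ N)"
      using gF0 v0_pos less_imp_le by (intro Bochner_Integration.integral_nonneg mult_nonneg_nonneg zero_le_power) auto
    then show ?thesis using gFI c1 by (simp add: zero_le_mult_iff)
  qed
  have \<psi>c: "continuous_on UNIV ?\<psi>"
    by (intro continuous_intros continuous_on_compose2[OF Theta_cont]) auto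
  have pb: "0 \<le> phase_bound CARD('n) N"
    unfolding phase_bound_def using phase_const_nonneg inverse_const_ge_1 order_trans[OF zero_le_one]
    by (intro mult_nonneg_nonneg) auto
  have "norm (LINT t|lborel. ?F t * exp (\<i> * of_real (?\<psi> t))) \<le> c1 * (2 ^ N * (phase_bound CARD('n) N + 1)) * inverse (1 + norm y) ^ N * I"
  \<comment> \<open>For |y| \<le> 1 the phase may fail to oscillate, but the claimed decay factor is
    then at least 2^(-N), so the trivial estimate is enough.\<close>
  proof (cases "norm y \<le> 1")
    case True
    have "norm (LINT t|lborel. ?F t * exp (\<i> * of_real (?\<psi> t))) \<le> (LINT t|lborel. norm (?F t * exp (\<i> * of_real (?\<psi> t))))"
      by (rule integral_norm_bound)
    also have "\<dots> \<le> (LINT t|lborel. gF t * q t ^ N * v\<^sub>0 t ^ N)"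
    proof (rule Bochner_Integration.integral_mono')
      show "norm (?F t * exp (\<i> * of_real (?\<psi> t))) \<le> gF t * q t ^ N * v\<^sub>0 t ^ N" for t
      proof -
        have "norm (?F t * exp (\<i> * of_real (?\<psi> t))) \<le> gF t"
          using symbol_est_norm[OF F, of t] by (simp add: norm_mult)
        also have "1 \<le> q t ^ N * v\<^sub>0 t ^ N"
          using mult_mono[OF one_le_power[OF q_ge_1[of t], of N] one_le_power[OF v0_ge_1[of t], of N]] by simp
        then have "gF t * 1 \<le> gF t * (q t ^ N * v\<^sub>0 t ^ N)" by (rule mult_left_mono[OF _ gF0])
        then have "gF t \<le> gF t * (q t ^ N * v\<^sub>0 t ^ N)" by simp
        finally show ?thesis by (simp add: mult_ac)
      qed
    qed (use gFint gF0 less_imp_le[OF v0_pos] in \<open>auto intro!: mult_nonneg_nonneg zero_le_power\<close>)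
    also have "\<dots> = c1 * I" by (rule gFI)
    also have "\<dots> \<le> c1 * (2 ^ N * (phase_bound CARD('n) N + 1)) * inverse (1 + norm y) ^ N * I"
    proof -
      have "1 \<le> (2 * inverse (1 + norm y)) ^ N"
        using True norm_ge_zero[of y] by (intro one_le_power) (simp add: field_simps add_pos_nonneg)
      also have "\<dots> \<le> 2 ^ N * inverse (1 + norm y) ^ N * (phase_bound CARD('n) N + 1)"
        using pb mult_left_mono[of 1 "phase_bound CARD('n) N + 1" "2 ^ N * inverse (1 + norm y) ^ N"]
        by (simp add: power_mult_distrib)
      finally have "c1 * I * 1 \<le> c1 * I * (2 ^ N * inverse (1 + norm y) ^ N * (phase_bound CARD('n) N + 1))"
        using c1 decay_mass by (intro mult_left_mono) auto
      then show ?thesis by (simp add: mult_ac)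
    qed
    finally show ?thesis .
  next
    case False
    then have y: "1 < norm y" by simp
    \<comment> \<open>The gradient of the phase, by the chain rule and the identity A^T(t + t0) x =
      \<phi> y.\<close>
    define e where "e t = (2 * pi) *\<^sub>R (\<phi> t0 t *v y)" for t
    have en: "norm (e t) = 2 * pi * norm (\<phi> t0 t *v y)" for t by (simp add: e_def)
    have ylow: "norm y \<le> v\<^sub>0 t * norm (e t)" for t
    proof -
      have "norm (\<phi> t0 t *v y) * 1 \<le> norm (\<phi> t0 t *v y) * (2 * pi)"
        using pi_ge_two by (intro mult_left_mono) auto
      then have "norm (\<phi> t0 t *v y) \<le> norm (e t)" by (simp add: en mult.commute)
      then have "v\<^sub>0 t * norm (\<phi> t0 t *v y) \<le> v\<^sub>0 t * norm (e t)" using v0_pos[of t] by (intro mult_left_mono) auto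
      then show ?thesis using phi_lower[of y t t0] by linarith
    qed
    have enz: "e t \<noteq> 0" for t using ylow[of t] y by auto
    have "norm (LINT t|lborel. ?F t * exp (\<i> * of_real (?\<psi> t))) \<le> phase_bound CARD('n) N * inverse (norm y) ^ N * (LINT t|lborel. gF t * q t ^ N * v\<^sub>0 t ^ N)"
    proof (rule nonstationary_phase[OF q_ge_1 v0_ge_1 enz _ _ \<psi>c _ F gFint])
      show "inverse (norm (e t)) \<le> inverse (norm y) * v\<^sub>0 t" for t
      proof -
        have "0 < norm y" using y by linarith
        then show ?thesis using ylow[of t] enz[of t] by (simp add: field_simps)
      qed
      show "((\<lambda>r. ?\<psi> (t + r *\<^sub>R axis j 1)) has_real_derivative e t $ j) (at 0)" for j t
        using phase_deriv_axis[of "2 * pi" x t j t0 0] by (simp add: e_def y_def)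
      show "symbol_est (axis j 1) q N (\<lambda>x. norm (e x)) (\<lambda>x. e x $ k)" for j k
        using symbol_est_phi_mult(1)[of "2 * pi" j t0 y k] by (simp add: e_def)
    qed
    also have "inverse (norm y) ^ N \<le> (2 * inverse (1 + norm y)) ^ N"
    proof (intro power_mono)
      have "inverse r \<le> 2 * inverse (1 + r)" if "1 < r" for r :: real using that by (simp add: field_simps)
      then show "inverse (norm y) \<le> 2 * inverse (1 + norm y)" using y by blast
    qed simp
    then have "phase_bound CARD('n) N * inverse (norm y) ^ N * (LINT t|lborel. gF t * q t ^ N * v\<^sub>0 t ^ N)
       \<le> (phase_bound CARD('n) N + 1) * (2 * inverse (1 + norm y)) ^ N * (LINT t|lborel. gF t * q t ^ N * v\<^sub>0 t ^ N)"
      unfolding gFI using pb c1 decay_mass by (intro mult_mono) auto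
    finally show ?thesis unfolding gFI by (simp add: power_mult_distrib mult_ac)
  qed
  then show ?thesis unfolding osc_const_def c1_def y_def I_def .
qed

end

section \<open>Polynomial weights\<close>

definition poly_weight :: "'a::euclidean_space \<Rightarrow> real" where
  "poly_weight x = (1 + norm x) ^ (DIM('a) + 1)"

lemma poly_weight_ge_1: "1 \<le> poly_weight x"
  unfolding poly_weight_def by (rule one_le_power) simp

lemma poly_weight_pos: "0 < poly_weight x"
  using poly_weight_ge_1[of x] by linarith

lemma poly_weight_submult: "poly_weight (x + y) \<le> poly_weight x * poly_weight y"
proof -
  have "1 + norm (x + y) \<le> (1 + norm x) * (1 + norm y)"
  proof -
    have "(1 + norm x) * (1 + norm y) = 1 + norm x + norm y + norm x * norm y" by (simp add: algebra_simps)
    moreover have "0 \<le> norm x * norm y" by simp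
    ultimately show ?thesis using norm_triangle_ineq[of x y] by linarith
  qed
  then show ?thesis unfolding poly_weight_def power_mult_distrib[symmetric] by (intro power_mono) auto
qed

lemma continuous_poly_weight: "continuous_on S poly_weight"
  unfolding poly_weight_def[abs_def] by (intro continuous_intros)

lemma borel_poly_weight [measurable]: "poly_weight \<in> borel_measurable borel"
  by (intro borel_measurable_continuous_onI continuous_poly_weight)

lemma nn_integral_powr_decay:
  assumes a: "1 < a"
  shows "(\<integral>\<^sup>+x. ennreal ((1 + \<bar>x\<bar>) powr (- a)) \<partial>lborel) < (\<infinity>::ennreal)"
proof -
  let ?F = "\<lambda>x::real. - ((1 + x) powr (1 - a)) / (a - 1)"
  have "(\<integral>\<^sup>+x. ennreal ((1 + x) powr (- a)) * indicator {0..} x \<partial>lborel) = ennreal (0 - ?F 0)"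
  proof (rule nn_integral_FTC_atLeast)
    show "DERIV ?F x :> (1 + x) powr (- a)" if "0 \<le> x" for x
    proof -
      have "((\<lambda>x. (1 + x) powr (1 - a)) has_real_derivative (1 - a) * (1 + x) powr (- a)) (at x)"
        using that by (auto intro!: derivative_eq_intros)
      from DERIV_cdivide[OF DERIV_minus[OF this], of "a - 1"]
      have "DERIV ?F x :> - ((1 - a) * (1 + x) powr (- a)) / (a - 1)" .
      moreover have "- ((1 - a) * X) / (a - 1) = X" for X using a by (simp add: field_simps)
      ultimately show ?thesis by simp
    qed
    have "((\<lambda>x::real. (1 + x) powr (1 - a)) \<longlongrightarrow> 0) at_top"
      by (rule tendsto_neg_powr) (use a in \<open>auto intro: filterlim_tendsto_add_at_top[OF tendsto_const filterlim_ident]\<close>)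
    then have "((\<lambda>x::real. - ((1 + x) powr (1 - a)) / (a - 1)) \<longlongrightarrow> - 0 / (a - 1)) at_top"
      by (intro tendsto_intros) (use a in auto)
    then show "(?F \<longlongrightarrow> 0) at_top" by simp
  qed (use a in auto)
  then have fin: "(\<integral>\<^sup>+x. ennreal ((1 + \<bar>x\<bar>) powr (- a)) * indicator {0..} x \<partial>lborel) < \<infinity>" (is "?I < _")
    by (subst (asm) nn_integral_cong[where v="\<lambda>x. ennreal ((1 + \<bar>x\<bar>) powr (- a)) * indicator {0..} x"]) (auto simp: indicator_def)
  have "?I = (\<integral>\<^sup>+x. ennreal ((1 + \<bar>x\<bar>) powr (- a)) * indicator {..0} x \<partial>lborel)"
    by (subst nn_integral_real_affine[where c="-1" and t=0]) (auto simp: indicator_def intro!: nn_integral_cong)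
  then have fin2: "(\<integral>\<^sup>+x. ennreal ((1 + \<bar>x\<bar>) powr (- a)) * indicator {..0} x \<partial>lborel) < \<infinity>"
    using fin by simp
  have "(\<integral>\<^sup>+x. ennreal ((1 + \<bar>x\<bar>) powr (- a)) \<partial>lborel) \<le>
     (\<integral>\<^sup>+x. ennreal ((1 + \<bar>x\<bar>) powr (- a)) * indicator {0..} x + ennreal ((1 + \<bar>x\<bar>) powr (- a)) * indicator {..0} x \<partial>lborel)"
    by (intro nn_integral_mono) (auto simp: indicator_def)
  also have "\<dots> = ?I + (\<integral>\<^sup>+x. ennreal ((1 + \<bar>x\<bar>) powr (- a)) * indicator {..0} x \<partial>lborel)"
    by (rule nn_integral_add) auto
  also have "\<dots> < \<infinity>" using fin fin2 by simp
  finally show ?thesis .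
qed

lemma nn_integral_inverse_poly_weight:
  "(\<integral>\<^sup>+x. ennreal (inverse (poly_weight (x::'a::euclidean_space))) \<partial>lborel) < \<infinity>"
proof -
  \<comment> \<open>Spreads the decay of order d + 1 evenly over the d coordinates; each of them
    receives an exponent greater than 1.\<close>
  define a where "a = (real DIM('a) + 1) / real DIM('a)"
  have a: "1 < a" by (simp add: a_def)
  have "ennreal (inverse (poly_weight x)) \<le> (\<Prod>b\<in>Basis. ennreal ((1 + \<bar>x \<bullet> b\<bar>) powr (- a)))" for x :: 'a
  proof -
    have "inverse (poly_weight x) = (1 + norm x) powr (- (real DIM('a) + 1))"
      unfolding poly_weight_def powr_minus by (subst powr_realpow[symmetric]) (auto simp: add_pos_nonneg add.commute)
    also have "\<dots> = (\<Prod>b\<in>(Basis::'a set). (1 + norm x) powr (- a))"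
    proof -
      have "((1 + norm x) powr (- a)) ^ DIM('a) = (1 + norm x) powr (- a * real DIM('a))"
        using add_pos_nonneg[OF zero_less_one norm_ge_zero[of x]]
        by (subst powr_realpow[symmetric]) (auto simp: powr_powr)
      moreover have "- a * real DIM('a) = - (real DIM('a) + 1)" by (simp add: a_def)
      ultimately show ?thesis by simp
    qed
    also have "\<dots> \<le> (\<Prod>b\<in>Basis. (1 + \<bar>x \<bullet> b\<bar>) powr (- a))"
    proof (intro prod_mono conjI)
      fix b :: 'a assume "b \<in> Basis"
      then show "(1 + norm x) powr (- a) \<le> (1 + \<bar>x \<bullet> b\<bar>) powr (- a)"
        using a Basis_le_norm[of b x] by (intro powr_mono2') auto
    qed auto
    finally have "ennreal (inverse (poly_weight x)) \<le> ennreal (\<Prod>b\<in>Basis. (1 + \<bar>x \<bullet> b\<bar>) powr (- a))"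
      by (rule ennreal_leI)
    then show ?thesis by (simp add: prod_ennreal)
  qed
  then have "(\<integral>\<^sup>+x. ennreal (inverse (poly_weight (x::'a))) \<partial>lborel) \<le> (\<integral>\<^sup>+x. (\<Prod>b\<in>Basis. ennreal ((1 + \<bar>(x::'a) \<bullet> b\<bar>) powr (- a))) \<partial>lborel)"
    by (rule nn_integral_mono)
  also have "\<dots> = (\<Prod>b\<in>(Basis::'a set). \<integral>\<^sup>+x. ennreal ((1 + \<bar>x\<bar>) powr (- a)) \<partial>lborel)"
    by (rule nn_integral_lborel_prod) auto
  also have "\<dots> < \<infinity>"
    using nn_integral_powr_decay[OF a] by (simp add: ennreal_prod_eq_top power_less_top_ennreal)
  finally show ?thesis .
qed

lemma nn_integral_lborel_shift:
  fixes f :: "'a::euclidean_space \<Rightarrow> ennreal"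
  assumes [measurable]: "f \<in> borel_measurable borel"
  shows "(\<integral>\<^sup>+x. f (x + c) \<partial>lborel) = (\<integral>\<^sup>+x. f x \<partial>lborel)"
  by (subst lborel_distr_plus[symmetric, of c], subst nn_integral_distr) (auto simp: add.commute)

lemma nn_integral_lborel_reflect:
  fixes f :: "'a::euclidean_space \<Rightarrow> ennreal"
  assumes [measurable]: "f \<in> borel_measurable borel"
  shows "(\<integral>\<^sup>+x. f (c - x) \<partial>lborel) = (\<integral>\<^sup>+x. f x \<partial>lborel)"
proof -
  have "(\<integral>\<^sup>+x. f x \<partial>lborel) = (\<integral>\<^sup>+x. f x \<partial>density (distr lborel borel (\<lambda>x. c + (-1) *\<^sub>R x)) (\<lambda>_. ennreal (\<bar>-1\<bar> ^ DIM('a))))"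
    by (subst lborel_affine[of "-1" c]) auto
  also have "\<dots> = (\<integral>\<^sup>+x. f (c - x) \<partial>lborel)"
    by (simp add: density_1 nn_integral_distr)
  finally show ?thesis by simp
qed

text \<open>Integrating over the shift \<open>u\<close> decouples the two functions. The majorant of
  the oscillation is built from such correlations for this reason.\<close>

lemma nn_integral_correlation:
  fixes f g :: "'a::euclidean_space \<Rightarrow> ennreal"
  assumes [measurable]: "f \<in> borel_measurable borel" "g \<in> borel_measurable borel"
  shows "(\<integral>\<^sup>+u. (\<integral>\<^sup>+t. f (t + u) * g t \<partial>lborel) \<partial>lborel) = (\<integral>\<^sup>+t. f t \<partial>lborel) * (\<integral>\<^sup>+t. g t \<partial>lborel)"
proof -
  have "(\<integral>\<^sup>+u. (\<integral>\<^sup>+t. f (t + u) * g t \<partial>lborel) \<partial>lborel) = (\<integral>\<^sup>+t. (\<integral>\<^sup>+u. f (t + u) * g t \<partial>lborel) \<partial>lborel)"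
    by (rule lborel_pair.Fubini'[where f="\<lambda>t u. f (t + u) * g t"]) measurable
  also have "\<dots> = (\<integral>\<^sup>+t. (\<integral>\<^sup>+u. f u \<partial>lborel) * g t \<partial>lborel)"
  proof (intro nn_integral_cong)
    fix t
    have "(\<integral>\<^sup>+u. f (t + u) * g t \<partial>lborel) = (\<integral>\<^sup>+u. f (u + t) \<partial>lborel) * g t"
      by (subst nn_integral_multc) (auto simp: add.commute)
    then show "(\<integral>\<^sup>+u. f (t + u) * g t \<partial>lborel) = (\<integral>\<^sup>+u. f u \<partial>lborel) * g t"
      by (simp add: nn_integral_lborel_shift)
  qed
  also have "\<dots> = (\<integral>\<^sup>+t. f t \<partial>lborel) * (\<integral>\<^sup>+t. g t \<partial>lborel)"
    by (rule nn_integral_cmult) simp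
  finally show ?thesis .
qed

section \<open>Estimates for the weighted prototype\<close>

lemma exp_const_mono: "0 \<le> a \<Longrightarrow> a \<le> b \<Longrightarrow> exp_const a n \<le> exp_const b n"
proof (induction n)
  case (Suc n)
  have "2 ^ n * a * exp_const a n \<le> 2 ^ n * b * exp_const b n"
    using Suc exp_const_ge_1[of a n] by (intro mult_mono) auto
  then show ?case unfolding exp_const.simps using Suc by (intro max.mono) auto
qed simp

lemma continuous_exp_const: "continuous_on S f \<Longrightarrow> continuous_on S (\<lambda>x. exp_const (f x) n)"
  by (induction n) (auto intro!: continuous_intros)

text \<open>Mean value inequality on the ball of radius |t|, where radial monotonicity bounds all
  derivatives by \<open>v\<^sub>0 t\<close>. The norm is the Euclidean one on matrices: d^2 entries
  bound a partial derivative, and d partial derivatives bound the differential. The bound is uniform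
  in \<open>t0\<close>.\<close>

lemma (in warping) phi_continuity_estimate:
  "norm (\<phi> t0 t - mat 1) \<le> real CARD('n) * (real CARD('n))\<^sup>2 * v\<^sub>0 t * norm t"
proof -
  let ?f' = "\<lambda>x. frechet_derivative (\<phi> t0) (at x)"
  have d: "(\<phi> t0 has_derivative ?f' x) (at x)" for x
  proof -
    obtain k where k: "N = Suc k" using N0 by (cases N) auto
    have "\<phi> t0 differentiable (at x)" using phi_Ck[of t0] unfolding k by simp
    then show ?thesis using frechet_derivative_works by blast
  qed
  have B: "onorm (?f' x) \<le> real CARD('n) * (real CARD('n))\<^sup>2 * v\<^sub>0 t" if x: "x \<in> cball 0 (norm t)" for x
  proof (rule onorm_le)
    fix h :: "real^'n"
    have lin: "linear (?f' x)" using d has_derivative_linear by blast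
    have pn: "norm (partial_deriv j (\<phi> t0) x) \<le> (real CARD('n))\<^sup>2 * v\<^sub>0 t" for j
    proof -
      have "norm (partial_deriv j (\<phi> t0) x) \<le> (\<Sum>a\<in>UNIV. norm (partial_deriv j (\<phi> t0) x $ a))"
        unfolding norm_vec_def by (intro L2_set_le_sum) auto
      also have "\<dots> \<le> (\<Sum>a\<in>(UNIV::'n set). \<Sum>b\<in>(UNIV::'n set). \<bar>partial_deriv j (\<phi> t0) x $ a $ b\<bar>)"
        by (intro sum_mono norm_le_l1_cart)
      also have "\<dots> \<le> (\<Sum>a\<in>(UNIV::'n set). \<Sum>b\<in>(UNIV::'n set). v\<^sub>0 t)"
      proof (intro sum_mono)
        fix a b
        have "\<bar>partial_deriv j (\<phi> t0) x $ a $ b\<bar> \<le> v\<^sub>0 x"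
          using phi_entry_bound[of 1 j t0 x a b] N0 by simp
        also have "\<dots> \<le> v\<^sub>0 t" using x by (intro v0_rad) auto
        finally show "\<bar>partial_deriv j (\<phi> t0) x $ a $ b\<bar> \<le> v\<^sub>0 t" .
      qed
      finally show ?thesis by (simp add: power2_eq_square)
    qed
    have "?f' x h = ?f' x (\<Sum>j\<in>UNIV. (h $ j) *\<^sub>R axis j 1)"
      using basis_expansion[of h] by (simp add: scalar_mult_eq_scaleR)
    also have "\<dots> = (\<Sum>j\<in>UNIV. (h $ j) *\<^sub>R partial_deriv j (\<phi> t0) x)"
      by (simp add: linear_sum[OF lin] linear_scale[OF lin] partial_deriv_def)
    also have "norm \<dots> \<le> (\<Sum>j\<in>(UNIV::'n set). norm h * ((real CARD('n))\<^sup>2 * v\<^sub>0 t))"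
    proof (rule sum_norm_le)
      fix j
      show "norm ((h $ j) *\<^sub>R partial_deriv j (\<phi> t0) x) \<le> norm h * ((real CARD('n))\<^sup>2 * v\<^sub>0 t)"
        using pn[of j] component_le_norm_cart[of h j] v0_pos[of t] by (auto intro!: mult_mono)
    qed
    finally show "norm (?f' x h) \<le> real CARD('n) * (real CARD('n))\<^sup>2 * v\<^sub>0 t * norm h"
      by (simp add: mult_ac)
  qed
  have "norm (\<phi> t0 t - \<phi> t0 0) \<le> (real CARD('n) * (real CARD('n))\<^sup>2 * v\<^sub>0 t) * norm (t - 0)"
    by (rule differentiable_bound[OF convex_cball[of 0 "norm t"] _ B]) (auto intro: has_derivative_at_withinI d)
  then show ?thesis by (simp add: phi_0)
qed

text \<open>The quotient is the determinant of \<phi> based at t0 + s and evaluated at -s, hence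
  near det 1 uniformly in \<open>t0\<close>. The uniformity is the point: continuity of
  \<open>w\<close> alone would give an \<eta> depending on \<open>t0\<close>.\<close>

lemma (in warping) w_ratio_near_1:
  assumes e: "0 < e"
  shows "\<exists>\<eta>>0. \<forall>t0 s. norm s \<le> \<eta> \<longrightarrow> \<bar>1 - sqrt (w t0 / w (t0 + s))\<bar> \<le> e"
proof -
  have "continuous_on UNIV (\<lambda>B::real^'n^'n. det B)"
    unfolding det_def
    by (intro continuous_on_sum continuous_on_mult continuous_on_const continuous_on_prod continuous_on_component continuous_on_id)
  then have "isCont (\<lambda>B::real^'n^'n. det B) (mat 1)" by (simp add: continuous_on_eq_continuous_at)
  then obtain \<rho> where \<rho>: "0 < \<rho>" "\<And>B::real^'n^'n. norm (B - mat 1) < \<rho> \<Longrightarrow> \<bar>det B - 1\<bar> < e"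
    using e unfolding continuous_at_eps_delta by (auto simp: dist_norm)
  \<comment> \<open>By radial monotonicity the value of \<open>v\<^sub>0\<close> at a unit vector
    bounds it on the whole unit ball.\<close>
  obtain a :: "real^'n" where a: "norm a = 1" using vector_choose_size[of 1] by auto
  define C where "C = real CARD('n) * (real CARD('n))\<^sup>2 * v\<^sub>0 a"
  have C: "0 < C" using v0_pos[of a] by (simp add: C_def)
  show ?thesis
  proof (intro exI[of _ "min 1 (\<rho> / (2 * C))"] conjI allI impI)
    show "0 < min 1 (\<rho> / (2 * C))" using \<rho> C by simp
    fix t0 s :: "real^'n" assume s: "norm s \<le> min 1 (\<rho> / (2 * C))"
    have "norm (\<phi> (t0 + s) (- s) - mat 1) \<le> real CARD('n) * (real CARD('n))\<^sup>2 * v\<^sub>0 (- s) * norm (- s)"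
      by (rule phi_continuity_estimate)
    also have "\<dots> \<le> C * norm s"
      unfolding C_def using s a by (simp add: mult_right_mono mult_left_mono v0_rad)
    also have "\<dots> \<le> C * (\<rho> / (2 * C))" using C s by (intro mult_left_mono) auto
    also have "\<dots> < \<rho>" using C \<rho> by simp
    finally have "\<bar>det (\<phi> (t0 + s) (- s)) - 1\<bar> < e" by (rule \<rho>(2))
    then have x: "\<bar>w t0 / w (t0 + s) - 1\<bar> < e" by (simp add: det_phi add.commute)
    define x where "x = w t0 / w (t0 + s)"
    have "0 \<le> x" using w_pos[of t0] w_pos[of "t0 + s"] by (simp add: x_def)
    then have "1 - x = (1 - sqrt x) * (1 + sqrt x)" by (simp add: algebra_simps)
    then have "\<bar>1 - x\<bar> = \<bar>1 - sqrt x\<bar> * (1 + sqrt x)" using \<open>0 \<le> x\<close> by (simp add: abs_mult)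
    moreover have "\<bar>1 - sqrt x\<bar> * 1 \<le> \<bar>1 - sqrt x\<bar> * (1 + sqrt x)" using \<open>0 \<le> x\<close> by (intro mult_left_mono) auto
    ultimately have "\<bar>1 - sqrt x\<bar> \<le> \<bar>1 - x\<bar>" by simp
    also have "\<dots> < e" using x unfolding x_def[symmetric] abs_minus_commute[of x 1] .
    finally show "\<bar>1 - sqrt (w t0 / w (t0 + s))\<bar> \<le> e" unfolding x_def by (rule less_imp_le)
  qed
qed

text \<open>The hypotheses in the form the estimates consume: \<open>R_Phi\<close> is the bound on
  the differential of \<Phi>, rewritten for the inverse transpose of \<open>A\<close>, and
  \<open>square_fin\<close> gathers the L^2 hypotheses on all pure derivatives into the single
  function \<open>G\<close>.\<close>

locale osc_setup = warped_prototype D \<Phi> v\<^sub>0 N \<theta>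
  for D :: "(real^'n::finite) set" and \<Phi> v\<^sub>0 N \<theta> +
  fixes v\<^sub>1 :: "real^'n \<Rightarrow> real" and p :: nat and R\<^sub>\<Phi> :: real
  assumes N_eq: "N = CARD('n) + p + 1"
    and v1_cont: "continuous_on UNIV v\<^sub>1" and v1_sub: "v\<^sub>1 (a + b) \<le> v\<^sub>1 a * v\<^sub>1 b"
    and v1_minus: "v\<^sub>1 (- a) = v\<^sub>1 a" and v1_pos: "0 < v\<^sub>1 a"
    and R_Phi: "0 < p \<Longrightarrow> norm x \<le> R\<^sub>\<Phi> * norm (transpose (A t) *v x)"
    and square_fin: "(\<integral>\<^sup>+t. ennreal ((poly_weight t * v\<^sub>1 t * v\<^sub>0 t powr (9 * real CARD('n) / 2 + 3 * real p + 3) * G t)\<^sup>2) \<partial>lborel) < \<infinity>"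
begin

definition W :: "real^'n \<Rightarrow> real" where
  "W t = poly_weight t * v\<^sub>1 t * v\<^sub>0 t powr (9 * real CARD('n) / 2 + 3 * real p + 3)"

definition WG :: "real^'n \<Rightarrow> real" where "WG t = W t * G t"

lemma v1_ge_1: "1 \<le> v\<^sub>1 a"
proof -
  have "v\<^sub>1 0 * 1 \<le> v\<^sub>1 0 * v\<^sub>1 0" using v1_sub[of 0 0] by simp
  then have "1 \<le> v\<^sub>1 0" using v1_pos[of 0] mult_le_cancel_left_pos by blast
  also have "v\<^sub>1 0 \<le> (v\<^sub>1 a)\<^sup>2" using v1_sub[of a "- a"] by (simp add: v1_minus power2_eq_square)
  finally show ?thesis using v1_pos[of a] power2_le_imp_le[of 1 "v\<^sub>1 a"] by simp
qed

lemma W_cont: "continuous_on S W"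
  unfolding W_def[abs_def]
  by (intro continuous_intros continuous_poly_weight continuous_on_subset[OF v1_cont] continuous_on_subset[OF v0_cont])
     (use v0_pos in \<open>auto simp: less_imp_neq[symmetric]\<close>)

lemma W_borel [measurable]: "W \<in> borel_measurable borel"
  by (intro borel_measurable_continuous_onI W_cont)
lemma G_borel [measurable]: "G \<in> borel_measurable borel"
  by (intro borel_measurable_continuous_onI G_cont)
lemma WG_borel [measurable]: "WG \<in> borel_measurable borel"
  unfolding WG_def[abs_def] by measurable

lemma W_pos: "0 < W t"
  unfolding W_def using poly_weight_pos[of t] v1_pos[of t] v0_pos[of t] by simp

lemma W_submult: "W (s + t) \<le> W s * W t"
proof -
  have "v\<^sub>0 (s + t) powr (9 * real CARD('n) / 2 + 3 * real p + 3) \<le> (v\<^sub>0 s * v\<^sub>0 t) powr (9 * real CARD('n) / 2 + 3 * real p + 3)"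
    using v0_pos[of "s + t"] by (intro powr_mono2 v0_sub) auto
  also have "\<dots> = v\<^sub>0 s powr (9 * real CARD('n) / 2 + 3 * real p + 3) * v\<^sub>0 t powr (9 * real CARD('n) / 2 + 3 * real p + 3)"
    using v0_pos[of s] v0_pos[of t] by (simp add: powr_mult)
  finally have "W (s + t) \<le> (poly_weight s * poly_weight t) * (v\<^sub>1 s * v\<^sub>1 t) *
     (v\<^sub>0 s powr (9 * real CARD('n) / 2 + 3 * real p + 3) * v\<^sub>0 t powr (9 * real CARD('n) / 2 + 3 * real p + 3))"
    unfolding W_def
    by (intro mult_mono poly_weight_submult v1_sub mult_nonneg_nonneg)
       (auto intro: less_imp_le[OF poly_weight_pos] less_imp_le[OF v1_pos])
  then show ?thesis by (simp add: W_def mult_ac)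
qed

lemma W_ge: "real k \<le> 9 * real CARD('n) / 2 + 3 * real p + 3 \<Longrightarrow> poly_weight t * v\<^sub>0 t ^ k \<le> W t"
proof -
  assume "real k \<le> 9 * real CARD('n) / 2 + 3 * real p + 3"
  then have "v\<^sub>0 t powr real k \<le> v\<^sub>0 t powr (9 * real CARD('n) / 2 + 3 * real p + 3)"
    by (intro powr_mono v0_ge_1)
  then have "poly_weight t * v\<^sub>0 t ^ k \<le> poly_weight t * v\<^sub>0 t powr (9 * real CARD('n) / 2 + 3 * real p + 3)"
    using v0_pos[of t] poly_weight_pos[of t] by (simp add: powr_realpow)
  also have "\<dots> = poly_weight t * 1 * v\<^sub>0 t powr (9 * real CARD('n) / 2 + 3 * real p + 3)" by simp
  also have "\<dots> \<le> W t"
    unfolding W_def using poly_weight_pos[of t] v1_ge_1[of t] by (intro mult_right_mono mult_left_mono) auto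
  finally show ?thesis .
qed

lemma WG_square_fin: "(\<integral>\<^sup>+t. ennreal ((WG t)\<^sup>2) \<partial>lborel) < \<infinity>"
  using square_fin by (simp add: WG_def W_def)

lemma WG_square_integrable: "integrable lborel (\<lambda>t. (WG t)\<^sup>2)"
  by (rule integrableI_nonneg) (use WG_square_fin in auto)

lemma inverse_poly_weight_integrable: "integrable lborel (\<lambda>t::real^'n. inverse (poly_weight t))"
  by (rule integrableI_nonneg) (use nn_integral_inverse_poly_weight poly_weight_pos less_imp_le in auto)

text \<open>The weight \<open>W\<close> leaves a spare factor \<open>poly_weight\<close>, whose
  inverse is integrable and at most 1, hence square integrable. The function is thus dominated by a
  product of two L^2 functions.\<close>

lemma G_integrable: "integrable lborel (\<lambda>t. v\<^sub>0 t ^ CARD('n) * G t)"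
proof (rule Bochner_Integration.integrable_bound)
  show "integrable lborel (\<lambda>t. (WG t)\<^sup>2 + inverse (poly_weight t))"
    using WG_square_integrable inverse_poly_weight_integrable by simp
  have [measurable]: "v\<^sub>0 \<in> borel_measurable borel" by (intro borel_measurable_continuous_onI v0_cont)
  show "(\<lambda>t. v\<^sub>0 t ^ CARD('n) * G t) \<in> borel_measurable lborel" by measurable
  show "AE t in lborel. norm (v\<^sub>0 t ^ CARD('n) * G t) \<le> norm ((WG t)\<^sup>2 + inverse (poly_weight t))"
  proof (rule AE_I2)
    fix t :: "real^'n"
    define P where "P = poly_weight t"
    have P: "1 \<le> P" unfolding P_def by (rule poly_weight_ge_1)
    have "poly_weight t * v\<^sub>0 t ^ CARD('n) * G t \<le> WG t"
      unfolding WG_def by (intro mult_right_mono W_ge G_nonneg) simp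
    then have "v\<^sub>0 t ^ CARD('n) * G t \<le> WG t * inverse P" using P by (simp add: field_simps P_def)
    also have "\<dots> \<le> ((WG t)\<^sup>2 + (inverse P)\<^sup>2) / 2"
      using mult_le_sum_squares[of 1 "WG t" "inverse P"] by simp
    also have "\<dots> \<le> (WG t)\<^sup>2 + inverse P"
    proof -
      have "(inverse P)\<^sup>2 \<le> inverse P" using P by (simp add: power2_eq_square mult_left_le inverse_le_1_iff)
      moreover have "0 \<le> inverse P" using P by simp
      moreover have "(a + b) / 2 \<le> a + c" if "b \<le> c" "0 \<le> c" "0 \<le> a" for a b c :: real
        using that by (simp add: field_simps)
      ultimately show ?thesis by (metis zero_le_power2)
    qed
    finally show "norm (v\<^sub>0 t ^ CARD('n) * G t) \<le> norm ((WG t)\<^sup>2 + inverse (poly_weight t))"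
      using P v0_pos[of t] G_nonneg[of t] by (simp add: P_def)
  qed
qed

lemma G_square_integrable: "integrable lborel (\<lambda>t. v\<^sub>0 t ^ CARD('n) * (G t)\<^sup>2)"
proof (rule Bochner_Integration.integrable_bound[OF WG_square_integrable])
  have [measurable]: "v\<^sub>0 \<in> borel_measurable borel" by (intro borel_measurable_continuous_onI v0_cont)
  show "(\<lambda>t. v\<^sub>0 t ^ CARD('n) * (G t)\<^sup>2) \<in> borel_measurable lborel" by measurable
  show "AE t in lborel. norm (v\<^sub>0 t ^ CARD('n) * (G t)\<^sup>2) \<le> norm ((WG t)\<^sup>2)"
  proof (rule AE_I2)
    fix t
    have v: "1 \<le> v\<^sub>0 t ^ CARD('n)" by (rule one_le_power[OF v0_ge_1])
    have "v\<^sub>0 t ^ CARD('n) * 1 \<le> v\<^sub>0 t ^ CARD('n) * v\<^sub>0 t ^ CARD('n)" using v by (intro mult_left_mono) auto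
    then have "v\<^sub>0 t ^ CARD('n) * (G t)\<^sup>2 \<le> (v\<^sub>0 t ^ CARD('n) * v\<^sub>0 t ^ CARD('n)) * (G t)\<^sup>2"
      by (intro mult_right_mono) auto
    also have "\<dots> = (v\<^sub>0 t ^ CARD('n) * G t)\<^sup>2" by (simp only: power2_eq_square mult_ac)
    finally have "v\<^sub>0 t ^ CARD('n) * (G t)\<^sup>2 \<le> (v\<^sub>0 t ^ CARD('n) * G t)\<^sup>2" .
    also have "(v\<^sub>0 t ^ CARD('n) * G t)\<^sup>2 \<le> (WG t)\<^sup>2"
    proof (intro power_mono)
      have "1 * v\<^sub>0 t ^ CARD('n) \<le> poly_weight t * v\<^sub>0 t ^ CARD('n)"
        using poly_weight_ge_1[of t] v by (intro mult_right_mono) auto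
      also have "\<dots> \<le> W t" by (rule W_ge) simp
      finally show "v\<^sub>0 t ^ CARD('n) * G t \<le> WG t" unfolding WG_def by (intro mult_right_mono G_nonneg) simp
    qed (use v G_nonneg[of t] in auto)
    finally show "norm (v\<^sub>0 t ^ CARD('n) * (G t)\<^sup>2) \<le> norm ((WG t)\<^sup>2)" using v by simp
  qed
qed

text \<open>The weights at \<open>u\<close> are split over t + u and -t, and symmetry turns -t into
  t. At \<open>t\<close> the exponents of \<open>v\<^sub>0\<close> add up to d/2 + 3N + d, the
  exponent in \<open>W\<close>. The factors 1/\<open>poly_weight\<close> left over at
  \<open>t\<close> and t + u are handed out crosswise after the mean inequality: each summand
  becomes a function of t + u times a function of t, with both integrable in the end.\<close>

lemma osc_integrand_le:
  assumes \<kappa>: "0 < \<kappa>" and B: "0 \<le> B"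
  shows "v\<^sub>1 u * v\<^sub>0 u powr (real CARD('n) / 2) * (v\<^sub>0 t ^ (3 * N + CARD('n)) * (G (t + u) * B))
    \<le> \<kappa> * (WG (t + u))\<^sup>2 * inverse (poly_weight t) + inverse (poly_weight (t + u)) * ((W t * B)\<^sup>2 / \<kappa>)"
proof -
  let ?h = "real CARD('n) / 2" let ?e = "9 * real CARD('n) / 2 + 3 * real p + 3"
  let ?P = "poly_weight t" and ?Q = "poly_weight (t + u)"
  have P: "1 \<le> ?P" and Q: "1 \<le> ?Q" by (rule poly_weight_ge_1)+
  have u: "u = (t + u) + (- t)" by simp
  have "v\<^sub>1 u \<le> v\<^sub>1 (t + u) * v\<^sub>1 t" using v1_sub[of "t + u" "- t"] by (simp add: v1_minus)
  moreover have "v\<^sub>0 u powr ?h \<le> v\<^sub>0 (t + u) powr ?h * v\<^sub>0 t powr ?h"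
  proof -
    have "v\<^sub>0 u \<le> v\<^sub>0 (t + u) * v\<^sub>0 t" using v0_sub[of "t + u" "- t"] by (simp add: v0_minus)
    then have "v\<^sub>0 u powr ?h \<le> (v\<^sub>0 (t + u) * v\<^sub>0 t) powr ?h" using v0_pos[of u] by (intro powr_mono2) auto
    then show ?thesis using v0_pos[of t] v0_pos[of "t + u"] by (simp add: powr_mult)
  qed
  ultimately have "v\<^sub>1 u * v\<^sub>0 u powr ?h \<le> (v\<^sub>1 (t + u) * v\<^sub>1 t) * (v\<^sub>0 (t + u) powr ?h * v\<^sub>0 t powr ?h)"
    by (intro mult_mono mult_nonneg_nonneg less_imp_le[OF v1_pos]) auto
  then have "v\<^sub>1 u * v\<^sub>0 u powr ?h * (v\<^sub>0 t ^ (3 * N + CARD('n)) * (G (t + u) * B))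
     \<le> (v\<^sub>1 (t + u) * v\<^sub>1 t) * (v\<^sub>0 (t + u) powr ?h * v\<^sub>0 t powr ?h) * (v\<^sub>0 t ^ (3 * N + CARD('n)) * (G (t + u) * B))"
    using v0_pos[of t] G_nonneg[of "t + u"] B by (intro mult_right_mono) auto
  also have "\<dots> = (v\<^sub>1 (t + u) * v\<^sub>0 (t + u) powr ?h * G (t + u)) * (v\<^sub>1 t * (v\<^sub>0 t powr ?h * v\<^sub>0 t ^ (3 * N + CARD('n))) * B)"
    by (simp add: mult_ac)
  also have "v\<^sub>0 t powr ?h * v\<^sub>0 t ^ (3 * N + CARD('n)) = v\<^sub>0 t powr ?e"
  proof -
    have "v\<^sub>0 t powr ?h * v\<^sub>0 t powr real (3 * N + CARD('n)) = v\<^sub>0 t powr (?h + real (3 * N + CARD('n)))"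
      by (rule powr_add[symmetric])
    also have "?h + real (3 * N + CARD('n)) = ?e" by (simp add: N_eq field_simps)
    finally show ?thesis unfolding powr_realpow[OF v0_pos] .
  qed
  also have "v\<^sub>1 t * v\<^sub>0 t powr ?e * B = (W t * B) * inverse ?P"
    using P by (simp add: W_def field_simps)
  also have "(v\<^sub>1 (t + u) * v\<^sub>0 (t + u) powr ?h * G (t + u)) * ((W t * B) * inverse ?P) \<le> (WG (t + u) * inverse ?Q) * ((W t * B) * inverse ?P)"
  proof (rule mult_right_mono)
    have "v\<^sub>1 (t + u) * v\<^sub>0 (t + u) powr ?h * G (t + u) \<le> v\<^sub>1 (t + u) * v\<^sub>0 (t + u) powr ?e * G (t + u)"
      using v1_pos[of "t + u"] G_nonneg[of "t + u"] v0_ge_1[of "t + u"]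
      by (intro mult_right_mono mult_left_mono powr_mono) auto
    also have "\<dots> = WG (t + u) * inverse ?Q" using Q by (simp add: WG_def W_def field_simps)
    finally show "v\<^sub>1 (t + u) * v\<^sub>0 (t + u) powr ?h * G (t + u) \<le> WG (t + u) * inverse ?Q" .
  qed (use B W_pos[of t] P in auto)
  also have "\<dots> = (WG (t + u) * (W t * B)) * (inverse ?P * inverse ?Q)" by (simp add: mult_ac)
  also have "\<dots> \<le> ((\<kappa> * (WG (t + u))\<^sup>2 + (W t * B)\<^sup>2 / \<kappa>) / 2) * (inverse ?P * inverse ?Q)"
    using P Q by (intro mult_right_mono mult_le_sum_squares \<kappa>) auto
  also have "\<dots> \<le> (\<kappa> * (WG (t + u))\<^sup>2) * inverse ?P + ((W t * B)\<^sup>2 / \<kappa>) * inverse ?Q"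
  proof -
    have ineq: "(X + Y) / 2 * (a * b) \<le> X * a + Y * b" if "0 \<le> X" "0 \<le> Y" "0 \<le> a" "a \<le> 1" "0 \<le> b" "b \<le> 1" for X Y a b :: real
    proof -
      have "X * (a * b) \<le> X * a" "Y * (a * b) \<le> Y * b" "0 \<le> X * a" "0 \<le> Y * b"
        using that by (auto intro!: mult_left_mono simp: mult_left_le mult_left_le_one_le)
      then show ?thesis by (simp add: field_simps)
    qed
    show ?thesis by (rule ineq) (use \<kappa> P Q in \<open>auto simp: inverse_le_1_iff\<close>)
  qed
  finally show ?thesis by (simp add: mult_ac)
qed

end

lemma nn_integral_tail_tendsto_0:
  fixes f :: "'a::euclidean_space \<Rightarrow> ennreal"
  assumes [measurable]: "f \<in> borel_measurable borel" and fin: "(\<integral>\<^sup>+t. f t \<partial>lborel) < \<infinity>"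
  shows "(\<lambda>n. \<integral>\<^sup>+t. f t * indicator {t. real n < norm t} t \<partial>lborel) \<longlonglongrightarrow> 0"
proof -
  have "(\<lambda>n. \<integral>\<^sup>+t. f t * indicator {t. real n < norm t} t \<partial>lborel) \<longlonglongrightarrow> (\<integral>\<^sup>+t. 0 \<partial>(lborel :: 'a measure))"
  proof (rule nn_integral_dominated_convergence[where w=f])
    show "(\<lambda>t. f t * indicator {t. real n < norm t} t) \<in> borel_measurable lborel" for n by measurable
    show "AE t in lborel. (\<lambda>n. f t * indicator {t. real n < norm t} t) \<longlonglongrightarrow> 0"
    proof (rule AE_I2)
      fix t :: 'a
      obtain n0 where "norm t \<le> real n0" using real_arch_simple by blast
      then have "\<forall>n\<ge>n0. f t * indicator {t. real n < norm t} t = 0" by (auto simp: indicator_def)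
      then show "(\<lambda>n. f t * indicator {t. real n < norm t} t) \<longlonglongrightarrow> 0"
        by (intro tendsto_eventually) (auto simp: eventually_sequentially)
    qed
  qed (use fin in \<open>auto simp: indicator_def\<close>)
  then show ?thesis by simp
qed

lemma ennreal_majorant_expand:
  fixes k :: real
  assumes "0 \<le> k" "0 \<le> a" "0 \<le> b" "0 \<le> c" "0 \<le> l" "0 \<le> i" "0 \<le> l'" "0 \<le> x" "0 \<le> i'" "0 \<le> l''" "0 \<le> y" "0 \<le> i''"
  shows "ennreal (k * a * b + (c * (l * i) + (c * (l' * (x * i')) + c * (l'' * (y * i''))))) =
     (ennreal k * ennreal a) * ennreal b + (ennreal c * (ennreal l * ennreal i)
     + (ennreal c * (ennreal l' * (ennreal x * ennreal i')) + ennreal c * (ennreal l'' * (ennreal y * ennreal i''))))"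
  using assms by (simp add: ennreal_plus ennreal_mult)

section \<open>Substitution along the warping function\<close>

context warping begin

lemma Phi_indicator_borel [measurable]: "(\<lambda>x. indicator D x *\<^sub>R \<Phi> x) \<in> borel_measurable borel"
  by (rule borel_measurable_continuous_on_indicator) (auto simp: openD Phi_cont)

lemma D_borel [measurable]: "D \<in> sets borel" using openD by simp

lemma warp_density: "distr (density lborel (\<lambda>t. ennreal (w t))) borel \<Theta> = density lborel (indicator D)"
  using density_distr_diffeomorphism[OF Theta_deriv inj_Theta det_cont] w_pos less_imp_le[OF w_pos]
  by (simp add: range_Theta openD warp_w_def[abs_def] abs_of_pos)

lemma w_borel [measurable]: "w \<in> borel_measurable borel"
  by (intro borel_measurable_continuous_onI w_cont)
lemma Theta_borel [measurable]: "\<Theta> \<in> borel_measurable borel"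
  by (intro borel_measurable_continuous_onI Theta_cont)
lemma v0_borel [measurable]: "v\<^sub>0 \<in> borel_measurable borel"
  by (intro borel_measurable_continuous_onI v0_cont)

lemma nn_integral_warp:
  assumes [measurable]: "g \<in> borel_measurable borel"
  shows "(\<integral>\<^sup>+x. g x * indicator D x \<partial>lborel) = (\<integral>\<^sup>+t. ennreal (w t) * g (\<Theta> t) \<partial>lborel)"
proof -
  have "(\<integral>\<^sup>+x. g x * indicator D x \<partial>lborel) = (\<integral>\<^sup>+x. g x \<partial>density lborel (indicator D))"
    by (subst nn_integral_density) (auto simp: mult.commute)
  also have "\<dots> = (\<integral>\<^sup>+x. g x \<partial>distr (density lborel (\<lambda>t. ennreal (w t))) borel \<Theta>)" by (simp add: warp_density)
  also have "\<dots> = (\<integral>\<^sup>+t. ennreal (w t) * g (\<Theta> t) \<partial>lborel)"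
    by (subst nn_integral_distr) (auto simp: nn_integral_density)
  finally show ?thesis .
qed

lemma nn_integral_warp_lebesgue_on:
  assumes [measurable]: "h \<in> borel_measurable borel"
  shows "(\<integral>\<^sup>+x. h (\<Phi> x) \<partial>lebesgue_on D) = (\<integral>\<^sup>+t. ennreal (w t) * h t \<partial>lborel)"
proof -
  have "(\<integral>\<^sup>+x. h (\<Phi> x) \<partial>lebesgue_on D) = (\<integral>\<^sup>+x. h (\<Phi> x) * indicator D x \<partial>lborel)"
    by (subst nn_integral_restrict_space) (simp_all add: nn_integral_completion)
  \<comment> \<open>The values of \<Phi> outside \<open>D\<close> are arbitrary, so \<Phi> is
    replaced by its Borel extension by zero before the substitution.\<close>
  also have "\<dots> = (\<integral>\<^sup>+x. h (indicator D x *\<^sub>R \<Phi> x) * indicator D x \<partial>lborel)"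
    by (intro nn_integral_cong) (auto simp: indicator_def)
  also have "\<dots> = (\<integral>\<^sup>+t. ennreal (w t) * h t \<partial>lborel)"
    by (subst nn_integral_warp) auto
  finally show ?thesis .
qed

lemma
  fixes F :: "real^'n \<Rightarrow> 'b::{banach, second_countable_topology}"
  assumes [measurable]: "F \<in> borel_measurable borel"
  shows integrable_warp: "integrable lborel (\<lambda>x. indicator D x *\<^sub>R F x) \<longleftrightarrow> integrable lborel (\<lambda>t. w t *\<^sub>R F (\<Theta> t))"
    and integral_warp: "(LINT x|lborel. indicator D x *\<^sub>R F x) = (LINT t|lborel. w t *\<^sub>R F (\<Theta> t))"
proof -
  have e: "density lborel (\<lambda>x. ennreal (indicator D x)) = density lborel (indicator D)"
    by (intro density_cong) (auto simp: indicator_def)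
  have "integrable lborel (\<lambda>x. indicator D x *\<^sub>R F x) \<longleftrightarrow> integrable (density lborel (indicator D)) F"
    unfolding e[symmetric] by (rule integrable_density[symmetric]) auto
  also have "\<dots> \<longleftrightarrow> integrable (distr (density lborel (\<lambda>t. ennreal (w t))) borel \<Theta>) F" by (simp add: warp_density)
  also have "\<dots> \<longleftrightarrow> integrable (density lborel (\<lambda>t. ennreal (w t))) (\<lambda>t. F (\<Theta> t))"
    by (rule integrable_distr_eq) auto
  also have "\<dots> \<longleftrightarrow> integrable lborel (\<lambda>t. w t *\<^sub>R F (\<Theta> t))"
    by (rule integrable_density) (auto simp: less_imp_le[OF w_pos])
  finally show "integrable lborel (\<lambda>x. indicator D x *\<^sub>R F x) \<longleftrightarrow> integrable lborel (\<lambda>t. w t *\<^sub>R F (\<Theta> t))" .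
  have "(LINT x|lborel. indicator D x *\<^sub>R F x) = integral\<^sup>L (density lborel (indicator D)) F"
    unfolding e[symmetric] by (rule integral_density[symmetric]) auto
  also have "\<dots> = integral\<^sup>L (distr (density lborel (\<lambda>t. ennreal (w t))) borel \<Theta>) F" by (simp add: warp_density)
  also have "\<dots> = (LINT t|density lborel (\<lambda>t. ennreal (w t)). F (\<Theta> t))"
    by (rule integral_distr) auto
  also have "\<dots> = (LINT t|lborel. w t *\<^sub>R F (\<Theta> t))"
    by (rule integral_density) (auto simp: less_imp_le[OF w_pos])
  finally show "(LINT x|lborel. indicator D x *\<^sub>R F x) = (LINT t|lborel. w t *\<^sub>R F (\<Theta> t))" .
qed

text \<open>The linear case of the change of variables. It converts decay in A^T x, the natural
  variable of the oscillatory estimate, into integrability in x.\<close>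

lemma nn_integral_transpose:
  assumes [measurable]: "h \<in> borel_measurable borel"
  shows "ennreal (w t0) * (\<integral>\<^sup>+x. h (transpose (A t0) *v x) \<partial>lborel) = (\<integral>\<^sup>+x. h x \<partial>lborel)"
proof -
  let ?T = "transpose (A t0)"
  have inv: "invertible ?T" using detA_nz by (simp add: invertible_det_nz)
  have bij: "bij ((*v) ?T)" using inv by (simp add: invertible_eq_bij)
  have [measurable]: "(*v) ?T \<in> borel_measurable borel"
    by (intro borel_measurable_continuous_onI linear_continuous_on) simp
  have d: "distr (density lborel (\<lambda>x. ennreal \<bar>det ?T\<bar>)) borel ((*v) ?T) = density lborel (indicator (range ((*v) ?T)))"
    by (rule density_distr_diffeomorphism[where A="\<lambda>_. ?T"])
       (use bij in \<open>auto simp: bij_def intro!: bounded_linear_imp_has_derivative\<close>)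
  have r: "range ((*v) ?T) = UNIV" using bij unfolding bij_def by blast
  have wd: "\<bar>det ?T\<bar> = w t0" using w_pos[of t0] by (simp add: det_transpose warp_w_def)
  have d': "distr (density lborel (\<lambda>x. ennreal (w t0))) borel ((*v) ?T) = lborel"
    using d unfolding r wd indicator_UNIV density_1 .
  define f where "f = (*v) ?T"
  have [measurable]: "f \<in> borel_measurable borel" unfolding f_def by measurable
  have "(\<integral>\<^sup>+x. h x \<partial>lborel) = (\<integral>\<^sup>+x. h x \<partial>distr (density lborel (\<lambda>x. ennreal (w t0))) borel f)"
    unfolding f_def d' ..
  also have "\<dots> = (\<integral>\<^sup>+x. h (f x) \<partial>density lborel (\<lambda>x. ennreal (w t0)))"
    by (rule nn_integral_distr) measurable
  also have "\<dots> = (\<integral>\<^sup>+x. ennreal (w t0) * h (f x) \<partial>lborel)"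
    by (rule nn_integral_density) measurable
  also have "\<dots> = ennreal (w t0) * (\<integral>\<^sup>+x. h (f x) \<partial>lborel)"
    by (rule nn_integral_cmult) measurable
  finally show ?thesis unfolding f_def ..
qed

end

section \<open>A majorant independent of the point of the supremum\<close>

context osc_setup begin

definition decay_mass :: ennreal where "decay_mass = (\<integral>\<^sup>+x. ennreal (inverse (poly_weight (x::real^'n))) \<partial>lborel)"
definition WG_mass :: ennreal where "WG_mass = (\<integral>\<^sup>+t. ennreal ((WG t)\<^sup>2) \<partial>lborel)"
definition tail :: "real \<Rightarrow> ennreal" where
  "tail R = (\<integral>\<^sup>+t. ennreal ((WG t)\<^sup>2) * indicator {t. R < norm t} t \<partial>lborel)"

lemma decay_mass_fin: "decay_mass < \<infinity>" unfolding decay_mass_def by (rule nn_integral_inverse_poly_weight)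
lemma WG_mass_fin: "WG_mass < \<infinity>" unfolding WG_mass_def by (rule WG_square_fin)

lemma tail_le: "tail R \<le> WG_mass"
  unfolding tail_def WG_mass_def by (intro nn_integral_mono) (auto simp: indicator_def)

lemma tail_small: "0 < e \<Longrightarrow> \<exists>n::nat. tail (real n) < e"
proof -
  assume "0 < e"
  have "(\<lambda>n. tail (real n)) \<longlonglongrightarrow> 0"
    unfolding tail_def by (rule nn_integral_tail_tendsto_0) (use WG_square_fin in auto)
  then have "eventually (\<lambda>n. tail (real n) < e) sequentially" using \<open>0 < e\<close> by (rule order_tendstoD(2))
  then show ?thesis by (auto simp: eventually_sequentially)
qed

text \<open>Here \<open>\<kappa>\<close> is the parameter of the arithmetic-geometric mean inequality, \<open>e\<close> bounds the weighted
  oscillation of the prototype on the ball of radius \<open>R\<close>, and \<open>r\<close> bounds the translations.\<close>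

definition osc_majorant :: "real \<Rightarrow> real \<Rightarrow> real \<Rightarrow> real \<Rightarrow> real \<Rightarrow> real^'n \<Rightarrow> ennreal" where
  "osc_majorant \<kappa> e R r M u = (\<integral>\<^sup>+t. (ennreal \<kappa> * ennreal ((WG (t + u))\<^sup>2)) * ennreal (inverse (poly_weight t)) \<partial>lborel) +
     (\<integral>\<^sup>+t. ennreal (inverse (poly_weight (t + u))) *
        (ennreal (e\<^sup>2 / \<kappa>) * indicator {t. norm t \<le> R} t + ennreal (M / \<kappa>) * (ennreal ((WG t)\<^sup>2) * indicator {t. R - r < norm t} t)) \<partial>lborel)"

lemma osc_majorant_borel [measurable]: "osc_majorant \<kappa> e R r M \<in> borel_measurable borel"
  unfolding osc_majorant_def[abs_def] by measurable

text \<open>The three terms dictate the order of the later choices: \<kappa> first, then the radius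
  \<open>R\<close> that makes the tail small, then \<open>e\<close>, which has to beat the volume of
  the ball.\<close>

lemma osc_majorant_integral:
  "(\<integral>\<^sup>+u. osc_majorant \<kappa> e R r M u \<partial>lborel) = ennreal \<kappa> * WG_mass * decay_mass + decay_mass * (ennreal (e\<^sup>2 / \<kappa>) * emeasure lborel {t::real^'n. norm t \<le> R} + ennreal (M / \<kappa>) * tail (R - r))"
proof -
  have "(\<integral>\<^sup>+u. osc_majorant \<kappa> e R r M u \<partial>lborel) = (\<integral>\<^sup>+t. ennreal \<kappa> * ennreal ((WG t)\<^sup>2) \<partial>lborel) * decay_mass +
     decay_mass * (\<integral>\<^sup>+t. (ennreal (e\<^sup>2 / \<kappa>) * indicator {t. norm t \<le> R} t + ennreal (M / \<kappa>) * (ennreal ((WG t)\<^sup>2) * indicator {t. R - r < norm t} t)) \<partial>lborel)"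
    unfolding osc_majorant_def decay_mass_def
    by (subst nn_integral_add) (auto simp: nn_integral_correlation[where f="\<lambda>t. ennreal \<kappa> * ennreal ((WG t)\<^sup>2)"]
        nn_integral_correlation[where f="\<lambda>t. ennreal (inverse (poly_weight t))"])
  also have "(\<integral>\<^sup>+t. ennreal \<kappa> * ennreal ((WG t)\<^sup>2) \<partial>lborel) = ennreal \<kappa> * WG_mass"
    unfolding WG_mass_def by (rule nn_integral_cmult) simp
  also have "(\<integral>\<^sup>+t. (ennreal (e\<^sup>2 / \<kappa>) * indicator {t. norm t \<le> R} t + ennreal (M / \<kappa>) * (ennreal ((WG t)\<^sup>2) * indicator {t. R - r < norm t} t)) \<partial>lborel)
    = ennreal (e\<^sup>2 / \<kappa>) * emeasure lborel {t::real^'n. norm t \<le> R} + ennreal (M / \<kappa>) * tail (R - r)"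
    unfolding tail_def by (subst nn_integral_add) (auto simp: nn_integral_cmult)
  finally show ?thesis .
qed

text \<open>Finiteness is wanted at every \<open>u\<close>, not just almost everywhere: it certifies
  that the integrand belonging to a given pair of frequencies is integrable, as
  \<open>atom_inner_bound\<close> assumes.\<close>

lemma osc_majorant_fin: "osc_majorant \<kappa> e R r M u < \<infinity>"
proof -
  have i1: "ennreal (inverse (poly_weight t)) \<le> 1" for t :: "real^'n"
    using poly_weight_ge_1[of t] poly_weight_pos[of t] by (simp add: inverse_le_1_iff)
  have "osc_majorant \<kappa> e R r M u \<le> (\<integral>\<^sup>+t. ennreal \<kappa> * ennreal ((WG (t + u))\<^sup>2) \<partial>lborel) +
     (\<integral>\<^sup>+t. (ennreal (e\<^sup>2 / \<kappa>) * indicator {t. norm t \<le> R} t + ennreal (M / \<kappa>) * (ennreal ((WG t)\<^sup>2) * indicator {t. R - r < norm t} t)) \<partial>lborel)"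
    unfolding osc_majorant_def
    by (intro add_mono nn_integral_mono)
       (use mult_left_mono[OF i1] mult_right_mono[OF i1] in \<open>auto simp del: ennreal_le_1\<close>)
  also have "(\<integral>\<^sup>+t. ennreal \<kappa> * ennreal ((WG (t + u))\<^sup>2) \<partial>lborel) = ennreal \<kappa> * WG_mass"
    unfolding WG_mass_def by (subst nn_integral_cmult) (auto simp: nn_integral_lborel_shift[where f="\<lambda>t. ennreal ((WG t)\<^sup>2)"])
  also have "(\<integral>\<^sup>+t. (ennreal (e\<^sup>2 / \<kappa>) * indicator {t. norm t \<le> R} t + ennreal (M / \<kappa>) * (ennreal ((WG t)\<^sup>2) * indicator {t. R - r < norm t} t)) \<partial>lborel)
    = ennreal (e\<^sup>2 / \<kappa>) * emeasure lborel {t::real^'n. norm t \<le> R} + ennreal (M / \<kappa>) * tail (R - r)"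
    unfolding tail_def by (subst nn_integral_add) (auto simp: nn_integral_cmult)
  finally have le: "osc_majorant \<kappa> e R r M u \<le> ennreal \<kappa> * WG_mass + (ennreal (e\<^sup>2 / \<kappa>) * emeasure lborel {t::real^'n. norm t \<le> R} + ennreal (M / \<kappa>) * tail (R - r))" .
  have nR: "emeasure lborel {t::real^'n. norm t \<le> R} < \<infinity>"
    using emeasure_lborel_cball_finite[of "0::real^'n" R] by (simp add: cball_def dist_norm)
  then have "ennreal \<kappa> * WG_mass + (ennreal (e\<^sup>2 / \<kappa>) * emeasure lborel {t::real^'n. norm t \<le> R} + ennreal (M / \<kappa>) * tail (R - r)) < \<infinity>"
    using WG_mass_fin le_less_trans[OF tail_le WG_mass_fin] nR
    by (auto simp: ennreal_mult_eq_top_iff less_top[symmetric])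
  with le show ?thesis by (rule le_less_trans)
qed

lemma bracket_bound_cont: "continuous_on UNIV (bracket_bound S c s)"
proof -
  have "continuous_on UNIV (\<lambda>t. G (t - s))"
    by (rule continuous_on_compose2[OF G_cont]) (auto intro!: continuous_intros)
  then show ?thesis
    unfolding bracket_bound_def[abs_def] bracket_coeff_def
    by (intro continuous_intros Gdiff_cont v0_cont)
qed

lemma bracket_bound_borel [measurable]: "bracket_bound S c s \<in> borel_measurable borel"
  by (intro borel_measurable_continuous_onI bracket_bound_cont)

lemma bracket_coeff_nonneg: "0 \<le> S \<Longrightarrow> 0 \<le> bracket_coeff S c t"
  unfolding bracket_coeff_def using v0_pos[of t] exp_const_ge_1[of "2 * pi * S" N]
  by (intro mult_nonneg_nonneg add_nonneg_nonneg) auto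

lemma bracket_bound_nonneg: "0 \<le> S \<Longrightarrow> 0 \<le> bracket_bound S c s t"
  unfolding bracket_bound_def using bracket_coeff_nonneg G_nonneg Gdiff_nonneg by simp

lemma Gdiff_le: "Gdiff s t \<le> G t + G (t - s)"
  unfolding Gdiff_def G_def sum.distrib[symmetric] by (intro sum_mono norm_triangle_ineq4)

text \<open>Outside the ball the bracket is at most G t + (1 + K) G (t - s). Squaring the sum gives
  the factors 2, moving \<open>W\<close> from t to t - s gives \<open>Wr\<close>, and moving
  \<open>poly_weight\<close> by \<open>s\<close> gives (1 + r)^(d+1).\<close>

definition Mconst :: "real \<Rightarrow> real \<Rightarrow> real \<Rightarrow> real" where
  "Mconst K Wr r = 2 + 2 * ((1 + K) * Wr)\<^sup>2 * (1 + r) ^ (CARD('n) + 1)"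

text \<open>On the ball of radius \<open>R\<close> the small bound \<open>e\<close> is used, outside
  it the tail of \<open>WG\<close>. Neither \<open>s\<close> nor \<open>S\<close> nor
  \<open>c\<close> is left on the right-hand side, so the bound survives the supremum.\<close>

lemma osc_majorant_bound:
  assumes \<kappa>: "0 < \<kappa>" and s: "norm s \<le> r" and Ws: "W s \<le> Wr" and S: "0 \<le> S"
    and K: "\<And>t. bracket_coeff S c t \<le> K" and e: "\<And>t. norm t \<le> R \<Longrightarrow> W t * bracket_bound S c s t \<le> e"
  shows "ennreal (v\<^sub>1 u * v\<^sub>0 u powr (real CARD('n) / 2)) * (\<integral>\<^sup>+t. ennreal (v\<^sub>0 t ^ (3 * N + CARD('n)) * (G (t + u) * bracket_bound S c s t)) \<partial>lborel)
     \<le> osc_majorant \<kappa> e R r (Mconst K Wr r) u"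
proof -
  define c2 where "c2 = 2 * ((1 + K) * Wr)\<^sup>2"
  define P where "P = (\<lambda>t::real^'n. inverse (poly_weight t))"
  have [measurable]: "P \<in> borel_measurable borel" unfolding P_def by measurable
  have P0: "0 \<le> P t" for t unfolding P_def using poly_weight_pos[of t] by simp
  have K0: "0 \<le> K" using K[of 0] bracket_coeff_nonneg[OF S, of c 0] by simp
  have Wr: "0 < Wr" using Ws W_pos[of s] by linarith
  have r0: "0 \<le> r" using s norm_ge_zero order_trans by blast
  let ?B = "bracket_bound S c s"
  let ?T1 = "\<lambda>t. (ennreal \<kappa> * ennreal ((WG (t + u))\<^sup>2)) * ennreal (P t)"
  let ?T2 = "\<lambda>t. ennreal (P (t + u)) * (ennreal (e\<^sup>2 / \<kappa>) * indicator {t. norm t \<le> R} t)"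
  let ?T3 = "\<lambda>t. ennreal (P (t + u)) * (ennreal (2 / \<kappa>) * (ennreal ((WG t)\<^sup>2) * indicator {t. R - r < norm t} t))"
  let ?T4 = "\<lambda>t. ennreal (P (t + u)) * (ennreal (c2 / \<kappa>) * (ennreal ((WG (t - s))\<^sup>2) * indicator {t. R < norm t} t))"
  let ?T5 = "\<lambda>t. ennreal (P (t + u)) * (ennreal (c2 * (1 + r) ^ (CARD('n) + 1) / \<kappa>) * (ennreal ((WG t)\<^sup>2) * indicator {t. R - r < norm t} t))"
  have b: "(W t * ?B t)\<^sup>2 \<le> e\<^sup>2 * indicator {t. norm t \<le> R} t + (2 * (WG t)\<^sup>2 + c2 * (WG (t - s))\<^sup>2) * indicator {t. R < norm t} t" for t
  proof (cases "norm t \<le> R")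
    case True
    then have "(W t * ?B t)\<^sup>2 \<le> e\<^sup>2"
      using e[OF True] W_pos[of t] bracket_bound_nonneg[OF S, of c s t] by (intro power_mono) auto
    then show ?thesis using True by simp
  next
    case False
    have "W t \<le> W s * W (t - s)" using W_submult[of s "t - s"] by simp
    also have "\<dots> \<le> Wr * W (t - s)" using Ws W_pos[of "t - s"] by (intro mult_right_mono) auto
    finally have Wt: "W t \<le> Wr * W (t - s)" .
    have "?B t \<le> G t + (1 + K) * G (t - s)"
      using Gdiff_le[of s t] mult_right_mono[OF K[of t] G_nonneg[of "t - s"]] unfolding bracket_bound_def by (simp add: algebra_simps)
    then have "W t * ?B t \<le> W t * (G t + (1 + K) * G (t - s))" using W_pos[of t] by (intro mult_left_mono) auto
    also have "\<dots> = WG t + W t * ((1 + K) * G (t - s))" by (simp add: WG_def algebra_simps)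
    also have "\<dots> \<le> WG t + (Wr * W (t - s)) * ((1 + K) * G (t - s))"
      using Wt K0 G_nonneg[of "t - s"] by (intro add_left_mono mult_right_mono) auto
    also have "\<dots> = WG t + ((1 + K) * Wr) * WG (t - s)" by (simp add: WG_def mult_ac)
    finally have "(W t * ?B t)\<^sup>2 \<le> (WG t + ((1 + K) * Wr) * WG (t - s))\<^sup>2"
      using W_pos[of t] bracket_bound_nonneg[OF S, of c s t] by (intro power_mono) auto
    also have "\<dots> \<le> 2 * (WG t)\<^sup>2 + 2 * (((1 + K) * Wr) * WG (t - s))\<^sup>2"
      using sum_squares_bound[of "WG t" "((1 + K) * Wr) * WG (t - s)"] by (simp add: power2_sum)
    also have "\<dots> = 2 * (WG t)\<^sup>2 + c2 * (WG (t - s))\<^sup>2" by (simp add: c2_def power_mult_distrib)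
    finally show ?thesis using False by simp
  qed
  have c20: "0 \<le> c2" by (simp add: c2_def)
  have pt: "ennreal (v\<^sub>1 u * v\<^sub>0 u powr (real CARD('n) / 2)) * ennreal (v\<^sub>0 t ^ (3 * N + CARD('n)) * (G (t + u) * ?B t))
     \<le> ?T1 t +
       (?T2 t
       + (?T3 t
       + ?T4 t))" for t
  proof -
    have "ennreal (v\<^sub>1 u * v\<^sub>0 u powr (real CARD('n) / 2)) * ennreal (v\<^sub>0 t ^ (3 * N + CARD('n)) * (G (t + u) * ?B t))
       = ennreal (v\<^sub>1 u * v\<^sub>0 u powr (real CARD('n) / 2) * (v\<^sub>0 t ^ (3 * N + CARD('n)) * (G (t + u) * ?B t)))"
      using v1_pos[of u] by (intro ennreal_mult'[symmetric]) simp
    also have "\<dots> \<le> ennreal (\<kappa> * (WG (t + u))\<^sup>2 * P t + (P (t + u) * (e\<^sup>2 / \<kappa> * indicator {t. norm t \<le> R} t)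
       + (P (t + u) * (2 / \<kappa> * ((WG t)\<^sup>2 * indicator {t. R - r < norm t} t))
       + P (t + u) * (c2 / \<kappa> * ((WG (t - s))\<^sup>2 * indicator {t. R < norm t} t)))))"
    proof (rule ennreal_leI)
      have "v\<^sub>1 u * v\<^sub>0 u powr (real CARD('n) / 2) * (v\<^sub>0 t ^ (3 * N + CARD('n)) * (G (t + u) * ?B t))
         \<le> \<kappa> * (WG (t + u))\<^sup>2 * P t + P (t + u) * ((W t * ?B t)\<^sup>2 / \<kappa>)"
        unfolding P_def by (rule osc_integrand_le[OF \<kappa> bracket_bound_nonneg[OF S]])
      also have "(W t * ?B t)\<^sup>2 / \<kappa> \<le> (e\<^sup>2 * indicator {t. norm t \<le> R} t + (2 * (WG t)\<^sup>2 + c2 * (WG (t - s))\<^sup>2) * indicator {t. R < norm t} t) / \<kappa>"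
        using b \<kappa> by (intro divide_right_mono) auto
      also have "\<dots> \<le> e\<^sup>2 / \<kappa> * indicator {t. norm t \<le> R} t + (2 / \<kappa> * ((WG t)\<^sup>2 * indicator {t. R - r < norm t} t)
         + c2 / \<kappa> * ((WG (t - s))\<^sup>2 * indicator {t. R < norm t} t))"
        using \<kappa> c20 r0 by (auto simp: indicator_def field_simps)
      finally show "v\<^sub>1 u * v\<^sub>0 u powr (real CARD('n) / 2) * (v\<^sub>0 t ^ (3 * N + CARD('n)) * (G (t + u) * ?B t))
         \<le> \<kappa> * (WG (t + u))\<^sup>2 * P t + (P (t + u) * (e\<^sup>2 / \<kappa> * indicator {t. norm t \<le> R} t)
       + (P (t + u) * (2 / \<kappa> * ((WG t)\<^sup>2 * indicator {t. R - r < norm t} t))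
       + P (t + u) * (c2 / \<kappa> * ((WG (t - s))\<^sup>2 * indicator {t. R < norm t} t))))"
        using P0[of "t + u"] by (simp only: distrib_left[symmetric] add.assoc) (auto intro: mult_left_mono)
    qed
    also have "\<dots> = ?T1 t +
       (?T2 t
       + (?T3 t
       + ?T4 t))"
      unfolding ennreal_indicator[symmetric] by (rule ennreal_majorant_expand) (use \<kappa> c20 P0 in auto)
    finally show ?thesis .
  qed
  \<comment> \<open>Translating \<open>t\<close> by \<open>s\<close> turns WG (t - s) into WG t and
    so removes the shift. The price is the larger region R - r < |t| and a factor from
    \<open>poly_weight\<close>.\<close>
  have sh: "(\<integral>\<^sup>+t. ?T4 t \<partial>lborel)
     \<le> (\<integral>\<^sup>+t. ?T5 t \<partial>lborel)"
  proof -
    have "(\<integral>\<^sup>+t. ?T4 t \<partial>lborel)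
       = (\<integral>\<^sup>+t. ennreal (P (t + s + u)) * (ennreal (c2 / \<kappa>) * (ennreal ((WG (t + s - s))\<^sup>2) * indicator {t. R < norm t} (t + s))) \<partial>lborel)"
      by (rule nn_integral_lborel_shift[symmetric, where f="\<lambda>t. ?T4 t"]) measurable
    also have "\<dots> \<le> (\<integral>\<^sup>+t. ?T5 t \<partial>lborel)"
    proof (rule nn_integral_mono)
      fix t :: "real^'n"
      have "P (t + s + u) \<le> P (t + u) * (1 + r) ^ (CARD('n) + 1)"
      proof -
        have "poly_weight (t + u) \<le> poly_weight (t + s + u) * poly_weight (- s)"
          using poly_weight_submult[of "t + s + u" "- s"] by (simp add: algebra_simps)
        also have "poly_weight (- s) \<le> (1 + r) ^ (CARD('n) + 1)"
          unfolding poly_weight_def using s by (simp add: power_mono del: power_Suc)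
        then have "poly_weight (t + s + u) * poly_weight (- s) \<le> poly_weight (t + s + u) * (1 + r) ^ (CARD('n) + 1)"
          using poly_weight_pos[of "t + s + u"] by (intro mult_left_mono) auto
        finally show ?thesis
          unfolding P_def using poly_weight_pos[of "t + u"] poly_weight_pos[of "t + s + u"] by (simp add: field_simps del: power_Suc)
      qed
      then have "ennreal (P (t + s + u)) * ennreal (c2 / \<kappa>) \<le> ennreal (P (t + u)) * ennreal (c2 * (1 + r) ^ (CARD('n) + 1) / \<kappa>)"
        using c20 \<kappa> P0 r0 by (subst (1 2) ennreal_mult[symmetric])
          (auto intro!: ennreal_leI divide_right_mono simp: mult_left_mono mult_ac simp del: power_Suc)
      moreover have "ennreal ((WG (t + s - s))\<^sup>2) * indicator {t. R < norm t} (t + s) \<le> ennreal ((WG t)\<^sup>2) * indicator {t. R - r < norm t} t"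
        using norm_triangle_ineq[of t s] s by (auto simp: indicator_def)
      ultimately show "ennreal (P (t + s + u)) * (ennreal (c2 / \<kappa>) * (ennreal ((WG (t + s - s))\<^sup>2) * indicator {t. R < norm t} (t + s)))
         \<le> ?T5 t"
        unfolding mult.assoc[symmetric, of "ennreal (P _)"] by (rule mult_mono) auto
    qed
    finally show ?thesis .
  qed
  have "ennreal (v\<^sub>1 u * v\<^sub>0 u powr (real CARD('n) / 2)) * (\<integral>\<^sup>+t. ennreal (v\<^sub>0 t ^ (3 * N + CARD('n)) * (G (t + u) * ?B t)) \<partial>lborel)
    = (\<integral>\<^sup>+t. ennreal (v\<^sub>1 u * v\<^sub>0 u powr (real CARD('n) / 2)) * ennreal (v\<^sub>0 t ^ (3 * N + CARD('n)) * (G (t + u) * ?B t)) \<partial>lborel)"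
    by (rule nn_integral_cmult[symmetric]) measurable
  also have "\<dots> \<le> (\<integral>\<^sup>+t. ?T1 t +
       (?T2 t
       + (?T3 t
       + ?T4 t)) \<partial>lborel)"
    by (rule nn_integral_mono) (rule pt)
  also have "\<dots> = (\<integral>\<^sup>+t. ?T1 t \<partial>lborel) +
       ((\<integral>\<^sup>+t. ?T2 t \<partial>lborel)
       + ((\<integral>\<^sup>+t. ?T3 t \<partial>lborel)
       + (\<integral>\<^sup>+t. ?T4 t \<partial>lborel)))"
    by (subst nn_integral_add, simp, simp, subst nn_integral_add, simp, simp, subst nn_integral_add) simp_all
  also have "\<dots> \<le> (\<integral>\<^sup>+t. ?T1 t \<partial>lborel) +
       ((\<integral>\<^sup>+t. ?T2 t \<partial>lborel)
       + ((\<integral>\<^sup>+t. ?T3 t \<partial>lborel)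
       + (\<integral>\<^sup>+t. ?T5 t \<partial>lborel)))"
    by (intro add_left_mono sh)
  also have "\<dots> = (\<integral>\<^sup>+t. ?T1 t \<partial>lborel) +
       (\<integral>\<^sup>+t. ?T2 t
       + (?T3 t
       + ?T5 t) \<partial>lborel)"
    by (subst nn_integral_add, simp, simp, subst nn_integral_add) simp_all
  also have "\<dots> = osc_majorant \<kappa> e R r (Mconst K Wr r) u"
  proof -
    have M: "ennreal (Mconst K Wr r / \<kappa>) = ennreal (2 / \<kappa>) + ennreal (c2 * (1 + r) ^ (CARD('n) + 1) / \<kappa>)"
      unfolding Mconst_def c2_def[symmetric] add_divide_distrib using \<kappa> c20 r0 by (intro ennreal_plus) auto
    show ?thesis unfolding osc_majorant_def M
      by (intro arg_cong2[where f="(+)"] refl nn_integral_cong) (simp_all add: P_def distrib_left distrib_right)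
  qed
  finally show ?thesis .
qed

end

section \<open>Oscillation of the warped system\<close>

context osc_setup begin

text \<open>The minimum in the coefficient makes this uniform in \<open>t\<close>, although |t| is
  unbounded.\<close>

lemma bracket_coeff_le:
  assumes "0 \<le> S" "S \<le> Sm" "\<bar>c\<bar> \<le> cm"
  shows "bracket_coeff S c t \<le> 2 ^ N * (1 + cm + cm * (2 + 2 ^ N * (2 * pi * Sm) * exp_const (2 * pi * Sm) N))"
proof -
  have e: "exp_const (2 * pi * S) N \<le> exp_const (2 * pi * Sm) N"
    using assms by (intro exp_const_mono) auto
  have "min 2 (2 * pi * S * norm t * v\<^sub>0 t) + 2 ^ N * (2 * pi * S) * exp_const (2 * pi * S) N
     \<le> 2 + 2 ^ N * (2 * pi * Sm) * exp_const (2 * pi * Sm) N"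
    using assms e exp_const_ge_1[of "2 * pi * S" N] by (intro add_mono mult_mono) auto
  moreover have "0 \<le> min 2 (2 * pi * S * norm t * v\<^sub>0 t) + 2 ^ N * (2 * pi * S) * exp_const (2 * pi * S) N"
    using assms v0_pos[of t] exp_const_ge_1[of "2 * pi * S" N] by (intro add_nonneg_nonneg mult_nonneg_nonneg) auto
  ultimately have "\<bar>c\<bar> * (min 2 (2 * pi * S * norm t * v\<^sub>0 t) + 2 ^ N * (2 * pi * S) * exp_const (2 * pi * S) N)
     \<le> cm * (2 + 2 ^ N * (2 * pi * Sm) * exp_const (2 * pi * Sm) N)"
    using assms by (intro mult_mono) auto
  then show ?thesis
    unfolding bracket_coeff_def using assms by (intro mult_left_mono add_mono) auto
qed

text \<open>The left-hand side is jointly continuous and vanishes at s = 0, S = 0, c = 1 for every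
  \<open>t\<close>; uniform continuity on a compact set makes this uniform over the ball of radius
  \<open>R\<close>. This is where the continuity of the derivatives of \<theta> enters.\<close>

lemma bracket_bound_small:
  assumes e: "0 < e"
  shows "\<exists>\<eta>>0. \<forall>s S c t. norm s \<le> \<eta> \<longrightarrow> 0 \<le> S \<longrightarrow> S \<le> \<eta> \<longrightarrow> \<bar>1 - c\<bar> \<le> \<eta> \<longrightarrow> norm t \<le> R \<longrightarrow> W t * bracket_bound S c s t \<le> e"
proof -
  define f where "f x = (case x of (s, S, c, t) \<Rightarrow> W t * bracket_bound S c s t)" for x :: "(real^'n) \<times> real \<times> real \<times> (real^'n)"
  have c1: "continuous_on UNIV (\<lambda>x :: (real^'n) \<times> real \<times> real \<times> (real^'n). g (snd (snd (snd x)) - fst x))"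
    "continuous_on UNIV (\<lambda>x :: (real^'n) \<times> real \<times> real \<times> (real^'n). g (snd (snd (snd x))))"
    if "continuous_on UNIV g" for g :: "real^'n \<Rightarrow> 'b::real_normed_vector"
    by (safe intro!: continuous_on_compose2[OF that] continuous_intros) auto
  have cf: "continuous_on UNIV f"
    unfolding f_def[abs_def] case_prod_beta bracket_bound_def bracket_coeff_def Gdiff_def
    by (intro continuous_intros continuous_exp_const c1 thetad_cont W_cont G_cont v0_cont) auto
  define Kc where "Kc = (cball 0 1 :: (real^'n) set) \<times> {0..1::real} \<times> {0..2::real} \<times> (cball 0 R :: (real^'n) set)"
  have "compact Kc" unfolding Kc_def by (intro compact_Times compact_cball compact_Icc)
  then have "uniformly_continuous_on Kc f"
    by (intro compact_uniformly_continuous continuous_on_subset[OF cf]) auto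
  then obtain d where d: "0 < d" "\<And>x x'. x \<in> Kc \<Longrightarrow> x' \<in> Kc \<Longrightarrow> dist x' x < d \<Longrightarrow> dist (f x') (f x) < e"
    unfolding uniformly_continuous_on_def using e by metis
  \<comment> \<open>Three coordinates move by at most \<eta> each, so 3 \<eta> < d is the
    requirement; \<eta> \<le> 1 keeps the point in \<open>Kc\<close>.\<close>
  define \<eta> where "\<eta> = min 1 (d / 4)"
  have \<eta>: "0 < \<eta>" "\<eta> \<le> 1" "3 * \<eta> < d" using d(1) by (auto simp: \<eta>_def)
  show ?thesis
  proof (intro exI[of _ \<eta>] conjI allI impI \<eta>(1))
    fix s t :: "real^'n" and S c :: real
    assume a: "norm s \<le> \<eta>" "0 \<le> S" "S \<le> \<eta>" "\<bar>1 - c\<bar> \<le> \<eta>" "norm t \<le> R"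
    have k: "(s, S, c, t) \<in> Kc" "(0, 0, 1, t) \<in> Kc"
      using a \<eta> by (auto simp: Kc_def)
    have "dist (s, S, c, t) (0, 0, 1, t) \<le> dist s 0 + dist (S, c, t) (0, 1, t)"
      unfolding dist_Pair_Pair[of s] by (rule sqrt_sum_squares_le_sum) auto
    also have "dist (S, c, t) (0, 1, t) \<le> dist S 0 + dist (c, t) (1, t)"
      unfolding dist_Pair_Pair[of S] by (rule sqrt_sum_squares_le_sum) auto
    also have "dist (c, t) (1, t) = \<bar>1 - c\<bar>" by (simp add: dist_Pair_Pair dist_real_def abs_minus_commute)
    finally have "dist (s, S, c, t) (0, 0, 1, t) \<le> 3 * \<eta>" using a by simp
    then have "dist (f (s, S, c, t)) (f (0, 0, 1, t)) < e" using \<eta>(3) by (intro d(2) k) simp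
    moreover have "f (0, 0, 1, t) = 0" by (simp add: f_def bracket_bound_def Gdiff_def bracket_coeff_def)
    ultimately have "f (s, S, c, t) < e" unfolding dist_real_def by linarith
    then show "W t * bracket_bound S c s t \<le> e" by (simp add: f_def)
  qed
qed

text \<open>Since N = p + (d + 1), the power p absorbs (1 + |x|)^p by way of |x| \<le> R |A^T x|,
  and the rest is the integrable inverse of \<open>poly_weight\<close>. The linear substitution
  leaves 1 / w t0, which the Jacobian of the warping cancels later.\<close>

lemma decay_integral:
  "(\<integral>\<^sup>+x. ennreal ((1 + norm x) ^ p * inverse (1 + norm (transpose (A t0) *v x)) ^ N) \<partial>lborel)
    \<le> ennreal ((1 + \<bar>R\<^sub>\<Phi>\<bar>) ^ p) * (decay_mass * ennreal (inverse (w t0)))"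
proof -
  let ?C = "(1 + \<bar>R\<^sub>\<Phi>\<bar>) ^ p" let ?T = "transpose (A t0)"
  have pt: "(1 + norm x) ^ p * inverse (1 + norm (?T *v x)) ^ N \<le> ?C * inverse (poly_weight (?T *v x))" for x
  proof -
    define Y where "Y = 1 + norm (?T *v x)"
    have Y: "1 \<le> Y" by (simp add: Y_def)
    have "(1 + norm x) ^ p \<le> ?C * Y ^ p"
    proof (cases "p = 0")
      case False
      then have "norm x \<le> R\<^sub>\<Phi> * norm (?T *v x)" by (intro R_Phi) simp
      also have "\<dots> \<le> \<bar>R\<^sub>\<Phi>\<bar> * norm (?T *v x)" by (intro mult_right_mono) auto
      finally have "1 + norm x \<le> (1 + \<bar>R\<^sub>\<Phi>\<bar>) * Y" by (simp add: Y_def algebra_simps add_increasing)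
      then show ?thesis unfolding power_mult_distrib[symmetric] by (intro power_mono) auto
    qed simp
    then have "(1 + norm x) ^ p * inverse Y ^ N \<le> (?C * Y ^ p) * inverse Y ^ N"
      using Y by (intro mult_right_mono) auto
    also have "Y ^ p * inverse Y ^ N = inverse (poly_weight (?T *v x))"
    proof -
      have N: "N = p + (CARD('n) + 1)" by (simp add: N_eq)
      have one: "Y ^ p * inverse Y ^ p = 1" unfolding power_mult_distrib[symmetric] using Y by simp
      have "Y ^ p * inverse Y ^ N = (Y ^ p * inverse Y ^ p) * inverse Y ^ (CARD('n) + 1)"
        unfolding N by (simp only: power_add mult.assoc)
      then show ?thesis
        unfolding one poly_weight_def Y_def[symmetric] by (simp add: power_inverse del: power_Suc)
    qed
    then have "(?C * Y ^ p) * inverse Y ^ N = ?C * inverse (poly_weight (?T *v x))" by (simp only: mult.assoc)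
    finally show ?thesis by (simp add: Y_def)
  qed
  have meas: "(\<lambda>x::real^'n. ennreal (inverse (poly_weight x))) \<in> borel_measurable borel" by measurable
  have tr: "(\<integral>\<^sup>+x. ennreal (inverse (poly_weight (?T *v x))) \<partial>lborel) = decay_mass * ennreal (inverse (w t0))"
  proof -
    have I: "decay_mass = ennreal (w t0) * (\<integral>\<^sup>+x. ennreal (inverse (poly_weight (?T *v x))) \<partial>lborel)"
      unfolding decay_mass_def by (rule nn_integral_transpose[OF meas, symmetric])
    have "decay_mass * ennreal (inverse (w t0)) = (ennreal (inverse (w t0)) * ennreal (w t0)) * (\<integral>\<^sup>+x. ennreal (inverse (poly_weight (?T *v x))) \<partial>lborel)"
      by (simp only: I mult_ac)
    also have "ennreal (inverse (w t0)) * ennreal (w t0) = 1"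
      using w_pos[of t0] by (simp add: ennreal_mult[symmetric])
    finally show ?thesis by simp
  qed
  define f where "f = (\<lambda>x. ?T *v x)"
  have [measurable]: "f \<in> borel_measurable borel"
    unfolding f_def by (intro borel_measurable_continuous_onI linear_continuous_on) (rule matrix_vector_mul_bounded_linear)
  have "(\<integral>\<^sup>+x. ennreal ((1 + norm x) ^ p * inverse (1 + norm (?T *v x)) ^ N) \<partial>lborel)
    \<le> (\<integral>\<^sup>+x. ennreal ?C * ennreal (inverse (poly_weight (f x))) \<partial>lborel)"
  proof (rule nn_integral_mono)
    fix x
    show "ennreal ((1 + norm x) ^ p * inverse (1 + norm (?T *v x)) ^ N) \<le> ennreal ?C * ennreal (inverse (poly_weight (f x)))"
      using pt[of x] poly_weight_pos[of "f x"] unfolding f_def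
      by (subst ennreal_mult[symmetric]) (auto intro: ennreal_leI simp del: transpose_matrix_vector)
  qed
  also have "\<dots> = ennreal ?C * (\<integral>\<^sup>+x. ennreal (inverse (poly_weight (f x))) \<partial>lborel)"
    by (rule nn_integral_cmult) measurable
  finally show ?thesis unfolding f_def tr .
qed

text \<open>Coordinates of points in a common cell lie in one ball of radius \<delta>, whence 2
  \<delta>. The cell uses \<open>A\<close> at its centre, the estimate uses \<open>A\<close> at
  \<Phi>(\<eta>); \<phi> passes from one to the other with an argument of length at most \<delta>,
  and the unit vector \<open>a\<close> expresses the maximum of \<open>v\<^sub>0\<close> over such
  arguments.\<close>

lemma cover_neighbourhood_estimate:
  assumes \<delta>: "0 < \<delta>" and \<nu>: "\<nu> \<in> cover_neighbourhood (induced_cover D \<Phi> \<delta>) (z, \<eta>)" and a: "norm a = 1"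
  shows "snd \<nu> \<in> D" "norm (\<Phi> (snd \<nu>) - \<Phi> \<eta>) \<le> 2 * \<delta>"
    "norm (transpose (A (\<Phi> \<eta>)) *v (z - fst \<nu>)) \<le> 2 * \<delta> * v\<^sub>0 (\<delta> *\<^sub>R a)"
proof -
  obtain l k where m: "\<nu> \<in> induced_cover D \<Phi> \<delta> l k" "(z, \<eta>) \<in> induced_cover D \<Phi> \<delta> l k"
    using \<nu> by (auto simp: cover_neighbourhood_def)
  define \<kappa> where "\<kappa> = \<delta> *\<^sub>R (lattice_point k :: real^'n)"
  obtain x1 y1 where 1: "x1 \<in> ball (lattice_point l) 1" "y1 \<in> ball (lattice_point k) 1"
    "z = inv_transpose (A \<kappa>) *v (\<delta> *\<^sub>R x1)" "\<eta> = \<Theta> (\<delta> *\<^sub>R y1)"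
    using m(2) by (auto simp: induced_cover_def scaled_ball_def \<kappa>_def)
  obtain x2 y2 where 2: "x2 \<in> ball (lattice_point l) 1" "y2 \<in> ball (lattice_point k) 1"
    "fst \<nu> = inv_transpose (A \<kappa>) *v (\<delta> *\<^sub>R x2)" "snd \<nu> = \<Theta> (\<delta> *\<^sub>R y2)"
    using m(1) by (auto simp: induced_cover_def scaled_ball_def \<kappa>_def)
  show "snd \<nu> \<in> D" using 2 by simp
  have two: "dist u v < 2" if "u \<in> ball c 1" "v \<in> ball c 1" for u v c :: "real^'n"
    using that dist_triangle_less_add[of u c 1 v 1] by (simp add: dist_commute)
  have "norm (\<Phi> (snd \<nu>) - \<Phi> \<eta>) = \<delta> * dist y2 y1"
    using \<delta> by (simp add: 1 2 dist_norm scaleR_diff_right[symmetric] abs_of_pos)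
  also have "\<dots> \<le> \<delta> * 2" using two[OF 2(2) 1(2)] \<delta> by (intro mult_left_mono) auto
  finally show "norm (\<Phi> (snd \<nu>) - \<Phi> \<eta>) \<le> 2 * \<delta>" by simp
  have "transpose (A (\<Phi> \<eta>)) *v (z - fst \<nu>) = \<phi> \<kappa> (\<Phi> \<eta> - \<kappa>) *v (\<delta> *\<^sub>R (x1 - x2))"
    by (simp add: 1(3) 2(3) warp_phi_def matrix_vector_mult_diff_distrib[symmetric] matrix_vector_mul_assoc scaleR_diff_right
      del: transpose_matrix_vector)
  then have "norm (transpose (A (\<Phi> \<eta>)) *v (z - fst \<nu>)) \<le> v\<^sub>0 (\<Phi> \<eta> - \<kappa>) * norm (\<delta> *\<^sub>R (x1 - x2))"
    using phi_bound by metis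
  also have "\<dots> \<le> v\<^sub>0 (\<delta> *\<^sub>R a) * (\<delta> * 2)"
  proof (intro mult_mono)
    have "norm (\<Phi> \<eta> - \<kappa>) = \<delta> * dist (lattice_point k) y1"
      using \<delta> by (simp add: 1 \<kappa>_def dist_norm scaleR_diff_right[symmetric] norm_minus_commute abs_of_pos)
    also have "\<dots> \<le> \<delta> * 1" using 1(2) \<delta> by (intro mult_left_mono) auto
    finally show "v\<^sub>0 (\<Phi> \<eta> - \<kappa>) \<le> v\<^sub>0 (\<delta> *\<^sub>R a)" using \<delta> a by (intro v0_rad) simp
    show "norm (\<delta> *\<^sub>R (x1 - x2)) \<le> \<delta> * 2"
      using two[OF 1(1) 2(1)] \<delta> by (simp add: dist_norm)
  qed (use v0_pos[of "\<delta> *\<^sub>R a"] in auto)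
  finally show "norm (transpose (A (\<Phi> \<eta>)) *v (z - fst \<nu>)) \<le> 2 * \<delta> * v\<^sub>0 (\<delta> *\<^sub>R a)" by (simp add: mult_ac)
qed

section \<open>Warped windows, atoms and their inner products\<close>

definition window_coeff :: "real^'n \<Rightarrow> real" where "window_coeff x = w (\<Phi> x) powr (-1/2)"

text \<open>The substitution rule asks for a function that is Borel on the whole space, so \<Phi> is
  replaced by 0 outside \<open>D\<close>; multiplying by the indicator of \<open>D\<close> recovers
  the window.\<close>

definition window_ext :: "real^'n \<Rightarrow> real^'n \<Rightarrow> complex" where
  "window_ext \<omega> x = of_real (window_coeff \<omega>) * \<theta> (indicator D x *\<^sub>R \<Phi> x - \<Phi> \<omega>)"

lemma window_ext_borel [measurable]: "window_ext \<omega> \<in> borel_measurable borel"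
proof -
  have [measurable]: "\<theta> \<in> borel_measurable borel" by (intro borel_measurable_continuous_onI theta_cont)
  show ?thesis unfolding window_ext_def[abs_def] by measurable
qed

lemma warped_window_eq: "warped_window D \<Phi> \<theta> \<omega> = (\<lambda>x. indicator D x *\<^sub>R window_ext \<omega> x)"
  by (auto simp: warped_window_def window_ext_def window_coeff_def translate_def fun_eq_iff)

lemma window_ext_Theta: "window_ext \<omega> (\<Theta> t) = of_real (window_coeff \<omega>) * \<theta> (t - \<Phi> \<omega>)"
  by (simp add: window_ext_def)

lemma norm_theta_le_G: "norm (\<theta> t) \<le> G t"
  using symbol_est_norm[OF symbol_est_theta, of 0 t] by simp

lemma w_shift_bound: "w t \<le> det_const CARD('n) N * v\<^sub>0 (t - s) ^ CARD('n) * w s"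
  using w_ratio[of "t - s" s] by simp

text \<open>After the substitution, w t is at most a constant times \<open>v\<^sub>0\<close>^d
  w(\<Phi>(\<omega>)), with \<open>v\<^sub>0\<close> at t - \<Phi>(\<omega>). Both claims thus
  reduce to the integrability of \<open>v\<^sub>0\<close>^d G and \<open>v\<^sub>0\<close>^d G^2,
  and they are what \<open>parseval_bound\<close> asks for.\<close>

lemma warped_window_integrable: "integrable lborel (warped_window D \<Phi> \<theta> \<omega>)"
  and warped_window_square_integrable: "integrable lborel (\<lambda>x. (norm (warped_window D \<Phi> \<theta> \<omega> x))\<^sup>2)"
proof -
  let ?s = "\<Phi> \<omega>"
  have [measurable]: "\<theta> \<in> borel_measurable borel" by (intro borel_measurable_continuous_onI theta_cont)
  have shift: "integrable lborel (\<lambda>t. g (t - ?s))" if "integrable lborel g" for g :: "real^'n \<Rightarrow> real"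
    using lborel_integrable_affine[of 1 g "- ?s"] that by simp
  have 1: "integrable lborel (\<lambda>t. w t *\<^sub>R window_ext \<omega> (\<Theta> t))"
  proof (rule Bochner_Integration.integrable_bound)
    show "integrable lborel (\<lambda>t. (\<bar>window_coeff \<omega>\<bar> * det_const CARD('n) N * w ?s) * (v\<^sub>0 (t - ?s) ^ CARD('n) * G (t - ?s)))"
      by (intro integrable_mult_right shift[OF G_integrable])
    show "AE t in lborel. norm (w t *\<^sub>R window_ext \<omega> (\<Theta> t)) \<le> norm ((\<bar>window_coeff \<omega>\<bar> * det_const CARD('n) N * w ?s) * (v\<^sub>0 (t - ?s) ^ CARD('n) * G (t - ?s)))"
    proof (rule AE_I2)
      fix t
      have "norm (w t *\<^sub>R window_ext \<omega> (\<Theta> t)) = \<bar>window_coeff \<omega>\<bar> * (w t * norm (\<theta> (t - ?s)))"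
        using w_pos[of t] by (simp add: window_ext_Theta norm_mult)
      also have "\<dots> \<le> \<bar>window_coeff \<omega>\<bar> * ((det_const CARD('n) N * v\<^sub>0 (t - ?s) ^ CARD('n) * w ?s) * G (t - ?s))"
        using w_pos[of t] w_pos[of ?s] det_const_pos v0_pos[of "t - ?s"] w_shift_bound[of t ?s]
        by (intro mult_left_mono mult_mono norm_theta_le_G) (auto intro: less_imp_le)
      finally show "norm (w t *\<^sub>R window_ext \<omega> (\<Theta> t)) \<le> norm ((\<bar>window_coeff \<omega>\<bar> * det_const CARD('n) N * w ?s) * (v\<^sub>0 (t - ?s) ^ CARD('n) * G (t - ?s)))"
        by (simp add: mult_ac)
    qed
  qed measurable
  then show "integrable lborel (warped_window D \<Phi> \<theta> \<omega>)"
    unfolding warped_window_eq by (subst integrable_warp) auto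
  have 2: "integrable lborel (\<lambda>t. w t *\<^sub>R (norm (window_ext \<omega> (\<Theta> t)))\<^sup>2)"
  proof (rule Bochner_Integration.integrable_bound)
    show "integrable lborel (\<lambda>t. ((window_coeff \<omega>)\<^sup>2 * det_const CARD('n) N * w ?s) * (v\<^sub>0 (t - ?s) ^ CARD('n) * (G (t - ?s))\<^sup>2))"
      by (intro integrable_mult_right shift[OF G_square_integrable])
    show "AE t in lborel. norm (w t *\<^sub>R (norm (window_ext \<omega> (\<Theta> t)))\<^sup>2) \<le> norm (((window_coeff \<omega>)\<^sup>2 * det_const CARD('n) N * w ?s) * (v\<^sub>0 (t - ?s) ^ CARD('n) * (G (t - ?s))\<^sup>2))"
    proof (rule AE_I2)
      fix t
      have "norm (w t *\<^sub>R (norm (window_ext \<omega> (\<Theta> t)))\<^sup>2) = (window_coeff \<omega>)\<^sup>2 * (w t * (norm (\<theta> (t - ?s)))\<^sup>2)"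
        using w_pos[of t] by (simp add: window_ext_Theta norm_mult power_mult_distrib)
      also have "\<dots> \<le> (window_coeff \<omega>)\<^sup>2 * ((det_const CARD('n) N * v\<^sub>0 (t - ?s) ^ CARD('n) * w ?s) * (G (t - ?s))\<^sup>2)"
        using w_pos[of t] w_pos[of ?s] det_const_pos v0_pos[of "t - ?s"] w_shift_bound[of t ?s]
        by (intro mult_left_mono mult_mono power_mono norm_theta_le_G) (auto intro: less_imp_le)
      finally show "norm (w t *\<^sub>R (norm (window_ext \<omega> (\<Theta> t)))\<^sup>2) \<le> norm (((window_coeff \<omega>)\<^sup>2 * det_const CARD('n) N * w ?s) * (v\<^sub>0 (t - ?s) ^ CARD('n) * (G (t - ?s))\<^sup>2))"
        by (simp add: mult_ac)
    qed
  qed measurable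
  have e: "(\<lambda>x. (norm (warped_window D \<Phi> \<theta> \<omega> x))\<^sup>2) = (\<lambda>x. indicator D x *\<^sub>R (norm (window_ext \<omega> x))\<^sup>2)"
    unfolding warped_window_eq by (auto simp: fun_eq_iff indicator_def)
  show "integrable lborel (\<lambda>x. (norm (warped_window D \<Phi> \<theta> \<omega> x))\<^sup>2)"
    unfolding e by (subst integrable_warp) (use 2 in auto)
qed

lemma warped_window_borel [measurable]: "warped_window D \<Phi> \<theta> \<omega> \<in> borel_measurable borel"
  unfolding warped_window_eq by measurable

lemma warped_window_cont: "continuous_on D (warped_window D \<Phi> \<theta> \<omega>)"
proof -
  have "continuous_on D (\<lambda>x. of_real (window_coeff \<omega>) * \<theta> (\<Phi> x - \<Phi> \<omega>))"
    by (intro continuous_intros continuous_on_compose2[OF theta_cont] Phi_cont) auto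
  then show ?thesis
    by (rule continuous_on_eq) (auto simp: warped_window_def window_coeff_def translate_def)
qed

definition unit_char :: "real \<Rightarrow> complex" where "unit_char t = exp (\<i> * of_real (2 * pi * t))"

lemma unit_char_norm [simp]: "norm (unit_char t) = 1" unfolding unit_char_def by simp
lemma unit_char_add: "unit_char (s + t) = unit_char s * unit_char t" unfolding unit_char_def by (simp add: exp_add[symmetric] algebra_simps)
lemma unit_char_cnj: "cnj (unit_char t) = unit_char (- t)" unfolding unit_char_def by (simp add: exp_cnj)
lemma unit_char_cont: "continuous_on S f \<Longrightarrow> continuous_on S (\<lambda>x. unit_char (f x))"
  unfolding unit_char_def by (intro continuous_intros)
lemma unit_char_borel [measurable]: "unit_char \<in> borel_measurable borel"
  by (intro borel_measurable_continuous_onI unit_char_cont continuous_on_id)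

text \<open>The atom on the Fourier side, where translation has become modulation.\<close>

definition modulated_window :: "(real^'n) \<times> (real^'n) \<Rightarrow> real^'n \<Rightarrow> complex" where
  "modulated_window \<kappa> x = warped_window D \<Phi> \<theta> (snd \<kappa>) x * unit_char (- (fst \<kappa> \<bullet> x))"

lemma modulated_window_borel [measurable]: "modulated_window \<kappa> \<in> borel_measurable borel"
  unfolding modulated_window_def[abs_def] by measurable

lemma modulated_window_integrable: "integrable lborel (modulated_window \<kappa>)"
  by (rule Bochner_Integration.integrable_bound[OF warped_window_integrable[of "snd \<kappa>"]])
     (auto simp: modulated_window_def norm_mult)

lemma modulated_window_square_integrable: "integrable lborel (\<lambda>x. (norm (modulated_window \<kappa> x))\<^sup>2)"
  using warped_window_square_integrable by (simp add: modulated_window_def norm_mult)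

lemma warped_atom_eq: "warped_atom D \<Phi> \<theta> \<kappa> = inv_fourier (modulated_window \<kappa>)"
proof -
  obtain y \<omega> where \<kappa>: "\<kappa> = (y, \<omega>)" by (cases \<kappa>)
  have "exp (2 * of_real pi * \<i> * of_real ((x - y) \<bullet> t)) = unit_char (- (y \<bullet> t)) * exp (2 * of_real pi * \<i> * of_real (x \<bullet> t))" for x t :: "real^'n"
    unfolding unit_char_def by (simp add: exp_add[symmetric] algebra_simps inner_diff_left)
  then show ?thesis
    unfolding \<kappa> warped_atom_def inv_fourier_def translate_def modulated_window_def by (simp add: fun_eq_iff mult.assoc)
qed

text \<open>After the substitution centred at t0 = \<Phi>(\<eta>), the atoms at the two nearby
  points differ by the shift \<open>s\<close>, the ratio \<open>c\<close> and the phase (z - z')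
  \<bullet> (\<Theta>(t + t0) - \<Theta> t0). The factor \<Gamma> supplies the term with \<Theta> t0
  = \<eta>, so the phase vanishes at t = 0; without it the phase could be large for large \<eta>,
  however fine the covering.\<close>

lemma atom_inner_bound:
  fixes y \<omega> z \<eta> z' \<eta>' :: "real^'n"
  assumes mem: "\<omega> \<in> D" "\<eta> \<in> D" "\<eta>' \<in> D"
  defines "t0 \<equiv> \<Phi> \<eta>" and "s \<equiv> \<Phi> \<eta>' - \<Phi> \<eta>"
  defines "u \<equiv> t0 - \<Phi> \<omega>" and "S \<equiv> norm (transpose (A t0) *v (z - z'))" and "c \<equiv> sqrt (w t0 / w (t0 + s))"
  assumes int: "integrable lborel (\<lambda>t. v\<^sub>0 t ^ (3 * N + CARD('n)) * (G (t + u) * bracket_bound S c s t))"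
  shows "cmod (L2_inner (warped_atom D \<Phi> \<theta> (y, \<omega>))
            (\<lambda>x. warped_atom D \<Phi> \<theta> (z, \<eta>) x - exp (- 2 * of_real pi * \<i> * of_real ((z - z') \<bullet> \<eta>)) * warped_atom D \<Phi> \<theta> (z', \<eta>') x))
     \<le> sqrt (w t0 / w (\<Phi> \<omega>)) * (osc_const * inverse (1 + norm (transpose (A t0) *v (z - y))) ^ N *
          (LINT t|lborel. v\<^sub>0 t ^ (3 * N + CARD('n)) * (G (t + u) * bracket_bound S c s t)))"
proof -
  define \<Gamma> where "\<Gamma> = unit_char (- ((z - z') \<bullet> \<eta>))"
  have \<Gamma>: "exp (- 2 * of_real pi * \<i> * of_real ((z - z') \<bullet> \<eta>)) = \<Gamma>"
    unfolding \<Gamma>_def unit_char_def by (simp add: mult_ac)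
  define f where "f = modulated_window (y, \<omega>)"
  define h where "h x = modulated_window (z, \<eta>) x - \<Gamma> * modulated_window (z', \<eta>') x" for x
  have hb [measurable]: "h \<in> borel_measurable borel" unfolding h_def[abs_def] by measurable
  have fb [measurable]: "f \<in> borel_measurable borel" unfolding f_def by measurable
  have hi: "integrable lborel h" unfolding h_def using modulated_window_integrable by simp
  have h2: "integrable lborel (\<lambda>x. (norm (h x))\<^sup>2)"
  proof (rule Bochner_Integration.integrable_bound)
    show "integrable lborel (\<lambda>x. 2 * (norm (modulated_window (z, \<eta>) x))\<^sup>2 + 2 * (norm (modulated_window (z', \<eta>') x))\<^sup>2)"
      using modulated_window_square_integrable by simp
    show "AE x in lborel. norm ((norm (h x))\<^sup>2) \<le> norm (2 * (norm (modulated_window (z, \<eta>) x))\<^sup>2 + 2 * (norm (modulated_window (z', \<eta>') x))\<^sup>2)"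
    proof (rule AE_I2)
      fix x
      have "norm (h x) \<le> norm (modulated_window (z, \<eta>) x) + norm (modulated_window (z', \<eta>') x)"
        unfolding h_def using norm_triangle_ineq4[of "modulated_window (z, \<eta>) x" "\<Gamma> * modulated_window (z', \<eta>') x"] by (simp add: norm_mult \<Gamma>_def)
      then have "(norm (h x))\<^sup>2 \<le> (norm (modulated_window (z, \<eta>) x) + norm (modulated_window (z', \<eta>') x))\<^sup>2" by (intro power_mono) auto
      also have "\<dots> \<le> 2 * (norm (modulated_window (z, \<eta>) x))\<^sup>2 + 2 * (norm (modulated_window (z', \<eta>') x))\<^sup>2"
        using sum_squares_bound[of "norm (modulated_window (z, \<eta>) x)" "norm (modulated_window (z', \<eta>') x)"] by (simp add: power2_sum)
      finally show "norm ((norm (h x))\<^sup>2) \<le> norm (2 * (norm (modulated_window (z, \<eta>) x))\<^sup>2 + 2 * (norm (modulated_window (z', \<eta>') x))\<^sup>2)" by simp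
    qed
  qed measurable
  have hc: "continuous_on D h"
    unfolding h_def modulated_window_def fst_conv snd_conv by (intro continuous_intros unit_char_cont warped_window_cont)
  have hinv: "(\<lambda>x. warped_atom D \<Phi> \<theta> (z, \<eta>) x - \<Gamma> * warped_atom D \<Phi> \<theta> (z', \<eta>') x) = inv_fourier h"
  proof
    fix x :: "real^'n"
    let ?e = "\<lambda>t. exp (2 * of_real pi * \<i> * of_real (x \<bullet> t))"
    have i: "integrable lborel (\<lambda>t. modulated_window \<kappa> t * ?e t)" for \<kappa>
      by (rule Bochner_Integration.integrable_bound[OF modulated_window_integrable[of \<kappa>]]) (auto simp: norm_mult)
    have "inv_fourier h x = (LINT t|lborel. modulated_window (z, \<eta>) t * ?e t - \<Gamma> * (modulated_window (z', \<eta>') t * ?e t))"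
      unfolding inv_fourier_lborel[OF hb] h_def by (simp add: algebra_simps)
    also have "\<dots> = (LINT t|lborel. modulated_window (z, \<eta>) t * ?e t) - \<Gamma> * (LINT t|lborel. modulated_window (z', \<eta>') t * ?e t)"
      using i by simp
    finally show "warped_atom D \<Phi> \<theta> (z, \<eta>) x - \<Gamma> * warped_atom D \<Phi> \<theta> (z', \<eta>') x = inv_fourier h x"
      by (simp add: warped_atom_eq inv_fourier_lborel)
  qed
  have "cmod (L2_inner (inv_fourier f) (inv_fourier h)) \<le> cmod (LINT x|lborel. f x * cnj (h x))"
  proof (rule parseval_bound[OF openD hc _ _ _ hi h2])
    show "f x = 0" if "x \<notin> D" for x using that by (simp add: f_def modulated_window_def warped_window_def)
  qed (simp_all add: f_def modulated_window_integrable modulated_window_square_integrable)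
  also have "(LINT x|lborel. f x * cnj (h x)) = of_real (sqrt (w t0 / w (\<Phi> \<omega>))) *
     (LINT t|lborel. of_real (det (\<phi> t0 t)) * \<theta> (t + u) *
       cnj (\<theta> t - of_real c * exp (\<i> * of_real (2 * pi * ((z - z') \<bullet> \<Theta> (t + t0) - (z - z') \<bullet> \<Theta> t0))) * \<theta> (t - s)) *
       exp (\<i> * of_real (2 * pi * ((z - y) \<bullet> \<Theta> (t + t0)))))"
  proof -
    define F where "F x = (window_ext \<omega> x * unit_char (- (y \<bullet> x))) * cnj (window_ext \<eta> x * unit_char (- (z \<bullet> x)) - \<Gamma> * (window_ext \<eta>' x * unit_char (- (z' \<bullet> x))))" for x
    have [measurable]: "cnj \<in> borel_measurable borel" by (intro borel_measurable_continuous_onI continuous_intros)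
    have Fb[measurable]: "F \<in> borel_measurable borel" unfolding F_def[abs_def] by measurable
    have "f x * cnj (h x) = indicator D x *\<^sub>R F x" for x
      unfolding f_def h_def modulated_window_def F_def warped_window_eq by (simp add: indicator_def)
    then have "(LINT x|lborel. f x * cnj (h x)) = (LINT t|lborel. w t *\<^sub>R F (\<Theta> t))"
      using integral_warp[OF Fb] by simp
    also have "\<dots> = (LINT t|lborel. w (t0 + t) *\<^sub>R F (\<Theta> (t0 + t)))"
      using lborel_integral_affine[of 1 "\<lambda>t. w t *\<^sub>R F (\<Theta> t)" t0] by simp
    also have "\<dots> = (LINT t|lborel. of_real (sqrt (w t0 / w (\<Phi> \<omega>))) * (of_real (det (\<phi> t0 t)) * \<theta> (t + u) *
       cnj (\<theta> t - of_real c * exp (\<i> * of_real (2 * pi * ((z - z') \<bullet> \<Theta> (t + t0) - (z - z') \<bullet> \<Theta> t0))) * \<theta> (t - s)) *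
       exp (\<i> * of_real (2 * pi * ((z - y) \<bullet> \<Theta> (t + t0))))))"
    proof (intro Bochner_Integration.integral_cong refl)
      fix t
      let ?x = "\<Theta> (t + t0)"
      have \<eta>: "\<Theta> t0 = \<eta>" using mem by (simp add: t0_def)
      have sq: "window_coeff x = 1 / sqrt (w (\<Phi> x))" for x
        using w_pos[of "\<Phi> x"] by (simp add: window_coeff_def powr_minus powr_half_sqrt inverse_eq_divide flip: minus_divide_left)
      have t0s: "\<Phi> \<eta>' = t0 + s" by (simp add: t0_def s_def)
      \<comment> \<open>Takes out the modulation by \<open>z\<close> and the normalisation of the
        atom at \<eta>, which leaves the bracket of \<open>symbol_est_bracket\<close>.\<close>
      have br: "window_ext \<eta> ?x * unit_char (- (z \<bullet> ?x)) - \<Gamma> * (window_ext \<eta>' ?x * unit_char (- (z' \<bullet> ?x)))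
         = of_real (1 / sqrt (w t0)) * unit_char (- (z \<bullet> ?x)) * (\<theta> t - of_real c * unit_char ((z - z') \<bullet> ?x - (z - z') \<bullet> \<eta>) * \<theta> (t - s))"
      proof -
        have "\<Gamma> * unit_char (- (z' \<bullet> ?x)) = unit_char (- (z \<bullet> ?x)) * unit_char ((z - z') \<bullet> ?x - (z - z') \<bullet> \<eta>)"
          unfolding \<Gamma>_def unit_char_add[symmetric] by (simp add: inner_diff_left)
        moreover have "1 / sqrt (w (t0 + s)) = 1 / sqrt (w t0) * c"
          using w_pos[of t0] by (simp add: c_def real_sqrt_divide)
        moreover have "window_ext \<eta> ?x = of_real (1 / sqrt (w t0)) * \<theta> t"
          by (simp add: window_ext_Theta sq t0_def)
        moreover have "window_ext \<eta>' ?x = of_real (1 / sqrt (w (t0 + s))) * \<theta> (t - s)"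
          by (simp only: window_ext_Theta sq t0s) simp
        ultimately show ?thesis by (simp add: algebra_simps)
      qed
      have "w (t0 + t) *\<^sub>R F (\<Theta> (t0 + t)) = of_real (w (t + t0)) * (of_real (1 / sqrt (w (\<Phi> \<omega>))) * \<theta> (t + u) * unit_char (- (y \<bullet> ?x)) *
          cnj (of_real (1 / sqrt (w t0)) * unit_char (- (z \<bullet> ?x)) * (\<theta> t - of_real c * unit_char ((z - z') \<bullet> ?x - (z - z') \<bullet> \<eta>) * \<theta> (t - s))))"
        unfolding F_def add.commute[of t0 t] br by (simp add: window_ext_Theta sq scaleR_conv_of_real u_def algebra_simps)
      also have "\<dots> = (of_real (w (t + t0)) * of_real (1 / sqrt (w (\<Phi> \<omega>))) * of_real (1 / sqrt (w t0))) * \<theta> (t + u) *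
          cnj (\<theta> t - of_real c * unit_char ((z - z') \<bullet> ?x - (z - z') \<bullet> \<eta>) * \<theta> (t - s)) * (unit_char (- (y \<bullet> ?x)) * unit_char (z \<bullet> ?x))"
        by (simp add: unit_char_cnj)
      also have "of_real (w (t + t0)) * of_real (1 / sqrt (w (\<Phi> \<omega>))) * complex_of_real (1 / sqrt (w t0)) = of_real (sqrt (w t0 / w (\<Phi> \<omega>))) * of_real (det (\<phi> t0 t))"
      proof -
        have "w (t + t0) * (1 / sqrt (w (\<Phi> \<omega>))) * (1 / sqrt (w t0)) = sqrt (w t0 / w (\<Phi> \<omega>)) * det (\<phi> t0 t)"
          using w_pos[of t0] w_pos[of "\<Phi> \<omega>"] by (simp add: det_phi real_sqrt_divide field_simps)
        then show ?thesis by (simp only: of_real_mult[symmetric])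
      qed
      also have "unit_char (- (y \<bullet> ?x)) * unit_char (z \<bullet> ?x) = unit_char ((z - y) \<bullet> ?x)"
        unfolding unit_char_add[symmetric] by (simp add: inner_diff_left)
      finally show "w (t0 + t) *\<^sub>R F (\<Theta> (t0 + t)) = of_real (sqrt (w t0 / w (\<Phi> \<omega>))) * (of_real (det (\<phi> t0 t)) * \<theta> (t + u) *
       cnj (\<theta> t - of_real c * exp (\<i> * of_real (2 * pi * ((z - z') \<bullet> \<Theta> (t + t0) - (z - z') \<bullet> \<Theta> t0))) * \<theta> (t - s)) *
       exp (\<i> * of_real (2 * pi * ((z - y) \<bullet> \<Theta> (t + t0)))))"
        unfolding unit_char_def \<eta> by (simp only: mult.assoc)
    qed
    finally show ?thesis by simp
  qed
  also have "cmod \<dots> \<le> sqrt (w t0 / w (\<Phi> \<omega>)) * (osc_const * inverse (1 + norm (transpose (A t0) *v (z - y))) ^ N *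
          (LINT t|lborel. v\<^sub>0 t ^ (3 * N + CARD('n)) * (G (t + u) * bracket_bound S c s t)))"
  proof -
    have "0 \<le> sqrt (w t0 / w (\<Phi> \<omega>))" using w_pos[of t0] w_pos[of "\<Phi> \<omega>"] by simp
    then show ?thesis
      unfolding norm_mult norm_of_real S_def using int[unfolded S_def]
      by (simp only: abs_of_nonneg) (intro mult_left_mono osc_integral_bound, auto)
  qed
  finally show ?thesis unfolding \<Gamma> hinv unfolding warped_atom_eq f_def .
qed

end

section \<open>From pointwise bounds to the kernel norm\<close>

lemma ess_sup_le: "(\<And>x. x \<in> space M \<Longrightarrow> f x \<le> c) \<Longrightarrow> ess_sup M f \<le> c"
  unfolding ess_sup_def by (intro Inf_lower) auto

lemma A1_norm_le:
  "(\<And>x. x \<in> space M \<Longrightarrow> (\<integral>\<^sup>+y. L x y \<partial>M) \<le> c) \<Longrightarrow> (\<And>y. y \<in> space M \<Longrightarrow> (\<integral>\<^sup>+x. L x y \<partial>M) \<le> c) \<Longrightarrow> A1_norm M L \<le> c"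
  unfolding A1_norm_def by (intro max.boundedI ess_sup_le)

context osc_setup begin

definition osc_gamma :: "'n phase \<Rightarrow> 'n phase \<Rightarrow> complex" where
  "osc_gamma = (\<lambda>(y, \<omega>) (z, \<eta>). exp (- 2 * of_real pi * \<i> * of_real ((y - z) \<bullet> \<omega>)))"

text \<open>\<open>axis undefined 1\<close> is some unit vector; \<open>v\<^sub>0\<close> depends on
  the length of its argument alone, so any other would give the same value.\<close>

definition cover_diam :: "real \<Rightarrow> real" where
  "cover_diam \<delta> = 2 * \<delta> * v\<^sub>0 (\<delta> *\<^sub>R axis undefined 1)"

text \<open>The quantified \<open>s\<close> and \<open>S\<close> range over all shifts and phase
  sizes that points of a common cell can produce, uniformly in \<open>t0\<close>, so the bounds
  apply to each point below the supremum.\<close>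

definition admissible_bounds :: "real \<Rightarrow> real \<Rightarrow> real \<Rightarrow> real \<Rightarrow> real \<Rightarrow> bool" where
  "admissible_bounds \<delta> Wr K R e \<longleftrightarrow> (\<forall>t0 s S. norm s \<le> 2 * \<delta> \<longrightarrow> 0 \<le> S \<longrightarrow> S \<le> cover_diam \<delta> \<longrightarrow>
     W s \<le> Wr \<and> (\<forall>t. bracket_coeff S (sqrt (w t0 / w (t0 + s))) t \<le> K) \<and>
     (\<forall>t. norm t \<le> R \<longrightarrow> W t * bracket_bound S (sqrt (w t0 / w (t0 + s))) s t \<le> e))"

lemma osc_const_nonneg: "0 \<le> osc_const"
  unfolding osc_const_def phase_bound_def
  using det_const_pos[of "CARD('n)" N] phase_const_nonneg inverse_const_ge_1 order_trans[OF zero_le_one]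
  by (intro mult_nonneg_nonneg add_nonneg_nonneg) (auto intro: less_imp_le)

lemma osc_pointwise_bound:
  assumes \<delta>: "0 < \<delta>" and ab: "admissible_bounds \<delta> Wr K R e" and \<kappa>: "0 < \<kappa>"
    and mem: "\<omega> \<in> D" "\<eta> \<in> D"
  defines "t0 \<equiv> \<Phi> \<eta>" and "u \<equiv> \<Phi> \<eta> - \<Phi> \<omega>"
  shows "ennreal (v\<^sub>1 u * v\<^sub>0 u powr (real CARD('n) / 2)) * osc D \<Phi> \<theta> (induced_cover D \<Phi> \<delta>) osc_gamma (y, \<omega>) (z, \<eta>)
     \<le> ennreal (sqrt (w t0 / w (\<Phi> \<omega>)) * osc_const * inverse (1 + norm (transpose (A t0) *v (z - y))) ^ N)
       * osc_majorant \<kappa> e R (2 * \<delta>) (Mconst K Wr (2 * \<delta>)) u"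
    (is "ennreal ?v * _ \<le> ennreal ?c * ?H")
proof -
  have c0: "0 \<le> ?c" using w_pos[of t0] w_pos[of "\<Phi> \<omega>"] osc_const_nonneg by simp
  have v0: "0 < ?v" using v1_pos[of u] v0_pos[of u] by simp
  have iv: "0 \<le> inverse ?v" by (rule inverse_nonnegative_iff_nonnegative[THEN iffD2, OF less_imp_le[OF v0]])
  \<comment> \<open>The supremum is to be bounded by a quantity free of \<nu>, so the positive
    factor on the left is first moved to the right.\<close>
  have "osc D \<Phi> \<theta> (induced_cover D \<Phi> \<delta>) osc_gamma (y, \<omega>) (z, \<eta>) \<le> ennreal (inverse ?v) * (ennreal ?c * ?H)"
    unfolding osc_def
  proof (rule SUP_least)
    fix \<nu> assume \<nu>: "\<nu> \<in> cover_neighbourhood (induced_cover D \<Phi> \<delta>) (z, \<eta>)"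
    obtain z' \<eta>' where \<nu>eq: "\<nu> = (z', \<eta>')" by (cases \<nu>)
    define s where "s = \<Phi> \<eta>' - \<Phi> \<eta>"
    define S where "S = norm (transpose (A t0) *v (z - z'))"
    define c where "c = sqrt (w t0 / w (t0 + s))"
    note cn = cover_neighbourhood_estimate[OF \<delta> \<nu>, of "axis undefined 1", unfolded \<nu>eq fst_conv snd_conv norm_axis_1]
    have \<eta>': "\<eta>' \<in> D" and s: "norm s \<le> 2 * \<delta>" and S: "0 \<le> S" "S \<le> cover_diam \<delta>"
      using cn by (simp_all only: s_def S_def t0_def cover_diam_def norm_ge_zero)
    have b: "W s \<le> Wr" "\<And>t. bracket_coeff S c t \<le> K" "\<And>t. norm t \<le> R \<Longrightarrow> W t * bracket_bound S c s t \<le> e"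
      using ab s S unfolding admissible_bounds_def c_def by blast+
    let ?g = "\<lambda>t. v\<^sub>0 t ^ (3 * N + CARD('n)) * (G (t + u) * bracket_bound S c s t)"
    have g0: "0 \<le> ?g t" for t
      using v0_pos[of t] G_nonneg[of "t + u"] bracket_bound_nonneg[OF S(1), of c s t] by (intro mult_nonneg_nonneg) auto
    have Hb: "ennreal ?v * (\<integral>\<^sup>+t. ennreal (?g t) \<partial>lborel) \<le> ?H"
      by (rule osc_majorant_bound[OF \<kappa> s b(1) S(1) b(2) b(3)])
    have Hf: "?H < \<infinity>" by (rule osc_majorant_fin)
    have fin: "(\<integral>\<^sup>+t. ennreal (?g t) \<partial>lborel) < \<infinity>"
    proof (rule ccontr)
      assume "\<not> ?thesis"
      then have "(\<integral>\<^sup>+t. ennreal (?g t) \<partial>lborel) = \<top>" by (simp add: less_top[symmetric])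
      then have "?H = \<top>" using Hb v0 by (simp add: ennreal_mult_top top.extremum_unique ennreal_eq_0_iff not_le)
      then show False using Hf by simp
    qed
    have int: "integrable lborel ?g"
      by (rule integrableI_nonneg) (use g0 fin in auto)
    have gI: "ennreal (LINT t|lborel. ?g t) = (\<integral>\<^sup>+t. ennreal (?g t) \<partial>lborel)"
      using int g0 by (simp add: nn_integral_eq_integral)
    have "cmod (L2_inner (warped_atom D \<Phi> \<theta> (y, \<omega>))
            (\<lambda>x. warped_atom D \<Phi> \<theta> (z, \<eta>) x - osc_gamma (z, \<eta>) \<nu> * warped_atom D \<Phi> \<theta> \<nu> x))
       \<le> sqrt (w t0 / w (\<Phi> \<omega>)) * (osc_const * inverse (1 + norm (transpose (A t0) *v (z - y))) ^ N * (LINT t|lborel. ?g t))"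
      using atom_inner_bound[OF mem \<eta>', where y=y and z=z and z'=z'] int
      unfolding \<nu>eq osc_gamma_def S_def c_def s_def t0_def u_def by simp
    also have "\<dots> = ?c * (LINT t|lborel. ?g t)" by simp
    finally have "ennreal (cmod (L2_inner (warped_atom D \<Phi> \<theta> (y, \<omega>))
            (\<lambda>x. warped_atom D \<Phi> \<theta> (z, \<eta>) x - osc_gamma (z, \<eta>) \<nu> * warped_atom D \<Phi> \<theta> \<nu> x)))
       \<le> ennreal (?c * (LINT t|lborel. ?g t))" by (rule ennreal_leI)
    also have "\<dots> = ennreal ?c * (\<integral>\<^sup>+t. ennreal (?g t) \<partial>lborel)"
      unfolding gI[symmetric] by (rule ennreal_mult'[OF c0])
    also have "\<dots> = ennreal ?c * ((ennreal (inverse ?v) * ennreal ?v) * (\<integral>\<^sup>+t. ennreal (?g t) \<partial>lborel))"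
    proof -
      have "ennreal (inverse ?v) * ennreal ?v = ennreal (inverse ?v * ?v)"
        by (rule ennreal_mult[OF iv less_imp_le[OF v0], symmetric])
      also have "inverse ?v * ?v = 1" using v0 by (intro left_inverse) linarith
      finally show ?thesis by simp
    qed
    also have "\<dots> = ennreal (inverse ?v) * (ennreal ?c * (ennreal ?v * (\<integral>\<^sup>+t. ennreal (?g t) \<partial>lborel)))"
      by (simp only: mult_ac)
    also have "\<dots> \<le> ennreal (inverse ?v) * (ennreal ?c * ?H)"
      by (intro mult_left_mono Hb) auto
    finally show "ennreal (cmod (L2_inner (warped_atom D \<Phi> \<theta> (y, \<omega>))
            (\<lambda>x. warped_atom D \<Phi> \<theta> (z, \<eta>) x - osc_gamma (z, \<eta>) \<nu> * warped_atom D \<Phi> \<theta> \<nu> x)))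
       \<le> ennreal (inverse ?v) * (ennreal ?c * ?H)" .
  qed
  then have "ennreal ?v * osc D \<Phi> \<theta> (induced_cover D \<Phi> \<delta>) osc_gamma (y, \<omega>) (z, \<eta>)
     \<le> ennreal ?v * (ennreal (inverse ?v) * (ennreal ?c * ?H))" by (intro mult_left_mono) auto
  also have "\<dots> = (ennreal ?v * ennreal (inverse ?v)) * (ennreal ?c * ?H)" by (simp only: mult.assoc)
  also have "ennreal ?v * ennreal (inverse ?v) = 1"
  proof -
    have "ennreal ?v * ennreal (inverse ?v) = ennreal (?v * inverse ?v)"
      by (rule ennreal_mult[OF less_imp_le[OF v0] iv, symmetric])
    also have "?v * inverse ?v = 1" using v0 by (intro right_inverse) linarith
    finally show ?thesis by simp
  qed
  finally show ?thesis by simp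
qed

definition Bconst :: ennreal where
  "Bconst = ennreal ((1 + \<bar>R\<^sub>\<Phi>\<bar>) ^ p) * decay_mass * ennreal (osc_const * sqrt (det_const CARD('n) N))"

lemma Bconst_fin: "Bconst < \<infinity>"
  unfolding Bconst_def using decay_mass_fin by (simp add: ennreal_mult_less_top)

lemma sqrt_w_ratio: "sqrt (w a / w b) \<le> sqrt (det_const CARD('n) N) * v\<^sub>0 (a - b) powr (real CARD('n) / 2)"
proof -
  have "w a / w b \<le> det_const CARD('n) N * v\<^sub>0 (a - b) ^ CARD('n)"
    using w_shift_bound[of a b] w_pos[of b] by (simp add: divide_le_eq)
  then have "sqrt (w a / w b) \<le> sqrt (det_const CARD('n) N * v\<^sub>0 (a - b) ^ CARD('n))" by simp
  also have "\<dots> = sqrt (det_const CARD('n) N) * sqrt (v\<^sub>0 (a - b) powr real CARD('n))"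
    using v0_pos[of "a - b"] by (simp add: real_sqrt_mult powr_realpow)
  also have "sqrt (v\<^sub>0 (a - b) powr real CARD('n)) = v\<^sub>0 (a - b) powr (real CARD('n) / 2)"
    using v0_pos[of "a - b"] by (simp add: powr_half_sqrt[symmetric] powr_powr)
  finally show ?thesis .
qed

text \<open>The outer norm integrates over either frequency, and the substitution in that variable
  produces its own factor \<open>w\<close>. Hence the inner norm is bounded twice, with 1 / w at
  \<Phi>(\<eta>) and at \<Phi>(\<omega>); the majorant depends on the difference alone, so both
  outer integrals give its total mass.\<close>

lemma Bm_norm_bound:
  assumes \<delta>: "0 < \<delta>" and ab: "admissible_bounds \<delta> Wr K R e" and \<kappa>: "0 < \<kappa>"
    and m: "\<And>y z \<xi> \<eta>. \<xi> \<in> D \<Longrightarrow> \<eta> \<in> D \<Longrightarrow> m (y, \<xi>) (z, \<eta>) \<le> (1 + norm (y - z)) ^ p * v\<^sub>1 (\<Phi> \<xi> - \<Phi> \<eta>)"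
  shows "Bm_norm D m (osc D \<Phi> \<theta> (induced_cover D \<Phi> \<delta>) osc_gamma)
     \<le> Bconst * (\<integral>\<^sup>+u. osc_majorant \<kappa> e R (2 * \<delta>) (Mconst K Wr (2 * \<delta>)) u \<partial>lborel)"
proof -
  let ?H = "osc_majorant \<kappa> e R (2 * \<delta>) (Mconst K Wr (2 * \<delta>))"
  let ?osc = "osc D \<Phi> \<theta> (induced_cover D \<Phi> \<delta>) osc_gamma"
  let ?C = "ennreal ((1 + \<bar>R\<^sub>\<Phi>\<bar>) ^ p)" and ?L = "sqrt (det_const CARD('n) N)"
  have inner: "A1_norm lebesgue (\<lambda>y z. ennreal (m (y, \<omega>) (z, \<eta>)) * ?osc (y, \<omega>) (z, \<eta>))
     \<le> Bconst * (ennreal (inverse (w (\<Phi> \<eta>))) * ?H (\<Phi> \<eta> - \<Phi> \<omega>))" (is ?th1)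
    and inner': "A1_norm lebesgue (\<lambda>y z. ennreal (m (y, \<omega>) (z, \<eta>)) * ?osc (y, \<omega>) (z, \<eta>))
     \<le> Bconst * (ennreal (inverse (w (\<Phi> \<omega>))) * ?H (\<Phi> \<eta> - \<Phi> \<omega>))" (is ?th2)
    if mem: "\<omega> \<in> D" "\<eta> \<in> D" for \<omega> \<eta>
  proof -
    define t0 where "t0 = \<Phi> \<eta>"
    define u where "u = \<Phi> \<eta> - \<Phi> \<omega>"
    define T where "T = (\<lambda>x::real^'n. transpose (A t0) *v x)"
    have [measurable]: "T \<in> borel_measurable borel"
      unfolding T_def by (intro borel_measurable_continuous_onI linear_continuous_on) (rule matrix_vector_mul_bounded_linear)
    define vh where "vh = v\<^sub>0 u powr (real CARD('n) / 2)"
    have vh: "0 < vh" using v0_pos[of u] by (simp add: vh_def)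
    define sq where "sq = sqrt (w t0 / w (\<Phi> \<omega>))"
    have sq: "0 \<le> sq" using w_pos[of t0] w_pos[of "\<Phi> \<omega>"] by (simp add: sq_def)
    define g where "g x = ennreal ((1 + norm x) ^ p * inverse (1 + norm (T x)) ^ N)" for x
    have [measurable]: "g \<in> borel_measurable borel" unfolding g_def[abs_def] by measurable
    define Y where "Y = ennreal (sq * osc_const * inverse vh) * ?H u"
    have v1u: "v\<^sub>1 (\<Phi> \<omega> - \<Phi> \<eta>) = v\<^sub>1 u" using v1_minus[of u] by (simp add: u_def)
    \<comment> \<open>Inserting \<open>vh\<close> prepares the use of
      \<open>osc_pointwise_bound\<close>; its inverse stays in \<open>Y\<close> and compensates the
      normalisation ratio \<open>sq\<close>.\<close>
    have pt: "ennreal (m (y, \<omega>) (z, \<eta>)) * ?osc (y, \<omega>) (z, \<eta>) \<le> g (z - y) * Y" for y z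
    proof -
      let ?P = "(1 + norm (z - y)) ^ p" and ?i = "inverse (1 + norm (T (z - y))) ^ N"
      have "ennreal (m (y, \<omega>) (z, \<eta>)) \<le> ennreal (?P * v\<^sub>1 u)"
        using m[OF mem, of y z] by (intro ennreal_leI) (simp add: v1u norm_minus_commute)
      also have "?P * v\<^sub>1 u = ?P * inverse vh * (v\<^sub>1 u * vh)" using vh by simp
      also have "ennreal \<dots> = ennreal (?P * inverse vh) * ennreal (v\<^sub>1 u * vh)"
        using vh v1_pos[of u] by (intro ennreal_mult) auto
      finally have "ennreal (m (y, \<omega>) (z, \<eta>)) * ?osc (y, \<omega>) (z, \<eta>)
         \<le> (ennreal (?P * inverse vh) * ennreal (v\<^sub>1 u * vh)) * ?osc (y, \<omega>) (z, \<eta>)" by (rule mult_right_mono) simp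
      also have "\<dots> = ennreal (?P * inverse vh) * (ennreal (v\<^sub>1 u * vh) * ?osc (y, \<omega>) (z, \<eta>))" by (simp only: mult.assoc)
      also have "\<dots> \<le> ennreal (?P * inverse vh) * (ennreal (sq * osc_const * ?i) * ?H u)"
        unfolding vh_def sq_def T_def t0_def u_def
        by (intro mult_left_mono osc_pointwise_bound[OF \<delta> ab \<kappa> mem]) simp
      also have "\<dots> = (ennreal (?P * inverse vh) * ennreal (sq * osc_const * ?i)) * ?H u" by (simp only: mult.assoc)
      also have "ennreal (?P * inverse vh) * ennreal (sq * osc_const * ?i) = ennreal ((?P * inverse vh) * (sq * osc_const * ?i))"
        using vh sq osc_const_nonneg by (intro ennreal_mult[symmetric]) auto
      also have "(?P * inverse vh) * (sq * osc_const * ?i) = (?P * ?i) * (sq * osc_const * inverse vh)" by (simp only: mult_ac)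
      also have "ennreal \<dots> = g (z - y) * ennreal (sq * osc_const * inverse vh)"
        unfolding g_def using vh sq osc_const_nonneg by (intro ennreal_mult) auto
      finally show ?thesis by (simp only: Y_def mult.assoc)
    qed
    have gint: "(\<integral>\<^sup>+x. g x \<partial>lborel) \<le> ?C * (decay_mass * ennreal (inverse (w t0)))"
      unfolding g_def T_def by (rule decay_integral)
    have "A1_norm lebesgue (\<lambda>y z. ennreal (m (y, \<omega>) (z, \<eta>)) * ?osc (y, \<omega>) (z, \<eta>)) \<le> (\<integral>\<^sup>+x. g x \<partial>lborel) * Y"
    proof (rule A1_norm_le)
      fix y :: "real^'n"
      have "(\<integral>\<^sup>+z. ennreal (m (y, \<omega>) (z, \<eta>)) * ?osc (y, \<omega>) (z, \<eta>) \<partial>lebesgue) \<le> (\<integral>\<^sup>+z. g (z + (- y)) * Y \<partial>lborel)"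
        unfolding nn_integral_completion using pt by (intro nn_integral_mono) simp
      also have "\<dots> = (\<integral>\<^sup>+x. g x * Y \<partial>lborel)"
        by (rule nn_integral_lborel_shift[where f="\<lambda>x. g x * Y"]) measurable
      also have "\<dots> = (\<integral>\<^sup>+x. g x \<partial>lborel) * Y" by (rule nn_integral_multc) measurable
      finally show "(\<integral>\<^sup>+z. ennreal (m (y, \<omega>) (z, \<eta>)) * ?osc (y, \<omega>) (z, \<eta>) \<partial>lebesgue) \<le> (\<integral>\<^sup>+x. g x \<partial>lborel) * Y" .
    next
      fix z :: "real^'n"
      have "(\<integral>\<^sup>+y. ennreal (m (y, \<omega>) (z, \<eta>)) * ?osc (y, \<omega>) (z, \<eta>) \<partial>lebesgue) \<le> (\<integral>\<^sup>+y. g (z - y) * Y \<partial>lborel)"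
        unfolding nn_integral_completion using pt by (intro nn_integral_mono) simp
      also have "\<dots> = (\<integral>\<^sup>+x. g x * Y \<partial>lborel)"
        by (rule nn_integral_lborel_reflect[where f="\<lambda>x. g x * Y"]) measurable
      also have "\<dots> = (\<integral>\<^sup>+x. g x \<partial>lborel) * Y" by (rule nn_integral_multc) measurable
      finally show "(\<integral>\<^sup>+y. ennreal (m (y, \<omega>) (z, \<eta>)) * ?osc (y, \<omega>) (z, \<eta>) \<partial>lebesgue) \<le> (\<integral>\<^sup>+x. g x \<partial>lborel) * Y" .
    qed
    also have "\<dots> \<le> (?C * (decay_mass * ennreal (inverse (w t0)))) * Y" by (intro mult_right_mono gint) simp
    also have "\<dots> = ?C * decay_mass * (ennreal (inverse (w t0)) * ennreal (sq * osc_const * inverse vh)) * ?H u"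
      unfolding Y_def by (simp only: mult.assoc)
    also have "ennreal (inverse (w t0)) * ennreal (sq * osc_const * inverse vh) = ennreal (inverse (w t0) * (sq * osc_const * inverse vh))"
      using w_pos[of t0] vh sq osc_const_nonneg by (intro ennreal_mult[symmetric]) auto
    finally have main: "A1_norm lebesgue (\<lambda>y z. ennreal (m (y, \<omega>) (z, \<eta>)) * ?osc (y, \<omega>) (z, \<eta>))
       \<le> ?C * decay_mass * ennreal (inverse (w t0) * (sq * osc_const * inverse vh)) * ?H u" .
    have L0: "0 \<le> osc_const * ?L" using osc_const_nonneg det_const_pos[of "CARD('n)" N] by simp
    \<comment> \<open>The two targets differ in the reciprocal weight \<open>r\<close> alone, so the
      common part is done once for a general \<open>r\<close>.\<close>
    have fin: "A1_norm lebesgue (\<lambda>y z. ennreal (m (y, \<omega>) (z, \<eta>)) * ?osc (y, \<omega>) (z, \<eta>)) \<le> Bconst * (ennreal r * ?H u)"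
      if r: "inverse (w t0) * (sq * osc_const * inverse vh) \<le> (osc_const * ?L) * r" "0 \<le> r" for r
    proof -
      have "ennreal (inverse (w t0) * (sq * osc_const * inverse vh)) \<le> ennreal (osc_const * ?L) * ennreal r"
        using r L0 by (subst ennreal_mult[symmetric]) (auto intro: ennreal_leI)
      then have "?C * decay_mass * ennreal (inverse (w t0) * (sq * osc_const * inverse vh)) * ?H u \<le> ?C * decay_mass * (ennreal (osc_const * ?L) * ennreal r) * ?H u"
        by (intro mult_right_mono mult_left_mono) auto
      then show ?thesis using main unfolding Bconst_def by (simp only: mult.assoc)
    qed
    have sq1: "sq \<le> ?L * vh"
      using sqrt_w_ratio[of t0 "\<Phi> \<omega>"] by (simp add: sq_def vh_def u_def t0_def)
    \<comment> \<open>The identity sqrt(a / b) / a = sqrt(b / a) / b exchanges the roles of the two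
      frequencies; \<open>v\<^sub>0\<close> being even, the reversed ratio obeys the same
      bound.\<close>
    have sq2: "inverse (w t0) * sq \<le> ?L * vh * inverse (w (\<Phi> \<omega>))"
    proof -
      have "sqrt (w (\<Phi> \<omega>) / w t0) \<le> ?L * vh"
        using sqrt_w_ratio[of "\<Phi> \<omega>" t0] v0_minus[of u] by (simp add: vh_def u_def t0_def)
      then have "sqrt (w (\<Phi> \<omega>) / w t0) * inverse (w (\<Phi> \<omega>)) \<le> ?L * vh * inverse (w (\<Phi> \<omega>))"
        using w_pos[of "\<Phi> \<omega>"] by (intro mult_right_mono) auto
      moreover have "inverse b * sqrt (b / a) = sqrt (a / b) * inverse a" if "0 < a" "0 < b" for a b :: real
        using that by (simp add: real_sqrt_divide field_simps)
      ultimately show ?thesis using w_pos unfolding sq_def by simp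
    qed
    have "A1_norm lebesgue (\<lambda>y z. ennreal (m (y, \<omega>) (z, \<eta>)) * ?osc (y, \<omega>) (z, \<eta>)) \<le> Bconst * (ennreal (inverse (w t0)) * ?H u)"
    proof (rule fin)
      have "sq * inverse vh \<le> ?L" using sq1 vh by (simp add: field_simps)
      then have "(inverse (w t0) * osc_const) * (sq * inverse vh) \<le> (inverse (w t0) * osc_const) * ?L"
        using w_pos[of t0] osc_const_nonneg by (intro mult_left_mono) auto
      then show "inverse (w t0) * (sq * osc_const * inverse vh) \<le> (osc_const * ?L) * inverse (w t0)" by (simp only: mult_ac)
    qed (use w_pos[of t0] in auto)
    then show ?th1 unfolding t0_def u_def .
    have "A1_norm lebesgue (\<lambda>y z. ennreal (m (y, \<omega>) (z, \<eta>)) * ?osc (y, \<omega>) (z, \<eta>)) \<le> Bconst * (ennreal (inverse (w (\<Phi> \<omega>))) * ?H u)"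
    proof (rule fin)
      have "(inverse (w t0) * sq) * (osc_const * inverse vh) \<le> (?L * vh * inverse (w (\<Phi> \<omega>))) * (osc_const * inverse vh)"
        using sq2 osc_const_nonneg vh by (intro mult_right_mono) auto
      also have "\<dots> = (osc_const * ?L) * inverse (w (\<Phi> \<omega>)) * (vh * inverse vh)" by (simp only: mult_ac)
      also have "vh * inverse vh = 1" using vh by simp
      finally show "inverse (w t0) * (sq * osc_const * inverse vh) \<le> (osc_const * ?L) * inverse (w (\<Phi> \<omega>))" by (simp add: mult_ac)
    qed (use w_pos[of "\<Phi> \<omega>"] in auto)
    then show ?th2 unfolding u_def .
  qed
  have wi: "ennreal (w t) * (ennreal (inverse (w t)) * x) = x" for t x
  proof -
    have "ennreal (w t) * ennreal (inverse (w t)) = 1" using w_pos[of t] by (simp add: ennreal_mult[symmetric])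
    then show ?thesis by (simp add: mult.assoc[symmetric])
  qed
  show ?thesis
    unfolding Bm_norm_def
  proof (rule A1_norm_le)
    fix \<omega> assume "\<omega> \<in> space (lebesgue_on D)"
    then have \<omega>: "\<omega> \<in> D" by simp
    let ?h = "\<lambda>t. Bconst * (ennreal (inverse (w t)) * ?H (t + (- \<Phi> \<omega>)))"
    have "(\<integral>\<^sup>+\<eta>. A1_norm lebesgue (\<lambda>y z. ennreal (m (y, \<omega>) (z, \<eta>)) * ?osc (y, \<omega>) (z, \<eta>)) \<partial>lebesgue_on D)
       \<le> (\<integral>\<^sup>+\<eta>. ?h (\<Phi> \<eta>) \<partial>lebesgue_on D)"
      using inner[OF \<omega>] by (intro nn_integral_mono) simp
    also have "\<dots> = (\<integral>\<^sup>+t. ennreal (w t) * ?h t \<partial>lborel)"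
      by (rule nn_integral_warp_lebesgue_on) measurable
    also have "\<dots> = (\<integral>\<^sup>+t. Bconst * ?H (t + (- \<Phi> \<omega>)) \<partial>lborel)"
      by (simp only: mult.left_commute[of _ Bconst] wi)
    also have "\<dots> = (\<integral>\<^sup>+t. Bconst * ?H t \<partial>lborel)"
      by (rule nn_integral_lborel_shift[where f="\<lambda>t. Bconst * ?H t"]) measurable
    also have "\<dots> = Bconst * (\<integral>\<^sup>+t. ?H t \<partial>lborel)" by (rule nn_integral_cmult) measurable
    finally show "(\<integral>\<^sup>+\<eta>. A1_norm lebesgue (\<lambda>y z. ennreal (m (y, \<omega>) (z, \<eta>)) * ?osc (y, \<omega>) (z, \<eta>)) \<partial>lebesgue_on D)
       \<le> Bconst * (\<integral>\<^sup>+t. ?H t \<partial>lborel)" .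
  next
    fix \<eta> assume "\<eta> \<in> space (lebesgue_on D)"
    then have \<eta>: "\<eta> \<in> D" by simp
    let ?h = "\<lambda>t. Bconst * (ennreal (inverse (w t)) * ?H (\<Phi> \<eta> - t))"
    have "(\<integral>\<^sup>+\<omega>. A1_norm lebesgue (\<lambda>y z. ennreal (m (y, \<omega>) (z, \<eta>)) * ?osc (y, \<omega>) (z, \<eta>)) \<partial>lebesgue_on D)
       \<le> (\<integral>\<^sup>+\<omega>. ?h (\<Phi> \<omega>) \<partial>lebesgue_on D)"
      using inner'[OF _ \<eta>] by (intro nn_integral_mono) simp
    also have "\<dots> = (\<integral>\<^sup>+t. ennreal (w t) * ?h t \<partial>lborel)"
      by (rule nn_integral_warp_lebesgue_on) measurable
    also have "\<dots> = (\<integral>\<^sup>+t. Bconst * ?H (\<Phi> \<eta> - t) \<partial>lborel)"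
      by (simp only: mult.left_commute[of _ Bconst] wi)
    also have "\<dots> = (\<integral>\<^sup>+t. Bconst * ?H t \<partial>lborel)"
      by (rule nn_integral_lborel_reflect[where f="\<lambda>t. Bconst * ?H t"]) measurable
    also have "\<dots> = Bconst * (\<integral>\<^sup>+t. ?H t \<partial>lborel)" by (rule nn_integral_cmult) measurable
    finally show "(\<integral>\<^sup>+\<omega>. A1_norm lebesgue (\<lambda>y z. ennreal (m (y, \<omega>) (z, \<eta>)) * ?osc (y, \<omega>) (z, \<eta>)) \<partial>lebesgue_on D)
       \<le> Bconst * (\<integral>\<^sup>+t. ?H t \<partial>lborel)" .
  qed
qed

end

section \<open>Choice of the constants and the limit\<close>

context osc_setup begin

lemma cover_diam_mono: "0 < \<delta> \<Longrightarrow> \<delta> \<le> \<delta>' \<Longrightarrow> cover_diam \<delta> \<le> cover_diam \<delta>'"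
  unfolding cover_diam_def using v0_pos[of "\<delta> *\<^sub>R axis undefined 1"] by (intro mult_mono v0_rad) auto

text \<open>One pair of constants serves all \<delta> up to \<delta>m, because in the limit they
  have to be fixed before \<delta> is chosen.\<close>

lemma uniform_constants:
  assumes \<delta>m: "0 < \<delta>m"
  shows "\<exists>Wr K. \<forall>\<delta>. 0 < \<delta> \<longrightarrow> \<delta> \<le> \<delta>m \<longrightarrow> (\<forall>t0 s S. norm s \<le> 2 * \<delta> \<longrightarrow> 0 \<le> S \<longrightarrow> S \<le> cover_diam \<delta> \<longrightarrow>
     W s \<le> Wr \<and> (\<forall>t. bracket_coeff S (sqrt (w t0 / w (t0 + s))) t \<le> K))"
proof -
  let ?a = "axis undefined 1 :: real^'n"
  define cm where "cm = sqrt (det_const CARD('n) N) * v\<^sub>0 ((2 * \<delta>m) *\<^sub>R ?a) powr (real CARD('n) / 2)"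
  have "compact (W ` cball 0 (2 * \<delta>m))"
    by (intro compact_continuous_image W_cont compact_cball)
  then have "bounded (W ` cball 0 (2 * \<delta>m))" by (rule compact_imp_bounded)
  then obtain Wr where "\<forall>x\<in>W ` cball 0 (2 * \<delta>m). norm x \<le> Wr" unfolding bounded_iff by blast
  then have Wr: "W s \<le> Wr" if "norm s \<le> 2 * \<delta>m" for s 
  proof -
    have "W s \<in> W ` cball 0 (2 * \<delta>m)" using that by auto
    with \<open>\<forall>x\<in>W ` cball 0 (2 * \<delta>m). norm x \<le> Wr\<close> have "norm (W s) \<le> Wr" by blast
    then show ?thesis by simp
  qed
  show ?thesis
  proof (intro exI allI impI conjI)
    fix \<delta> S :: real and t0 s t :: "real^'n" assume \<delta>: "0 < \<delta>" "\<delta> \<le> \<delta>m" and s: "norm s \<le> 2 * \<delta>" and S: "0 \<le> S" "S \<le> cover_diam \<delta>"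
    show "W s \<le> Wr" using s \<delta> by (intro Wr) simp
    have "sqrt (w t0 / w (t0 + s)) \<le> sqrt (det_const CARD('n) N) * v\<^sub>0 s powr (real CARD('n) / 2)"
      using sqrt_w_ratio[of t0 "t0 + s"] by (simp add: v0_minus)
    also have "\<dots> \<le> cm"
      unfolding cm_def using s \<delta> det_const_pos[of "CARD('n)" N] v0_pos[of s]
      by (intro mult_left_mono powr_mono2 v0_rad) auto
    finally have c: "\<bar>sqrt (w t0 / w (t0 + s))\<bar> \<le> cm" using w_pos[of t0] w_pos[of "t0 + s"] by simp
    have "S \<le> cover_diam \<delta>m" using S(2) cover_diam_mono[OF \<delta>] by simp
    from bracket_coeff_le[OF S(1) this c]
    show "bracket_coeff S (sqrt (w t0 / w (t0 + s))) t \<le> 2 ^ N * (1 + cm + cm * (2 + 2 ^ N * (2 * pi * cover_diam \<delta>m) * exp_const (2 * pi * cover_diam \<delta>m) N))" .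
  qed
qed

lemma Bm_norm_fin:
  assumes \<delta>: "0 < \<delta>"
    and m: "\<And>y z \<xi> \<eta>. \<xi> \<in> D \<Longrightarrow> \<eta> \<in> D \<Longrightarrow> m (y, \<xi>) (z, \<eta>) \<le> (1 + norm (y - z)) ^ p * v\<^sub>1 (\<Phi> \<xi> - \<Phi> \<eta>)"
  shows "Bm_norm D m (osc D \<Phi> \<theta> (induced_cover D \<Phi> \<delta>) osc_gamma) < \<infinity>"
proof -
  obtain Wr K where WK: "\<forall>t0 s S. norm s \<le> 2 * \<delta> \<longrightarrow> 0 \<le> S \<longrightarrow> S \<le> cover_diam \<delta> \<longrightarrow>
     W s \<le> Wr \<and> (\<forall>t. bracket_coeff S (sqrt (w t0 / w (t0 + s))) t \<le> K)"
    using uniform_constants[OF \<delta>] \<delta> by blast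
  \<comment> \<open>With radius -1 the ball is empty, so e = 0 is admissible and no smallness is
    demanded; the whole mass is then estimated as a tail.\<close>
  have "\<not> norm t \<le> -1" for t :: "real^'n" using norm_ge_zero[of t] by linarith
  with WK have ab: "admissible_bounds \<delta> Wr K (-1) 0"
    unfolding admissible_bounds_def by blast
  from Bm_norm_bound[OF \<delta> ab zero_less_one m]
  have "Bm_norm D m (osc D \<Phi> \<theta> (induced_cover D \<Phi> \<delta>) osc_gamma)
     \<le> Bconst * (\<integral>\<^sup>+u. osc_majorant 1 0 (-1) (2 * \<delta>) (Mconst K Wr (2 * \<delta>)) u \<partial>lborel)" .
  also have "\<dots> < \<infinity>"
    unfolding osc_majorant_integral using Bconst_fin decay_mass_fin WG_mass_fin le_less_trans[OF tail_le WG_mass_fin]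
    by (simp add: ennreal_mult_less_top)
  finally show ?thesis .
qed

lemma Bm_norm_tendsto:
  assumes m: "\<And>y z \<xi> \<eta>. \<xi> \<in> D \<Longrightarrow> \<eta> \<in> D \<Longrightarrow> m (y, \<xi>) (z, \<eta>) \<le> (1 + norm (y - z)) ^ p * v\<^sub>1 (\<Phi> \<xi> - \<Phi> \<eta>)"
  shows "((\<lambda>\<delta>. Bm_norm D m (osc D \<Phi> \<theta> (induced_cover D \<Phi> \<delta>) osc_gamma)) \<longlongrightarrow> 0) (at_right 0)"
proof (rule order_tendstoI)
  fix \<epsilon> :: ennreal assume \<epsilon>: "0 < \<epsilon>"
  obtain e1 where e1: "0 < e1" "ennreal e1 < \<epsilon>"
  proof -
    obtain y where "0 < y" "y < \<epsilon>" using dense[OF \<epsilon>] by blast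
    then show ?thesis using that[of "enn2real y"]
      by (metis enn2real_positive_iff ennreal_enn2real less_top not_less_iff_gr_or_eq order_less_trans top.not_eq_extremum)
  qed
  obtain a where a: "0 \<le> a" "WG_mass = ennreal a" using WG_mass_fin by (cases WG_mass) auto
  obtain i where i: "0 \<le> i" "decay_mass = ennreal i" using decay_mass_fin by (cases decay_mass) auto
  obtain b where b: "0 \<le> b" "Bconst = ennreal b" using Bconst_fin by (cases Bconst) auto
  obtain Wr K where WK0: "\<forall>\<delta>. 0 < \<delta> \<longrightarrow> \<delta> \<le> 1 \<longrightarrow> (\<forall>t0 s S. norm s \<le> 2 * \<delta> \<longrightarrow> 0 \<le> S \<longrightarrow> S \<le> cover_diam \<delta> \<longrightarrow>
     W s \<le> Wr \<and> (\<forall>t. bracket_coeff S (sqrt (w t0 / w (t0 + s))) t \<le> K))"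
    using uniform_constants[OF zero_less_one] by blast
  have WK: "\<And>\<delta> t0 s S. 0 < \<delta> \<Longrightarrow> \<delta> \<le> 1 \<Longrightarrow> norm s \<le> 2 * \<delta> \<Longrightarrow> 0 \<le> S \<Longrightarrow> S \<le> cover_diam \<delta> \<Longrightarrow>
     W s \<le> Wr \<and> (\<forall>t. bracket_coeff S (sqrt (w t0 / w (t0 + s))) t \<le> K)"
    using WK0 by blast
  define M where "M = Mconst K Wr 2"
  have M: "0 \<le> M" unfolding M_def Mconst_def by simp
  \<comment> \<open>Each of the three terms of \<open>osc_majorant_integral\<close> is to contribute
    at most e1 / 3; the summand 1 in the denominators excludes division by 0.\<close>
  define \<kappa> where "\<kappa> = e1 / (3 * (b * a * i + 1))"
  have \<kappa>: "0 < \<kappa>" using e1 a i b by (simp add: \<kappa>_def add_nonneg_pos)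
  define \<tau> where "\<tau> = e1 * \<kappa> / (3 * (b * i * M + 1))"
  have \<tau>: "0 < \<tau>" using e1 \<kappa> i b M by (simp add: \<tau>_def add_nonneg_pos)
  obtain n :: nat where n: "tail (real n) < ennreal \<tau>" using tail_small[of "ennreal \<tau>"] \<tau> by auto
  \<comment> \<open>For \<delta> \<le> 1 the tail starts at R - 2 \<delta>, which is at least
    \<open>n\<close>.\<close>
  define R where "R = real n + 2"
  obtain vv where vv: "0 \<le> vv" "emeasure lborel {t::real^'n. norm t \<le> R} = ennreal vv"
    using emeasure_lborel_cball_finite[of "0::real^'n" R]
    by (cases "emeasure lborel {t::real^'n. norm t \<le> R}") (auto simp: cball_def dist_norm)
  define e2 where "e2 = e1 * \<kappa> / (3 * (b * i * vv + 1))"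
  have e2: "0 < e2" using e1 \<kappa> i b vv by (simp add: e2_def add_nonneg_pos)
  \<comment> \<open>The square root is taken because this bound enters the majorant squared.\<close>
  obtain \<eta> where \<eta>: "0 < \<eta>" "\<And>s S c t. norm s \<le> \<eta> \<Longrightarrow> 0 \<le> S \<Longrightarrow> S \<le> \<eta> \<Longrightarrow> \<bar>1 - c\<bar> \<le> \<eta> \<Longrightarrow> norm t \<le> R \<Longrightarrow> W t * bracket_bound S c s t \<le> sqrt e2"
    using bracket_bound_small[of "sqrt e2" R] e2 by auto
  obtain \<eta>' where \<eta>': "0 < \<eta>'" "\<And>t0 s. norm s \<le> \<eta>' \<Longrightarrow> \<bar>1 - sqrt (w t0 / w (t0 + s))\<bar> \<le> \<eta>"
    using w_ratio_near_1[OF \<eta>(1)] by auto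
  let ?a = "axis undefined 1 :: real^'n"
  \<comment> \<open>Shifts have length up to 2 \<delta>, which explains the halves; the last entry
    makes \<open>cover_diam\<close> at most \<eta>.\<close>
  define d0 where "d0 = Min {1, \<eta> / 2, \<eta>' / 2, \<eta> / (2 * v\<^sub>0 ?a)}"
  have d0: "0 < d0" "d0 \<le> 1" "d0 \<le> \<eta> / 2" "d0 \<le> \<eta>' / 2" "d0 \<le> \<eta> / (2 * v\<^sub>0 ?a)"
    using \<eta>(1) \<eta>'(1) v0_pos[of ?a] by (auto simp: d0_def)
  have main: "Bm_norm D m (osc D \<Phi> \<theta> (induced_cover D \<Phi> \<delta>) osc_gamma) < \<epsilon>" if \<delta>: "0 < \<delta>" "\<delta> < d0" for \<delta>
  proof -
    have \<delta>1: "\<delta> \<le> 1" using \<delta> d0 by linarith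
    have ed: "cover_diam \<delta> \<le> \<eta>"
    proof -
      have "cover_diam \<delta> \<le> 2 * \<delta> * v\<^sub>0 ?a"
        unfolding cover_diam_def using \<delta> \<delta>1 by (intro mult_left_mono v0_rad) auto
      also have "\<dots> \<le> 2 * (\<eta> / (2 * v\<^sub>0 ?a)) * v\<^sub>0 ?a"
        using \<delta> d0 v0_pos[of ?a] by (intro mult_right_mono mult_left_mono) auto
      also have "\<dots> = \<eta>" using v0_pos[of ?a] by simp
      finally show ?thesis .
    qed
    have ab: "admissible_bounds \<delta> Wr K R (sqrt e2)"
      unfolding admissible_bounds_def
    proof (intro allI impI conjI)
      fix t0 s :: "real^'n" and S assume s: "norm s \<le> 2 * \<delta>" and S: "0 \<le> S" "S \<le> cover_diam \<delta>"
      show "W s \<le> Wr" "bracket_coeff S (sqrt (w t0 / w (t0 + s))) t \<le> K" for t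
        using WK[OF \<delta>(1) \<delta>1 s S] by auto
      show "W t * bracket_bound S (sqrt (w t0 / w (t0 + s))) s t \<le> sqrt e2" if "norm t \<le> R" for t
        using s S ed \<delta> d0 that by (intro \<eta>(2) \<eta>'(2)) linarith+
    qed
    have Mle: "Mconst K Wr (2 * \<delta>) \<le> M"
      unfolding M_def Mconst_def using \<delta> \<delta>1 by (intro add_left_mono mult_left_mono power_mono) auto
    have tl: "tail (R - 2 * \<delta>) \<le> ennreal \<tau>"
    proof -
      have "tail (R - 2 * \<delta>) \<le> tail (real n)"
        unfolding tail_def R_def using \<delta>1 by (intro nn_integral_mono mult_left_mono) (auto simp: indicator_def)
      then show ?thesis using n by simp
    qed
    have "Bm_norm D m (osc D \<Phi> \<theta> (induced_cover D \<Phi> \<delta>) osc_gamma)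
       \<le> Bconst * (\<integral>\<^sup>+u. osc_majorant \<kappa> (sqrt e2) R (2 * \<delta>) (Mconst K Wr (2 * \<delta>)) u \<partial>lborel)"
      by (rule Bm_norm_bound[OF \<delta>(1) ab \<kappa> m])
    also have "\<dots> = ennreal b * (ennreal \<kappa> * ennreal a * ennreal i + ennreal i * (ennreal (e2 / \<kappa>) * ennreal vv + ennreal (Mconst K Wr (2 * \<delta>) / \<kappa>) * tail (R - 2 * \<delta>)))"
      unfolding osc_majorant_integral a(2) i(2) b(2) vv(2) using e2 by simp
    also have "\<dots> \<le> ennreal b * (ennreal \<kappa> * ennreal a * ennreal i + ennreal i * (ennreal (e2 / \<kappa>) * ennreal vv + ennreal (M / \<kappa>) * ennreal \<tau>))"
      using Mle \<kappa> by (intro mult_left_mono add_left_mono mult_mono tl ennreal_leI divide_right_mono) auto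
    also have "\<dots> = ennreal (b * (\<kappa> * a * i + i * (e2 / \<kappa> * vv + M / \<kappa> * \<tau>)))"
    proof -
      have "ennreal c * (ennreal k * ennreal x * ennreal j + ennreal j * (ennreal y * ennreal v + ennreal l * ennreal t))
        = ennreal (c * (k * x * j + j * (y * v + l * t)))"
        if "0 \<le> c" "0 \<le> k" "0 \<le> x" "0 \<le> j" "0 \<le> y" "0 \<le> v" "0 \<le> l" "0 \<le> t" for c k x j y v l t :: real
        using that by (simp add: ennreal_mult ennreal_plus)
      then show ?thesis using a i b vv \<kappa> \<tau> e2 M by simp
    qed
    also have "b * (\<kappa> * a * i + i * (e2 / \<kappa> * vv + M / \<kappa> * \<tau>)) \<le> e1"
    proof -
      have frac: "x * (e1 / (3 * (x + 1))) \<le> e1 / 3" if "0 \<le> x" for x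
        using that e1 by (simp add: field_simps)
      have "b * (\<kappa> * a * i) = (b * a * i) * (e1 / (3 * (b * a * i + 1)))" by (simp add: \<kappa>_def)
      also have "\<dots> \<le> e1 / 3" using a i b by (intro frac) simp
      finally have 1: "b * (\<kappa> * a * i) \<le> e1 / 3" .
      have "b * (i * (e2 / \<kappa> * vv)) = (b * i * vv) * (e1 / (3 * (b * i * vv + 1)))"
        using \<kappa> by (simp add: e2_def)
      also have "\<dots> \<le> e1 / 3" using i b vv by (intro frac) simp
      finally have 2: "b * (i * (e2 / \<kappa> * vv)) \<le> e1 / 3" .
      have "b * (i * (M / \<kappa> * \<tau>)) = (b * i * M) * (e1 / (3 * (b * i * M + 1)))"
        using \<kappa> by (simp add: \<tau>_def)
      also have "\<dots> \<le> e1 / 3" using i b M by (intro frac) simp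
      finally have 3: "b * (i * (M / \<kappa> * \<tau>)) \<le> e1 / 3" .
      have "b * (\<kappa> * a * i + i * (e2 / \<kappa> * vv + M / \<kappa> * \<tau>)) = b * (\<kappa> * a * i) + b * (i * (e2 / \<kappa> * vv)) + b * (i * (M / \<kappa> * \<tau>))"
        by (simp add: distrib_left)
      then show ?thesis using 1 2 3 by linarith
    qed
    finally have "Bm_norm D m (osc D \<Phi> \<theta> (induced_cover D \<Phi> \<delta>) osc_gamma) \<le> ennreal e1"
      by (simp add: ennreal_leI)
    then show ?thesis using e1(2) by (rule le_less_trans)
  qed
  show "eventually (\<lambda>\<delta>. Bm_norm D m (osc D \<Phi> \<theta> (induced_cover D \<Phi> \<delta>) osc_gamma) < \<epsilon>) (at_right 0)"
    using main d0(1) by (intro eventually_at_rightI[of 0 d0]) auto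
qed simp

end

section \<open>Verification of the setup and conclusion\<close>

lemma (in warping) inverse_A_bound:
  assumes fin: "warp_R D \<Phi> \<noteq> \<infinity>"
  shows "norm x \<le> enn2real (warp_R D \<Phi>) * norm (transpose (A t) *v x)"
proof -
  define J where "J = jacobian \<Phi> (at (\<Theta> t))"
  have "\<Phi> differentiable (at (\<Theta> t))" using Phi_Ck Theta_in_D[of t] by auto
  then have J: "(\<Phi> has_derivative (*v) J) (at (\<Theta> t))" unfolding J_def by (simp add: jacobian_works)
  have "((\<Phi> \<circ> \<Theta>) has_derivative ((*v) J \<circ> (*v) (A t))) (at t)"
    by (rule diff_chain_at[OF Theta_deriv J])
  moreover have "\<Phi> \<circ> \<Theta> = (\<lambda>t. t)" by auto
  ultimately have "((\<lambda>t. t) has_derivative ((*v) J \<circ> (*v) (A t))) (at t)" by simp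
  then have "((*v) J \<circ> (*v) (A t)) = (\<lambda>h. h)" using has_derivative_ident has_derivative_unique by blast
  then have "J *v (A t *v h) = h" for h by (metis comp_apply)
  then have "J ** A t = mat 1" by (simp add: matrix_eq matrix_vector_mul_assoc)
  then have AJ: "A t ** J = mat 1" by (simp add: matrix_left_right_inverse)
  then have "transpose J ** transpose (A t) = mat 1" by (metis matrix_transpose_mul transpose_mat)
  then have x: "x = transpose J *v (transpose (A t) *v x)" by (simp add: matrix_vector_mul_assoc del: transpose_matrix_vector)
  define y where "y = transpose (A t) *v x"
  define r where "r = enn2real (warp_R D \<Phi>)"
  have "ennreal (matrix_opnorm J) \<le> warp_R D \<Phi>"
    unfolding warp_R_def J_def by (rule SUP_upper) simp
  then have Jr: "matrix_opnorm J \<le> r"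
    unfolding r_def using fin onorm_pos_le[OF matrix_vector_mul_bounded_linear, of J]
    by (cases "warp_R D \<Phi>") auto
  \<comment> \<open>Pairing x with itself moves the transpose to the other side, so the operator
    norm of \<open>J\<close> itself enters, as it does in \<open>warp_R\<close>.\<close>
  have "norm x * norm x = x \<bullet> (transpose J *v y)"
    using x unfolding y_def[symmetric] by (metis power2_eq_square power2_norm_eq_inner)
  also have "\<dots> = (J *v x) \<bullet> y"
    by (subst inner_matrix_transpose) simp
  also have "\<dots> \<le> norm (J *v x) * norm y" by (rule norm_cauchy_schwarz)
  also have "\<dots> \<le> (matrix_opnorm J * norm x) * norm y"
    by (intro mult_right_mono onorm[OF matrix_vector_mul_bounded_linear]) simp
  also have "\<dots> \<le> (r * norm x) * norm y" using Jr by (intro mult_right_mono) auto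
  finally have "norm x * norm x \<le> (r * norm y) * norm x" by (simp add: mult_ac)
  then show ?thesis unfolding r_def[symmetric] y_def[symmetric]
  proof (cases "norm x = 0")
    case True
    have "0 \<le> r" by (simp add: r_def)
    then show "norm x \<le> r * norm y" using True by simp
  qed (use mult_right_le_imp_le[of "norm x" "norm x" "r * norm y"] in auto)
qed

lemma (in warped_prototype) weighted_G_square_finite:
  fixes V :: "real^'n \<Rightarrow> real"
  assumes "\<And>j m. m \<le> N \<Longrightarrow> (\<integral>\<^sup>+t. ennreal ((V t * norm (\<theta>d j m t))\<^sup>2) \<partial>lborel) < \<infinity>"
    and [measurable]: "V \<in> borel_measurable borel"
  shows "(\<integral>\<^sup>+t. ennreal ((V t * G t)\<^sup>2) \<partial>lborel) < \<infinity>"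
proof -
  let ?I = "(UNIV :: 'n set) \<times> {..N}"
  have meas: "(\<lambda>t. ennreal ((V t * norm (\<theta>d (fst k) (snd k) t))\<^sup>2)) \<in> borel_measurable lborel" if "k \<in> ?I" for k
  proof -
    have [measurable]: "\<theta>d (fst k) (snd k) \<in> borel_measurable borel"
      using that by (intro borel_measurable_continuous_onI thetad_cont) auto
    show ?thesis by measurable
  qed
  have "(V t * G t)\<^sup>2 \<le> (\<Sum>(j, m)\<in>?I. (V t * norm (\<theta>d j m t))\<^sup>2) * card ?I" for t
  proof -
    have "V t * G t = (\<Sum>k\<in>?I. V t * norm (\<theta>d (fst k) (snd k) t))"
      unfolding G_def sum.cartesian_product by (simp add: sum_distrib_left split_def)
    then show ?thesis using sum_squared_le_sum_of_squares[of "\<lambda>k. V t * norm (\<theta>d (fst k) (snd k) t)" ?I]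
      by (simp only: split_def)
  qed
  then have "(\<integral>\<^sup>+t. ennreal ((V t * G t)\<^sup>2) \<partial>lborel) \<le> (\<integral>\<^sup>+t. (\<Sum>(j, m)\<in>?I. ennreal ((V t * norm (\<theta>d j m t))\<^sup>2)) * ennreal (card ?I) \<partial>lborel)"
    by (intro nn_integral_mono)
       (simp only: split_def, subst sum_ennreal, simp, subst ennreal_mult[symmetric], auto simp: sum_nonneg intro!: ennreal_leI)
  also have "\<dots> = (\<integral>\<^sup>+t. (\<Sum>(j, m)\<in>?I. ennreal ((V t * norm (\<theta>d j m t))\<^sup>2)) \<partial>lborel) * ennreal (card ?I)"
    unfolding split_def by (rule nn_integral_multc[OF borel_measurable_sum[OF meas]])
  also have "(\<integral>\<^sup>+t. (\<Sum>(j, m)\<in>?I. ennreal ((V t * norm (\<theta>d j m t))\<^sup>2)) \<partial>lborel)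
     = (\<Sum>k\<in>?I. \<integral>\<^sup>+t. ennreal ((V t * norm (\<theta>d (fst k) (snd k) t))\<^sup>2) \<partial>lborel)"
    unfolding split_def by (rule nn_integral_sum[OF meas])
  also have "\<dots> * ennreal (card ?I) < \<infinity>"
    using assms(1) by (auto simp: ennreal_mult_less_top)
  finally show ?thesis .
qed

theorem theorem6p1:
  fixes D :: "(real^'n::finite) set"
    and \<Phi> :: "real^'n \<Rightarrow> real^'n"
    and v\<^sub>0 v\<^sub>1 w\<^sub>2 :: "real^'n \<Rightarrow> real"
    and p :: nat
    and m :: "'n phase \<Rightarrow> 'n phase \<Rightarrow> real"
    and \<theta> :: "real^'n \<Rightarrow> complex"
    and \<Gamma> :: "'n phase \<Rightarrow> 'n phase \<Rightarrow> complex"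
  assumes "open D" and "D \<noteq> {}"
    and "admissible_warping (CARD('n) + p + 1) D \<Phi> v\<^sub>0"
    and "warp_R D \<Phi> = \<infinity> \<longrightarrow> p = 0"
    and "weight_on (phase_space D \<times> phase_space D) (\<lambda>(\<kappa>, \<rho>). m \<kappa> \<rho>)"
    and "\<forall>\<kappa>\<in>phase_space D. \<forall>\<rho>\<in>phase_space D. m \<kappa> \<rho> = m \<rho> \<kappa>"
    and "weight_on UNIV v\<^sub>1" and "continuous_on UNIV v\<^sub>1" and "submultiplicative v\<^sub>1"
    and "\<forall>\<upsilon>. v\<^sub>1 \<upsilon> = v\<^sub>1 (- \<upsilon>)"
    and "\<forall>y z. \<forall>\<xi>\<in>D. \<forall>\<eta>\<in>D.
           m (y, \<xi>) (z, \<eta>) \<le> (1 + norm (y - z)) ^ p * v\<^sub>1 (\<Phi> \<xi> - \<Phi> \<eta>)"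
    and "w\<^sub>2 = (\<lambda>\<upsilon>. (1 + norm \<upsilon>) ^ (CARD('n) + 1) * v\<^sub>1 \<upsilon> *
           v\<^sub>0 \<upsilon> powr (9 * real CARD('n) / 2 + 3 * real p + 3))"
    and "Ck_on (CARD('n) + p + 1) UNIV \<theta>"
    and "\<forall>j. \<forall>n \<le> CARD('n) + p + 1.
           (\<lambda>\<upsilon>. of_real (v\<^sub>0 \<upsilon> ^ n) * ((partial_deriv j ^^ (CARD('n) + p + 1 - n)) \<theta>) \<upsilon>)
             \<in> L2_weighted w\<^sub>2"
    and "\<Gamma> = (\<lambda>(y, \<omega>) (z, \<eta>). exp (- 2 * of_real pi * \<i> * of_real ((y - z) \<bullet> \<omega>)))"
  shows "(\<forall>\<delta>>0. Bm_norm D m (osc D \<Phi> \<theta> (induced_cover D \<Phi> \<delta>) \<Gamma>) < \<infinity>) \<and>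
         ((\<lambda>\<delta>. Bm_norm D m (osc D \<Phi> \<theta> (induced_cover D \<Phi> \<delta>) \<Gamma>)) \<longlongrightarrow> 0) (at_right 0)"
proof -
  let ?N = "CARD('n) + p + 1"
  let ?V = "\<lambda>t. poly_weight t * v\<^sub>1 t * v\<^sub>0 t powr (9 * real CARD('n) / 2 + 3 * real p + 3)"
  interpret warped_prototype D \<Phi> v\<^sub>0 ?N \<theta>
    by unfold_locales (use assms in auto)
  have v1: "continuous_on UNIV v\<^sub>1" "\<And>t. 0 < v\<^sub>1 t" "\<And>a b. v\<^sub>1 (a + b) \<le> v\<^sub>1 a * v\<^sub>1 b" "\<And>t. v\<^sub>1 (- t) = v\<^sub>1 t"
    using assms(7-10) by (auto simp: weight_on_def submultiplicative_def)
  have w2: "w\<^sub>2 = ?V" unfolding assms(12) poly_weight_def by simp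
  have Vm [measurable]: "?V \<in> borel_measurable borel"
  proof -
    have [measurable]: "v\<^sub>1 \<in> borel_measurable borel" by (rule borel_measurable_continuous_onI[OF v1(1)])
    show ?thesis by measurable
  qed
  have fin: "(\<integral>\<^sup>+t. ennreal ((?V t * G t)\<^sup>2) \<partial>lborel) < \<infinity>"
  proof (rule weighted_G_square_finite[OF _ Vm])
    fix j and k :: nat assume k: "k \<le> ?N"
    let ?f = "\<lambda>x. of_real (v\<^sub>0 x ^ (?N - k)) * (partial_deriv j ^^ k) \<theta> x"
    have "?f \<in> L2_weighted w\<^sub>2" using assms(14)[rule_format, of "?N - k" j] k by simp
    then have L: "(\<integral>\<^sup>+x. ennreal ((norm (w\<^sub>2 x * ?f x))\<^sup>2) \<partial>lborel) < \<infinity>"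
      by (simp add: L2_weighted_def nn_integral_completion)
    \<comment> \<open>Since \<open>v\<^sub>0\<close> is at least 1, the hypothesis of index ?N - k
      controls the k-th pure derivative in the weight \<open>w\<^sub>2\<close>.\<close>
    have "(?V t * norm ((partial_deriv j ^^ k) \<theta> t))\<^sup>2 \<le> (norm (w\<^sub>2 t * ?f t))\<^sup>2" for t
    proof (rule power_mono)
      have V0: "0 \<le> ?V t" using poly_weight_pos[of t] v1(2)[of t] by simp
      have "1 * norm ((partial_deriv j ^^ k) \<theta> t) \<le> v\<^sub>0 t ^ (?N - k) * norm ((partial_deriv j ^^ k) \<theta> t)"
        by (intro mult_right_mono one_le_power v0_ge_1) simp
      then have "?V t * norm ((partial_deriv j ^^ k) \<theta> t) \<le> ?V t * (v\<^sub>0 t ^ (?N - k) * norm ((partial_deriv j ^^ k) \<theta> t))"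
        using V0 by (intro mult_left_mono) auto
      also have "\<dots> = norm (w\<^sub>2 t * ?f t)"
        unfolding w2 norm_mult norm_of_real using V0 v0_pos[of t] by (simp add: abs_of_nonneg)
      finally show "?V t * norm ((partial_deriv j ^^ k) \<theta> t) \<le> norm (w\<^sub>2 t * ?f t)" .
      show "0 \<le> ?V t * norm ((partial_deriv j ^^ k) \<theta> t)" using V0 by simp
    qed
    then show "(\<integral>\<^sup>+t. ennreal ((?V t * norm ((partial_deriv j ^^ k) \<theta> t))\<^sup>2) \<partial>lborel) < \<infinity>"
      by (intro le_less_trans[OF nn_integral_mono L] ennreal_leI)
  qed
  \<comment> \<open>For p > 0 the value \<infinity> of \<open>warp_R\<close> is excluded, so its
    real part is the true bound; for p = 0 the locale asks for no such bound.\<close>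
  interpret osc_setup D \<Phi> v\<^sub>0 ?N \<theta> v\<^sub>1 p "enn2real (warp_R D \<Phi>)"
  proof
    show "norm x \<le> enn2real (warp_R D \<Phi>) * norm (transpose (warp_A D \<Phi> t) *v x)" if "0 < p" for x t
      using assms(4) that by (intro inverse_A_bound) auto
  qed (use v1 fin in auto)
  have \<Gamma>: "\<Gamma> = osc_gamma" unfolding assms(15) osc_gamma_def ..
  have m: "m (y, \<xi>) (z, \<eta>) \<le> (1 + norm (y - z)) ^ p * v\<^sub>1 (\<Phi> \<xi> - \<Phi> \<eta>)" if "\<xi> \<in> D" "\<eta> \<in> D" for y z \<xi> \<eta>
    using assms(11) that by blast
  show ?thesis
    unfolding \<Gamma> using Bm_norm_fin[of _ m, OF _ m] Bm_norm_tendsto[of m, OF m] by blast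
qed

end
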